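(* Let $\Omega\subseteq\mathbb R^n$ be an open, bounded, connected, polytopal Lipschitz domain, $\Sigma=H(\operatorname{div},\Omega)$ and $U=L^2(\Omega)$. Let $\mathcal T$ be a partition of $\overline\Omega$ into convex polytopes with maximal element diameter $h=\max_{T\in\mathcal T}\operatorname{diam}(T)$. Let $\Sigma_h\subseteq\Sigma$ and $U_h\subseteq U$ be finite-dimensional subspaces that are inf-sup stable, i.e. $$0<\inf_{v_h\in U_h\setminus\{0\}}\sup_{\tau_h\in\Sigma_h\setminus\{0\}}\frac{(\operatorname{div}\tau_h,v_h)_{L^2(\Omega)}}{\|\tau_h\|_{H(\operatorname{div},\Omega)}\|v_h\|_{L^2(\Omega)}},$$ with $P_0(\mathcal T)\subseteq U_h$ and $\operatorname{div}\Sigma_h\subseteq U_h$. Then, for every $J\in\{1,\dots,\dim U_h\}$, the $J$th eigenvalue $\lambda_J$ of the Dirichlet-Laplacian in mixed form and the $J$th discrete eigenvalue $\lambda_{J,h}$ (both defined in the context) satisfy $$\frac{\lambda_{J,h}}{1+(h^2/\pi^2)\lambda_{J,h}}\le\lambda_J .$$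
   Context: $H(\operatorname{div},\Omega)$ is the space of vector fields in $[L^2(\Omega)]^n$ with distributional divergence in $L^2(\Omega)$. $P_0(\mathcal T)$ is the space of functions that are constant on each $T\in\mathcal T$. Continuous problem: find $(\lambda,u)\in\mathbb R\times U$, $u\ne0$, such that with $\sigma\in\Sigma$ $$(\sigma,\tau)_{L^2(\Omega)}+(\operatorname{div}\tau,u)_{L^2(\Omega)}=0\ \ \forall\tau\in\Sigma,\qquad(\operatorname{div}\sigma,v)_{L^2(\Omega)}=-\lambda(u,v)_{L^2(\Omega)}\ \ \forall v\in U.$$ Its eigenvalues, enumerated with multiplicity as $0<\lambda_1\le\lambda_2\le\cdots$, are those of $-\Delta u=\lambda u$ in $\Omega$, $u=0$ on $\partial\Omega$ (weakly, $u\in H^1_0(\Omega)\setminus\{0\}$). Discrete problem: find $(\lambda_h,u_h)\in\mathbb R\times U_h$, $\|u_h\|_{L^2(\Omega)}=1$, such that with $\sigma_h\in\Sigma_h$ $$(\sigma_h,\tau_h)_{L^2(\Omega)}+(\operatorname{div}\tau_h,u_h)_{L^2(\Omega)}=0\ \ \forall\tau_h\in\Sigma_h,\qquad(\operatorname{div}\sigma_h,v_h)_{L^2(\Omega)}=-\lambda_h(u_h,v_h)_{L^2(\Omega)}\ \ \forall v_h\in U_h.$$ Its eigenvalues are enumerated with multiplicity as $0<\lambda_{1,h}\le\lambda_{2,h}\le\cdots$. *)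

theory Defs
  imports "HOL-Analysis.Analysis"
begin

section \<open>Square-integrable functions\<close>

definition square_integrable :: "('a::euclidean_space \<Rightarrow> 'b::euclidean_space) \<Rightarrow> bool" where
  "square_integrable f \<longleftrightarrow>
     f \<in> borel_measurable lborel \<and> integrable lborel (\<lambda>x. (norm (f x))\<^sup>2)"

lemma square_integrable_zero: "square_integrable (\<lambda>x. 0)"
  by (simp add: square_integrable_def)

lemma square_integrable_scaleR:
  assumes "square_integrable f"
  shows "square_integrable (\<lambda>x. c *\<^sub>R f x)"
  using assms by (auto simp: square_integrable_def power_mult_distrib)

lemma square_integrable_add:
  assumes f: "square_integrable f" and g: "square_integrable g"
  shows "square_integrable (\<lambda>x. f x + g x)"
proof -
  have [measurable]: "f \<in> borel_measurable lborel" "g \<in> borel_measurable lborel"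
    using f g by (auto simp: square_integrable_def)
  have le: "(norm (u + v))\<^sup>2 \<le> 2 * (norm u)\<^sup>2 + 2 * (norm v)\<^sup>2" for u v :: 'b
  proof -
    have "(norm (u + v))\<^sup>2 \<le> (norm u + norm v)\<^sup>2"
      by (intro power_mono norm_triangle_ineq) auto
    also have "\<dots> \<le> 2 * (norm u)\<^sup>2 + 2 * (norm v)\<^sup>2"
      using zero_le_power2[of "norm u - norm v"] by (simp add: power2_eq_square algebra_simps)
    finally show ?thesis .
  qed
  have "integrable lborel (\<lambda>x. 2 * (norm (f x))\<^sup>2 + 2 * (norm (g x))\<^sup>2)"
    using f g by (auto simp: square_integrable_def)
  then have "integrable lborel (\<lambda>x. (norm (f x + g x))\<^sup>2)"
    by (rule Bochner_Integration.integrable_bound) (auto simp: le)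
  then show ?thesis by (simp add: square_integrable_def)
qed

lemma square_integrable_uminus:
  assumes "square_integrable f"
  shows "square_integrable (\<lambda>x. - f x)"
  using square_integrable_scaleR[OF assms, of "-1"] by simp

lemma square_integrable_diff:
  assumes "square_integrable f" "square_integrable g"
  shows "square_integrable (\<lambda>x. f x - g x)"
  using square_integrable_add[OF assms(1) square_integrable_uminus[OF assms(2)]] by simp

lemma square_integrable_inner:
  assumes f: "square_integrable f" and g: "square_integrable g"
  shows "integrable lborel (\<lambda>x. f x \<bullet> g x)"
proof -
  have [measurable]: "f \<in> borel_measurable lborel" "g \<in> borel_measurable lborel"
    using f g by (auto simp: square_integrable_def)
  have le: "\<bar>u \<bullet> v\<bar> \<le> (norm u)\<^sup>2 + (norm v)\<^sup>2" for u v :: 'b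
  proof -
    have "\<bar>u \<bullet> v\<bar> \<le> norm u * norm v" by (rule Cauchy_Schwarz_ineq2)
    also have "\<dots> \<le> 2 * (norm u * norm v)" by simp
    also have "\<dots> \<le> (norm u)\<^sup>2 + (norm v)\<^sup>2"
      using zero_le_power2[of "norm u - norm v"] by (simp add: power2_eq_square algebra_simps)
    finally show ?thesis .
  qed
  have "integrable lborel (\<lambda>x. (norm (f x))\<^sup>2 + (norm (g x))\<^sup>2)"
    using f g by (auto simp: square_integrable_def)
  then show ?thesis
    by (rule Bochner_Integration.integrable_bound) (auto simp: le)
qed

section \<open>The Hilbert space of square-integrable functions modulo null sets\<close>

quotient_type (overloaded) ('a, 'b) L2 = "'a::euclidean_space \<Rightarrow> 'b::euclidean_space" /
  partial: "\<lambda>f g. square_integrable f \<and> square_integrable g \<and> (AE x in lborel. f x = g x)"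
  morphisms rep_L2 abs_L2
proof (rule part_equivpI)
  show "\<exists>x::'a \<Rightarrow> 'b. square_integrable x \<and> square_integrable x \<and> (AE y in lborel. x y = x y)"
    using square_integrable_zero by blast
  show "symp (\<lambda>f g :: 'a \<Rightarrow> 'b. square_integrable f \<and> square_integrable g \<and> (AE x in lborel. f x = g x))"
    by (auto intro!: sympI)
  show "transp (\<lambda>f g :: 'a \<Rightarrow> 'b. square_integrable f \<and> square_integrable g \<and> (AE x in lborel. f x = g x))"
    by (auto intro!: transpI)
qed

lemma square_integrable_rep_L2: "square_integrable (rep_L2 f)"
  using Quotient_rep_reflp[OF Quotient_L2] by blast

lemma rep_abs_L2:
  assumes "square_integrable f"
  shows "AE x in lborel. rep_L2 (abs_L2 f) x = f x"
  using Quotient_rep_abs[OF Quotient_L2, of f] assms by blast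

instantiation L2 :: (euclidean_space, euclidean_space) real_inner
begin

lift_definition zero_L2 :: "('a, 'b) L2" is "\<lambda>x. 0"
  by (auto simp: square_integrable_zero)

lift_definition plus_L2 :: "('a, 'b) L2 \<Rightarrow> ('a, 'b) L2 \<Rightarrow> ('a, 'b) L2"
  is "\<lambda>f g x. f x + g x"
  by (auto intro: square_integrable_add)

lift_definition minus_L2 :: "('a, 'b) L2 \<Rightarrow> ('a, 'b) L2 \<Rightarrow> ('a, 'b) L2"
  is "\<lambda>f g x. f x - g x"
  by (auto intro: square_integrable_diff)

lift_definition uminus_L2 :: "('a, 'b) L2 \<Rightarrow> ('a, 'b) L2" is "\<lambda>f x. - f x"
  by (auto intro: square_integrable_uminus)

lift_definition scaleR_L2 :: "real \<Rightarrow> ('a, 'b) L2 \<Rightarrow> ('a, 'b) L2" is "\<lambda>c f x. c *\<^sub>R f x"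
  by (auto intro: square_integrable_scaleR)

lift_definition inner_L2 :: "('a, 'b) L2 \<Rightarrow> ('a, 'b) L2 \<Rightarrow> real"
  is "\<lambda>f g. integral\<^sup>L lborel (\<lambda>x. f x \<bullet> g x)"
proof -
  fix f f' g g' :: "'a \<Rightarrow> 'b"
  assume 1: "square_integrable f \<and> square_integrable f' \<and> (AE x in lborel. f x = f' x)"
    and 2: "square_integrable g \<and> square_integrable g' \<and> (AE x in lborel. g x = g' x)"
  have "AE x in lborel. f x \<bullet> g x = f' x \<bullet> g' x" using 1 2 by auto
  moreover have "(\<lambda>x. f x \<bullet> g x) \<in> borel_measurable lborel" "(\<lambda>x. f' x \<bullet> g' x) \<in> borel_measurable lborel"
    using 1 2 square_integrable_inner borel_measurable_integrable by blast+
  ultimately show "integral\<^sup>L lborel (\<lambda>x. f x \<bullet> g x) = integral\<^sup>L lborel (\<lambda>x. f' x \<bullet> g' x)"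
    by (intro integral_cong_AE)
qed

definition norm_L2 :: "('a, 'b) L2 \<Rightarrow> real" where "norm_L2 f = sqrt (inner f f)"

definition dist_L2 :: "('a, 'b) L2 \<Rightarrow> ('a, 'b) L2 \<Rightarrow> real" where "dist_L2 f g = norm (f - g)"

definition sgn_L2 :: "('a, 'b) L2 \<Rightarrow> ('a, 'b) L2" where "sgn_L2 f = inverse (norm f) *\<^sub>R f"

definition uniformity_L2 :: "(('a, 'b) L2 \<times> ('a, 'b) L2) filter" where
  "uniformity_L2 = (INF e\<in>{0<..}. principal {(x, y). dist x y < e})"

definition open_L2 :: "('a, 'b) L2 set \<Rightarrow> bool" where
  "open_L2 U = (\<forall>x\<in>U. eventually (\<lambda>(x', y). x' = x \<longrightarrow> y \<in> U) uniformity)"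

instance
proof
  fix f g k :: "('a, 'b) L2" and a b :: real
  show "f + g + k = f + (g + k)"
    by transfer (auto intro: square_integrable_add simp: algebra_simps)
  show "f + g = g + f"
    by transfer (auto intro: square_integrable_add simp: algebra_simps)
  show "0 + f = f" by transfer auto
  show "- f + f = 0" by transfer (auto simp: square_integrable_zero)
  show "f - g = f + - g"
    by transfer (auto intro: square_integrable_diff square_integrable_add square_integrable_uminus)
  show "a *\<^sub>R (f + g) = a *\<^sub>R f + a *\<^sub>R g"
    by transfer (auto intro!: square_integrable_add square_integrable_scaleR simp: scaleR_add_right)
  show "(a + b) *\<^sub>R f = a *\<^sub>R f + b *\<^sub>R f"
    by transfer (auto intro!: square_integrable_add square_integrable_scaleR simp: scaleR_add_left)
  show "a *\<^sub>R b *\<^sub>R f = (a * b) *\<^sub>R f"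
    by transfer (auto intro!: square_integrable_scaleR)
  show "1 *\<^sub>R f = f" by transfer auto
  show "inner f g = inner g f" by transfer (simp add: inner_commute)
  show "inner (f + g) k = inner f k + inner g k"
  proof transfer
    fix f g k :: "'a \<Rightarrow> 'b"
    assume "square_integrable f \<and> square_integrable f \<and> (AE x in lborel. f x = f x)"
      "square_integrable g \<and> square_integrable g \<and> (AE x in lborel. g x = g x)"
      "square_integrable k \<and> square_integrable k \<and> (AE x in lborel. k x = k x)"
    then show "(LINT x|lborel. (f x + g x) \<bullet> k x) = (LINT x|lborel. f x \<bullet> k x) + (LINT x|lborel. g x \<bullet> k x)"
      by (simp add: inner_add_left square_integrable_inner)
  qed
  show "inner (a *\<^sub>R f) g = a * inner f g" by transfer simp
  show "0 \<le> inner f f" by transfer simp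
  show "(inner f f = 0) = (f = 0)"
  proof transfer
    fix f :: "'a \<Rightarrow> 'b"
    assume f: "square_integrable f \<and> square_integrable f \<and> (AE x in lborel. f x = f x)"
    then have "integrable lborel (\<lambda>x. f x \<bullet> f x)" by (simp add: square_integrable_inner)
    then have "((LINT x|lborel. f x \<bullet> f x) = 0) = (AE x in lborel. f x \<bullet> f x = 0)"
      by (intro integral_nonneg_eq_0_iff_AE) auto
    then show "((LINT x|lborel. f x \<bullet> f x) = 0) =
        (square_integrable f \<and> square_integrable (\<lambda>x. 0::'b) \<and> (AE x in lborel. f x = 0))"
      using f by (simp add: square_integrable_zero)
  qed
  show "norm f = sqrt (inner f f)" by (rule norm_L2_def)
  show "dist f g = norm (f - g)" by (rule dist_L2_def)
  show "sgn f = inverse (norm f) *\<^sub>R f" by (rule sgn_L2_def)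
  show "(uniformity :: (('a, 'b) L2 \<times> ('a, 'b) L2) filter) =
      (INF e\<in>{0<..}. principal {(x, y). dist x y < e})"
    by (rule uniformity_L2_def)
  show "open U = (\<forall>x\<in>U. \<forall>\<^sub>F (x', y) in uniformity. x' = x \<longrightarrow> y \<in> U)" for U :: "('a, 'b) L2 set"
    by (rule open_L2_def)
qed

end

text \<open>The space of square-integrable functions on \<open>\<Omega>\<close>, embedded isometrically into
  \<^typ>\<open>('a, 'b) L2\<close> by extension by zero.\<close>

definition L2_on :: "'a::euclidean_space set \<Rightarrow> ('a, 'b::euclidean_space) L2 set" where
  "L2_on \<Omega> = {f. AE x in lborel. x \<notin> \<Omega> \<longrightarrow> rep_L2 f x = 0}"

section \<open>Distributional divergence\<close>

primrec C_k :: "nat \<Rightarrow> ('a::euclidean_space \<Rightarrow> real) \<Rightarrow> bool" where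
  "C_k 0 f \<longleftrightarrow> continuous_on UNIV f"
| "C_k (Suc k) f \<longleftrightarrow> (\<forall>x. f differentiable at x) \<and>
     (\<forall>b\<in>Basis. C_k k (\<lambda>x. frechet_derivative f (at x) b))"

definition test_function :: "'a::euclidean_space set \<Rightarrow> ('a \<Rightarrow> real) \<Rightarrow> bool" where
  "test_function \<Omega> \<phi> \<longleftrightarrow> (\<forall>k. C_k k \<phi>) \<and>
     compact (closure {x. \<phi> x \<noteq> 0}) \<and> closure {x. \<phi> x \<noteq> 0} \<subseteq> \<Omega>"

text \<open>The Frechet derivative of \<open>\<phi>\<close> at \<open>x\<close> in direction \<open>\<sigma> x\<close> is the inner product of
  \<open>\<sigma> x\<close> with the gradient of \<open>\<phi>\<close> at \<open>x\<close>.\<close>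

definition is_weak_div :: "'a::euclidean_space set \<Rightarrow> ('a, 'a) L2 \<Rightarrow> ('a, real) L2 \<Rightarrow> bool" where
  "is_weak_div \<Omega> \<sigma> d \<longleftrightarrow> (\<forall>\<phi>. test_function \<Omega> \<phi> \<longrightarrow>
     (LINT x|lborel. frechet_derivative \<phi> (at x) (rep_L2 \<sigma> x)) =
     - (LINT x|lborel. rep_L2 d x * \<phi> x))"

definition Hdiv :: "'a::euclidean_space set \<Rightarrow> ('a, 'a) L2 set" where
  "Hdiv \<Omega> = {\<sigma> \<in> L2_on \<Omega>. \<exists>d\<in>L2_on \<Omega>. is_weak_div \<Omega> \<sigma> d}"

definition divg :: "'a::euclidean_space set \<Rightarrow> ('a, 'a) L2 \<Rightarrow> ('a, real) L2" where
  "divg \<Omega> \<sigma> = (THE d. d \<in> L2_on \<Omega> \<and> is_weak_div \<Omega> \<sigma> d)"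

definition norm_Hdiv :: "'a::euclidean_space set \<Rightarrow> ('a, 'a) L2 \<Rightarrow> real" where
  "norm_Hdiv \<Omega> \<sigma> = sqrt ((norm \<sigma>)\<^sup>2 + (norm (divg \<Omega> \<sigma>))\<^sup>2)"

section \<open>Domains and partitions\<close>

text \<open>Near each boundary point, \<open>\<Omega>\<close> is the strict epigraph, in some unit direction \<open>e\<close>, of
  a Lipschitz function \<open>g\<close> of the component orthogonal to \<open>e\<close>.\<close>

definition Lipschitz_domain :: "'a::euclidean_space set \<Rightarrow> bool" where
  "Lipschitz_domain \<Omega> \<longleftrightarrow> (\<forall>x\<in>frontier \<Omega>. \<exists>r>0. \<exists>e. \<exists>C. \<exists>g. norm e = 1 \<and>
     C-lipschitz_on {y. y \<bullet> e = 0} g \<and>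
     (\<forall>y\<in>ball x r. y \<in> \<Omega> \<longleftrightarrow> y \<bullet> e > (g (y - (y \<bullet> e) *\<^sub>R e) :: real)))"

definition polytopal :: "'a::euclidean_space set \<Rightarrow> bool" where
  "polytopal \<Omega> \<longleftrightarrow> (\<exists>\<P>. finite \<P> \<and> (\<forall>P\<in>\<P>. polytope P) \<and> closure \<Omega> = \<Union>\<P>)"

text \<open>Elements are full-dimensional closed convex polytopes. Hanging nodes are allowed.\<close>

definition polytopal_partition :: "'a::euclidean_space set set \<Rightarrow> 'a set \<Rightarrow> bool" where
  "polytopal_partition \<T> A \<longleftrightarrow> finite \<T> \<and> (\<forall>T\<in>\<T>. polytope T \<and> interior T \<noteq> {}) \<and>
     \<Union>\<T> = A \<and> pairwise (\<lambda>S T. interior S \<inter> interior T = {}) \<T>"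

definition P0 :: "'a::euclidean_space set \<Rightarrow> 'a set set \<Rightarrow> ('a, real) L2 set" where
  "P0 \<Omega> \<T> = {v \<in> L2_on \<Omega>. \<forall>T\<in>\<T>. \<exists>c. AE x in lborel. x \<in> T \<longrightarrow> rep_L2 v x = c}"

section \<open>The mixed eigenvalue problem\<close>

definition finite_dim_subspace :: "'v::real_vector set \<Rightarrow> bool" where
  "finite_dim_subspace V \<longleftrightarrow> subspace V \<and> (\<exists>B. finite B \<and> V = span B)"

text \<open>Taken in \<^typ>\<open>ereal\<close>, so that a supremum over the empty set is \<open>-\<infinity>\<close>.\<close>

definition inf_sup_stable ::
  "'a::euclidean_space set \<Rightarrow> ('a, 'a) L2 set \<Rightarrow> ('a, real) L2 set \<Rightarrow> bool" where
  "inf_sup_stable \<Omega> S U \<longleftrightarrow>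
     0 < (INF v\<in>U - {0}. SUP \<tau>\<in>S - {0}.
            ereal (inner (divg \<Omega> \<tau>) v / (norm_Hdiv \<Omega> \<tau> * norm v)))"

text \<open>The solutions \<open>u\<close> of the mixed problem posed in \<open>S \<times> U\<close> for the parameter \<open>\<mu>\<close>,
  together with 0.\<close>

definition mixed_eigenspace ::
  "'a::euclidean_space set \<Rightarrow> ('a, 'a) L2 set \<Rightarrow> ('a, real) L2 set \<Rightarrow> real \<Rightarrow> ('a, real) L2 set" where
  "mixed_eigenspace \<Omega> S U \<mu> = {u \<in> U. \<exists>\<sigma>\<in>S.
     (\<forall>\<tau>\<in>S. inner \<sigma> \<tau> + inner (divg \<Omega> \<tau>) u = 0) \<and>
     (\<forall>v\<in>U. inner (divg \<Omega> \<sigma>) v = - \<mu> * inner u v)}"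

definition mixed_eigenvalue ::
  "'a::euclidean_space set \<Rightarrow> ('a, 'a) L2 set \<Rightarrow> ('a, real) L2 set \<Rightarrow> real \<Rightarrow> bool" where
  "mixed_eigenvalue \<Omega> S U \<mu> \<longleftrightarrow> (\<exists>u\<in>mixed_eigenspace \<Omega> S U \<mu>. u \<noteq> 0)"

text \<open>\<open>l\<close> lists, in nondecreasing order along the index set \<open>I\<close>, exactly the eigenvalues of the
  mixed problem, each as often as the dimension of its eigenspace.\<close>

definition eigenvalue_enumeration ::
  "'a::euclidean_space set \<Rightarrow> ('a, 'a) L2 set \<Rightarrow> ('a, real) L2 set \<Rightarrow> nat set \<Rightarrow> (nat \<Rightarrow> real) \<Rightarrow> bool" where
  "eigenvalue_enumeration \<Omega> S U I l \<longleftrightarrow> mono_on I l \<and>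
     (\<forall>j\<in>I. mixed_eigenvalue \<Omega> S U (l j)) \<and>
     (\<forall>\<mu>. mixed_eigenvalue \<Omega> S U \<mu> \<longrightarrow>
        finite_dim_subspace (mixed_eigenspace \<Omega> S U \<mu>) \<and>
        card {j\<in>I. l j = \<mu>} = dim (mixed_eigenspace \<Omega> S U \<mu>))"

end

theory Submission
  imports Defs
begin

text \<open>
  A dimension count yields some \<open>u \<noteq> 0\<close> in the span of eigenfunctions for \<open>\<lambda>\<^sub>1, \<dots>, \<lambda>\<^sub>J\<close> whose projection \<open>x\<close> to \<open>U\<^sub>h\<close>
  lies in the span of discrete eigenfunctions for \<open>\<lambda>\<^sub>J\<^sub>,\<^sub>h, \<lambda>\<^sub>J\<^sub>+\<^sub>1\<^sub>,\<^sub>h, \<dots>\<close>. As \<open>div S\<^sub>h \<subseteq> U\<^sub>h\<close>, the discrete flux of \<open>x\<close> is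
  the projection to \<open>S\<^sub>h\<close> of the flux \<open>\<sigma> = \<nabla>u\<close>, so that \<open>\<lambda>\<^sub>J\<^sub>,\<^sub>h \<parallel>x\<parallel>\<^sup>2 \<le> \<parallel>\<sigma>\<parallel>\<^sup>2 \<le> \<lambda>\<^sub>J \<parallel>u\<parallel>\<^sup>2\<close>. As \<open>P\<^sub>0 \<subseteq> U\<^sub>h\<close>, the
  Payne--Weinberger inequality on each element gives \<open>\<parallel>u\<parallel>\<^sup>2 - \<parallel>x\<parallel>\<^sup>2 = \<parallel>u - x\<parallel>\<^sup>2 \<le> (h / \<pi>)\<^sup>2 \<parallel>\<sigma>\<parallel>\<^sup>2\<close>, and the claim
  follows by eliminating \<open>x\<close> and \<open>\<sigma>\<close>.

  The Payne--Weinberger inequality is reduced to smooth functions by mollification. A counterexample on a convex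
  body survives on one of the two halves when the body is cut by a hyperplane on both sides of which the function
  has mean zero; suitable nested cuts shrink to a segment. Close to the segment the problem is one-dimensional with
  a weight that is log-concave by the Brunn--Minkowski inequality, and there the constant is the square of
  length over \<open>\<pi>\<close>.
\<close>

section \<open>Projections and spectral subspaces\<close>

text \<open>No smallness of the mesh is involved. A min-max argument on the projected eigenfunctions
  would require the projection to be injective on them. Here spans of dimension at least J and N - J
  + 1 are compared in a space of dimension N, so a suitable u always exists; its projection may
  vanish, and only u is divided by.

  The continuous flux is known only through its equation against H(div). Testing with r h, where r
  is a C^1 function on the whole space and h a constant vector, shows that the extension of u by
  zero has the extended flux as weak gradient. Mollification can therefore be done on the whole
  space, and element boundaries never enter it.

  The number pi comes from an interval of length L, whose first Dirichlet eigenvalue is pi^2 / L^2.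
  Dirichlet conditions appear because the primitive of a weighted function of mean zero vanishes at
  both ends. All pieces of a cut element lie in that element, so its diameter bounds L throughout.
  Needles are only nearly one-dimensional; a strict slack kept in the assumed counterexample absorbs
  the difference.\<close>

lemma orthogonal_projection_span_exists:
  fixes u :: "'v::real_inner"
  assumes "finite B"
  shows "\<exists>p\<in>span B. \<forall>w\<in>span B. inner (u - p) w = 0"
  using assms
proof (induction B arbitrary: u rule: finite_induct)
  case empty
  then show ?case by auto
next
  case (insert b B)
  obtain pb where pb: "pb \<in> span B" "\<And>w. w \<in> span B \<Longrightarrow> inner (b - pb) w = 0"
    using insert.IH[of b] by blast
  obtain pu where pu: "pu \<in> span B" "\<And>w. w \<in> span B \<Longrightarrow> inner (u - pu) w = 0"
    using insert.IH[of u] by blast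
  define c where "c = b - pb"
  \<comment> \<open>If \<open>b\<close> already lies in \<open>span B\<close> then
    \<open>c = 0\<close>, the quotient is 0 by the convention on division, and the identity
    \<open>inner (u - pu) c = t * inner c c\<close> used below still holds.\<close>
  define t where "t = inner (u - pu) c / inner c c"
  have span_insert_c: "\<exists>k. \<exists>w'\<in>span B. w = k *\<^sub>R c + w'" if "w \<in> span (insert b B)" for w
  proof -
    from that obtain k where k: "w - k *\<^sub>R b \<in> span B" by (auto simp: span_insert)
    have "w = k *\<^sub>R c + ((w - k *\<^sub>R b) + k *\<^sub>R pb)" by (simp add: c_def algebra_simps)
    moreover have "(w - k *\<^sub>R b) + k *\<^sub>R pb \<in> span B"
      using k pb by (intro span_add span_scale)
    ultimately show ?thesis by blast
  qed
  have sub: "span B \<subseteq> span (insert b B)" by (intro span_mono) auto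
  have "c \<in> span (insert b B)"
    unfolding c_def using pb(1) sub by (intro span_diff) (auto intro: span_base)
  then have "pu + t *\<^sub>R c \<in> span (insert b B)"
    using pu(1) sub by (intro span_add span_scale) auto
  moreover have "inner (u - (pu + t *\<^sub>R c)) w = 0" if "w \<in> span (insert b B)" for w
  proof -
    from span_insert_c[OF that] obtain k w' where w: "w' \<in> span B" "w = k *\<^sub>R c + w'" by blast
    have "inner c w' = 0" "inner (u - pu) w' = 0" using pb(2) pu(2) w(1) by (auto simp: c_def)
    moreover have "inner (u - pu) c = t * inner c c" by (auto simp: t_def)
    ultimately show ?thesis
      by (simp add: w(2) inner_diff_left inner_add_left inner_add_right algebra_simps)
  qed
  ultimately show ?case by blast
qed

lemma finite_dim_subspace_projection_exists:
  fixes u :: "'v::real_inner"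
  assumes "finite_dim_subspace U"
  shows "\<exists>p\<in>U. \<forall>w\<in>U. inner (u - p) w = 0"
  using assms orthogonal_projection_span_exists[of _ u] unfolding finite_dim_subspace_def by auto

lemma finite_dim_subspace_basis:
  assumes "finite_dim_subspace V"
  obtains B where "B \<subseteq> V" "independent B" "finite B" "span B = V" "card B = dim V"
proof -
  obtain B where B: "B \<subseteq> V" "independent B" "V \<subseteq> span B" "card B = dim V"
    using basis_exists by blast
  obtain C where C: "finite C" "V = span C" using assms by (auto simp: finite_dim_subspace_def)
  have "finite B" using independent_span_bound[OF C(1) B(2)] B(1) C(2) by blast
  moreover have "span B = V"
    using B assms by (simp add: finite_dim_subspace_def span_minimal subset_antisym)
  ultimately show ?thesis using that B by blast
qed

text \<open>The projections of \<open>V\<close> to \<open>U\<close> and the vectors of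
  \<open>X\<close> are more than \<open>dim U\<close> vectors of \<open>U\<close>, hence dependent.
  Sorting a relation by origin equates a combination of projections with a vector of
  \<open>span X\<close>, and \<open>u\<close> is the same combination of the unprojected
  vectors.\<close>

lemma exists_nonzero_with_projection_in_span:
  fixes U :: "'v::real_inner set"
  assumes U: "finite_dim_subspace U"
    and V: "finite V" "independent V" and X: "finite X" "independent X" "X \<subseteq> U"
    and card: "card V + card X > dim U"
  shows "\<exists>u\<in>span V. u \<noteq> 0 \<and> (\<exists>x\<in>span X. \<forall>w\<in>U. inner (u - x) w = 0)"
proof -
  obtain P where P: "\<And>v. P v \<in> U" "\<And>v w. w \<in> U \<Longrightarrow> inner (v - P v) w = 0"
    using finite_dim_subspace_projection_exists[OF U] by metis
  show ?thesis
  proof (cases "inj_on P V \<and> P ` V \<inter> X = {}")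
    \<comment> \<open>Dependence of a set does not see repeated vectors, so coincidences are settled
      separately: \<open>P v = P v'\<close> gives \<open>u = v - v'\<close> with
      \<open>x = 0\<close>, and \<open>P v \<in> X\<close> gives \<open>u = v\<close>.\<close>
    case False
    then consider v v' where "v \<in> V" "v' \<in> V" "v \<noteq> v'" "P v = P v'" | v where "v \<in> V" "P v \<in> X"
      by (auto simp: inj_on_def)
    then show ?thesis
    proof cases
      case 1
      have "inner (v - v' - 0) w = 0" if "w \<in> U" for w
        using P(2)[OF that, of v] P(2)[OF that, of v'] 1(4) by (simp add: inner_diff_left)
      moreover have "v - v' \<in> span V" using 1 by (intro span_diff span_base)
      ultimately show ?thesis using 1(3) span_zero by (metis right_minus_eq)
    next
      case 2
      then show ?thesis using P(2) V(2) dependent_zero span_base by metis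
    qed
  next
    case True
    define Y where "Y = P ` V \<union> X"
    have "card Y = card V + card X" unfolding Y_def using True V(1) X(1)
      by (subst card_Un_disjoint) (auto simp: card_image)
    moreover have fY: "finite Y" "Y \<subseteq> U" using V X P(1) by (auto simp: Y_def)
    ultimately have "dependent Y"
      using card finite_dim_subspace_basis[OF U] independent_span_bound[of _ Y] by (metis not_le)
    then obtain c where c: "\<exists>y\<in>Y. c y \<noteq> 0" "(\<Sum>y\<in>Y. c y *\<^sub>R y) = 0"
      using dependent_finite[OF fY(1)] by auto
    define u where "u = (\<Sum>v\<in>V. c (P v) *\<^sub>R v)"
    define x where "x = - (\<Sum>y\<in>X. c y *\<^sub>R y)"
    have "(\<Sum>y\<in>P ` V. c y *\<^sub>R y) + (\<Sum>y\<in>X. c y *\<^sub>R y) = 0"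
      using c(2) True V(1) X(1) by (subst sum.union_disjoint[symmetric]) (auto simp: Y_def)
    then have "(\<Sum>v\<in>V. c (P v) *\<^sub>R P v) + (\<Sum>y\<in>X. c y *\<^sub>R y) = 0"
      using True by (subst (asm) sum.reindex) auto
    then have xeq: "x = (\<Sum>v\<in>V. c (P v) *\<^sub>R P v)" by (simp add: x_def minus_unique add.commute)
    have "inner (u - x) w = 0" if "w \<in> U" for w
    proof -
      have "u - x = (\<Sum>v\<in>V. c (P v) *\<^sub>R (v - P v))"
        by (simp add: u_def xeq sum_subtractf scaleR_diff_right)
      then show ?thesis using P(2)[OF that] by (simp add: inner_sum_left)
    qed
    moreover have "u \<in> span V" unfolding u_def by (intro span_sum span_scale span_base)
    moreover have "x \<in> span X" by (auto simp: x_def intro!: span_neg span_sum span_scale intro: span_base)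
    \<comment> \<open>If \<open>u\<close> vanished, independence of \<open>V\<close> would remove
      the coefficients on the projections and then independence of \<open>X\<close> those on
      \<open>X\<close>, so the relation would be trivial.\<close>
    moreover have "u \<noteq> 0"
    proof
      assume "u = 0"
      then have cV: "c (P v) = 0" if "v \<in> V" for v
        using that V(1) unfolding u_def by (intro independentD[OF V(2), of V "\<lambda>v. c (P v)"]) auto
      then have "x = 0" unfolding xeq by (intro sum.neutral) simp
      then have "(\<Sum>y\<in>X. c y *\<^sub>R y) = 0" by (simp add: x_def)
      then have "c y = 0" if "y \<in> X" for y
        using that X(1) by (intro independentD[OF X(2), of X c]) auto
      then show False using c(1) cV unfolding Y_def by blast
    qed
    ultimately show ?thesis by blast
  qed
qed

text \<open>Pairing a vanishing combination with the block of one index leaves only the squared norm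
  of that block, so each block vanishes separately. The blocks are disjoint, since a common vector
  would be orthogonal to itself; this makes the cardinalities add.\<close>

lemma independent_UN_orthogonal:
  fixes B :: "'i \<Rightarrow> 'v::real_inner set"
  assumes "finite D" and "\<And>i. i \<in> D \<Longrightarrow> finite (B i)" and ind: "\<And>i. i \<in> D \<Longrightarrow> independent (B i)"
    and orth: "\<And>i j x y. i \<in> D \<Longrightarrow> j \<in> D \<Longrightarrow> i \<noteq> j \<Longrightarrow> x \<in> span (B i) \<Longrightarrow> y \<in> span (B j) \<Longrightarrow> inner x y = 0"
  shows "independent (\<Union>i\<in>D. B i)" and "card (\<Union>i\<in>D. B i) = (\<Sum>i\<in>D. card (B i))"
proof -
  have disj: "B i \<inter> B j = {}" if "i \<in> D" "j \<in> D" "i \<noteq> j" for i j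
  proof (rule ccontr)
    assume "B i \<inter> B j \<noteq> {}"
    then obtain x where x: "x \<in> B i" "x \<in> B j" by auto
    then have "inner x x = 0" using orth that span_base by metis
    then show False using x ind[OF that(1)] dependent_zero by auto
  qed
  show "card (\<Union>i\<in>D. B i) = (\<Sum>i\<in>D. card (B i))"
    using assms disj by (intro card_UN_disjoint) auto
  show "independent (\<Union>i\<in>D. B i)"
  proof
    assume "dependent (\<Union>i\<in>D. B i)"
    then obtain c where c: "\<exists>y\<in>(\<Union>i\<in>D. B i). c y \<noteq> 0" "(\<Sum>y\<in>(\<Union>i\<in>D. B i). c y *\<^sub>R y) = 0"
      using assms dependent_finite[of "\<Union>i\<in>D. B i"] by auto
    define z where "z i = (\<Sum>y\<in>B i. c y *\<^sub>R y)" for i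
    have z: "(\<Sum>i\<in>D. z i) = 0" using c(2) assms disj unfolding z_def
      by (subst (asm) sum.UNION_disjoint) auto
    have zs: "z i \<in> span (B i)" for i unfolding z_def by (intro span_sum span_scale span_base)
    have "z i = 0" if "i \<in> D" for i
    proof -
      have "0 = inner (z i) (\<Sum>j\<in>D. z j)" using z by simp
      also have "\<dots> = (\<Sum>j\<in>D. if j = i then inner (z i) (z i) else 0)"
        unfolding inner_sum_right using orth zs that by (intro sum.cong) auto
      finally show ?thesis using that assms by simp
    qed
    then have "c y = 0" if "i \<in> D" "y \<in> B i" for i y
      using that assms(2) unfolding z_def by (intro independentD[OF ind[OF that(1)], of "B i" c]) auto
    then show False using c(1) by auto
  qed
qed

text \<open>Regroups an element of the span by eigenvalue, so that the quadratic forms below become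
  diagonal sums.\<close>

lemma span_UN_subset_sums:
  fixes E :: "'i \<Rightarrow> 'v::real_vector set"
  assumes "finite D" "\<And>i. i \<in> D \<Longrightarrow> subspace (E i)" "\<And>i. i \<in> D \<Longrightarrow> B i \<subseteq> E i"
    and "u \<in> span (\<Union>i\<in>D. B i)"
  shows "\<exists>x. (\<forall>i\<in>D. x i \<in> E i) \<and> u = (\<Sum>i\<in>D. x i)"
  using assms(4)
proof (induction rule: span_induct_alt)
  case base
  then show ?case using assms by (intro exI[of _ "\<lambda>_. 0"]) (auto simp: subspace_0)
next
  case (step c b y)
  then obtain x i where x: "\<forall>i\<in>D. x i \<in> E i" "y = (\<Sum>i\<in>D. x i)" and i: "i \<in> D" "b \<in> B i" by auto
  have "c *\<^sub>R b + y = (\<Sum>j\<in>D. (x(i := c *\<^sub>R b + x i)) j)"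
    using i assms(1) by (simp add: x(2) sum.remove[of D i] algebra_simps)
  moreover have "c *\<^sub>R b + x i \<in> E i"
    using x(1) i assms(2,3) by (blast intro: subspace_add subspace_scale)
  then have "\<forall>j\<in>D. (x(i := c *\<^sub>R b + x i)) j \<in> E j" using x(1) by auto
  ultimately show ?case by blast
qed

section \<open>Eigenspaces of the mixed problem and Rayleigh quotients\<close>

lemma mixed_eigenspace_subset: "mixed_eigenspace \<Omega> S U \<mu> \<subseteq> U"
  by (auto simp: mixed_eigenspace_def)

text \<open>Testing with the two fluxes in turn gives
  \<open>(\<sigma>\<^sub>\<mu>, \<sigma>\<^sub>\<nu>) = \<nu> (u\<^sub>\<mu>, u\<^sub>\<nu>)\<close>, whose left side is symmetric.\<close>

lemma mixed_eigenspace_orthogonal: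
  assumes "u \<in> mixed_eigenspace \<Omega> S U \<mu>" "v \<in> mixed_eigenspace \<Omega> S U \<nu>" "\<mu> \<noteq> \<nu>"
  shows "inner u v = 0"
proof -
  obtain s where s: "s \<in> S" "\<forall>\<tau>\<in>S. inner s \<tau> + inner (divg \<Omega> \<tau>) u = 0"
      "\<forall>v\<in>U. inner (divg \<Omega> s) v = - \<mu> * inner u v" and u: "u \<in> U"
    using assms(1) by (auto simp: mixed_eigenspace_def)
  obtain t where t: "t \<in> S" "\<forall>\<tau>\<in>S. inner t \<tau> + inner (divg \<Omega> \<tau>) v = 0"
      "\<forall>w\<in>U. inner (divg \<Omega> t) w = - \<nu> * inner v w" and v: "v \<in> U"
    using assms(2) by (auto simp: mixed_eigenspace_def)
  have "inner s t = \<nu> * inner u v" using s(2) t(1,3) u by (auto simp: inner_commute)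
  moreover have "inner s t = \<mu> * inner u v" using t(2) s(1,3) v by (auto simp: inner_commute)
  ultimately show ?thesis using assms(3) by simp
qed

text \<open>Eigenfunctions for different eigenvalues are orthogonal, and so are their fluxes, hence
  both norms are diagonal. The sum of the fluxes is only tested; \<open>divg\<close>, a definite
  description, is applied to single fields. Membership in \<open>S\<close> is conditional so that
  one statement serves both the discrete space and H(div), for which only the tested equation is
  used.\<close>

lemma mixed_eigenspace_sum:
  assumes D: "finite D" and x: "\<And>\<mu>. \<mu> \<in> D \<Longrightarrow> x \<mu> \<in> mixed_eigenspace \<Omega> S U \<mu>"
  shows "\<exists>\<sigma>. (\<forall>\<tau>\<in>S. inner \<sigma> \<tau> + inner (divg \<Omega> \<tau>) (\<Sum>\<mu>\<in>D. x \<mu>) = 0) \<and> (subspace S \<longrightarrow> \<sigma> \<in> S) \<and>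
    (norm \<sigma>)\<^sup>2 = (\<Sum>\<mu>\<in>D. \<mu> * (norm (x \<mu>))\<^sup>2) \<and>
    (norm (\<Sum>\<mu>\<in>D. x \<mu>))\<^sup>2 = (\<Sum>\<mu>\<in>D. (norm (x \<mu>))\<^sup>2)"
proof -
  have "\<forall>\<mu>\<in>D. \<exists>\<sigma>. \<sigma> \<in> S \<and> (\<forall>\<tau>\<in>S. inner \<sigma> \<tau> + inner (divg \<Omega> \<tau>) (x \<mu>) = 0) \<and>
     (\<forall>v\<in>U. inner (divg \<Omega> \<sigma>) v = - \<mu> * inner (x \<mu>) v)"
    using x by (fastforce simp: mixed_eigenspace_def)
  then obtain s where s: "\<And>\<mu>. \<mu> \<in> D \<Longrightarrow> s \<mu> \<in> S"
    "\<And>\<mu> \<tau>. \<mu> \<in> D \<Longrightarrow> \<tau> \<in> S \<Longrightarrow> inner (s \<mu>) \<tau> = - inner (divg \<Omega> \<tau>) (x \<mu>)"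
    "\<And>\<mu> v. \<mu> \<in> D \<Longrightarrow> v \<in> U \<Longrightarrow> inner (divg \<Omega> (s \<mu>)) v = - \<mu> * inner (x \<mu>) v"
    by (metis add_eq_0_iff2)
  have xU: "x \<mu> \<in> U" if "\<mu> \<in> D" for \<mu> using x[OF that] mixed_eigenspace_subset by blast
  have xx: "inner (x \<mu>) (x \<nu>) = (if \<nu> = \<mu> then (norm (x \<mu>))\<^sup>2 else 0)" if "\<mu> \<in> D" "\<nu> \<in> D" for \<mu> \<nu>
    using mixed_eigenspace_orthogonal[OF x[OF that(1)] x[OF that(2)]]
    by (auto simp: power2_norm_eq_inner)
  have ss: "inner (s \<mu>) (s \<nu>) = (if \<nu> = \<mu> then \<mu> * (norm (x \<mu>))\<^sup>2 else 0)" if "\<mu> \<in> D" "\<nu> \<in> D" for \<mu> \<nu>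
    using s(2)[OF that(1) s(1)[OF that(2)]] s(3)[OF that(2) xU[OF that(1)]] xx[OF that(2,1)] that
    by (auto split: if_splits)
  show ?thesis
  proof (intro exI[of _ "\<Sum>\<mu>\<in>D. s \<mu>"] conjI ballI impI)
    show "inner (\<Sum>\<mu>\<in>D. s \<mu>) \<tau> + inner (divg \<Omega> \<tau>) (\<Sum>\<mu>\<in>D. x \<mu>) = 0" if "\<tau> \<in> S" for \<tau>
      using s(2) that by (simp add: inner_sum_left inner_sum_right sum_negf)
    show "(\<Sum>\<mu>\<in>D. s \<mu>) \<in> S" if "subspace S" using that s(1) by (intro subspace_sum)
    show "(norm (\<Sum>\<mu>\<in>D. s \<mu>))\<^sup>2 = (\<Sum>\<mu>\<in>D. \<mu> * (norm (x \<mu>))\<^sup>2)"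
      using D by (simp add: power2_norm_eq_inner[of "sum _ _"] inner_sum_left inner_sum_right ss cong: sum.cong)
    show "(norm (\<Sum>\<mu>\<in>D. x \<mu>))\<^sup>2 = (\<Sum>\<mu>\<in>D. (norm (x \<mu>))\<^sup>2)"
      using D by (simp add: power2_norm_eq_inner[of "sum _ _"] inner_sum_left inner_sum_right xx cong: sum.cong)
  qed
qed

text \<open>Bounds of the Rayleigh quotient from above and from below on one spectral subspace: the
  upper bound is used for the first continuous eigenvalues, the lower bound for the last discrete
  ones. Complete eigenspaces are taken, so an eigenvalue whose indices are only partly in
  \<open>I'\<close> can make \<open>card B\<close> larger than \<open>card I'\<close>.\<close>

lemma spectral_subspace:
  assumes enum: "eigenvalue_enumeration \<Omega> S U I l" and I': "finite I'" "I' \<subseteq> I"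
  obtains B where "finite B" "independent B" "B \<subseteq> U" "card B \<ge> card I'"
    "\<And>u. u \<in> span B \<Longrightarrow> \<exists>\<sigma>. (\<forall>\<tau>\<in>S. inner \<sigma> \<tau> + inner (divg \<Omega> \<tau>) u = 0) \<and> (subspace S \<longrightarrow> \<sigma> \<in> S) \<and>
       (\<forall>c. (\<forall>i\<in>I'. l i \<le> c) \<longrightarrow> (norm \<sigma>)\<^sup>2 \<le> c * (norm u)\<^sup>2) \<and>
       (\<forall>c. (\<forall>i\<in>I'. c \<le> l i) \<longrightarrow> c * (norm u)\<^sup>2 \<le> (norm \<sigma>)\<^sup>2)"
proof -
  define D where "D = l ` I'"
  let ?E = "mixed_eigenspace \<Omega> S U"
  have D: "finite D" using I' by (simp add: D_def)
  have ev: "mixed_eigenvalue \<Omega> S U \<mu>" if "\<mu> \<in> D" for \<mu>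
    using that enum I'(2) by (auto simp: D_def eigenvalue_enumeration_def)
  have fd: "finite_dim_subspace (?E \<mu>)" "card {j\<in>I. l j = \<mu>} = dim (?E \<mu>)" if "\<mu> \<in> D" for \<mu>
    using ev[OF that] enum by (auto simp: eigenvalue_enumeration_def)
  have "\<forall>\<mu>\<in>D. \<exists>B. B \<subseteq> ?E \<mu> \<and> independent B \<and> finite B \<and> span B = ?E \<mu> \<and> card B = dim (?E \<mu>)"
    using finite_dim_subspace_basis[OF fd(1)] by metis
  then obtain B where B: "\<And>\<mu>. \<mu> \<in> D \<Longrightarrow> B \<mu> \<subseteq> ?E \<mu> \<and> independent (B \<mu>) \<and> finite (B \<mu>) \<and>
      span (B \<mu>) = ?E \<mu> \<and> card (B \<mu>) = dim (?E \<mu>)"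
    by metis
  have orth: "inner x y = 0"
    if "i \<in> D" "j \<in> D" "i \<noteq> j" "x \<in> span (B i)" "y \<in> span (B j)" for i j x y
    using that B mixed_eigenspace_orthogonal by metis
  have ind: "independent (\<Union>\<mu>\<in>D. B \<mu>)" and card: "card (\<Union>\<mu>\<in>D. B \<mu>) = (\<Sum>\<mu>\<in>D. card (B \<mu>))"
    using independent_UN_orthogonal[of D B] D B orth by blast+
  show ?thesis
  proof (rule that[of "\<Union>\<mu>\<in>D. B \<mu>"])
    show "finite (\<Union>\<mu>\<in>D. B \<mu>)" using D B by blast
    show "independent (\<Union>\<mu>\<in>D. B \<mu>)" by (rule ind)
    show "(\<Union>\<mu>\<in>D. B \<mu>) \<subseteq> U" using B mixed_eigenspace_subset by blast
    have "card {j\<in>I'. l j = \<mu>} \<le> card (B \<mu>)" if \<mu>: "\<mu> \<in> D" for \<mu>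
    proof -
      \<comment> \<open>An infinite set has \<open>card\<close> 0. A nonzero eigenvector makes the
        dimension, hence the cardinality of the full index set, positive; so that set is finite and
        \<open>card_mono\<close> applies.\<close>
      obtain u where "u \<in> ?E \<mu>" "u \<noteq> 0" using ev[OF \<mu>] by (auto simp: mixed_eigenvalue_def)
      then have "B \<mu> \<noteq> {}" using B[OF \<mu>] by auto
      then have "card {j\<in>I. l j = \<mu>} > 0" using B[OF \<mu>] fd(2)[OF \<mu>] by (metis card_gt_0_iff)
      then have "card {j\<in>I'. l j = \<mu>} \<le> card {j\<in>I. l j = \<mu>}"
        using I'(2) by (intro card_mono) (auto simp: card_gt_0_iff)
      then show ?thesis using fd(2)[OF \<mu>] B[OF \<mu>] by simp
    qed
    then have "(\<Sum>\<mu>\<in>D. card {j\<in>I'. l j = \<mu>}) \<le> card (\<Union>\<mu>\<in>D. B \<mu>)"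
      unfolding card by (intro sum_mono)
    moreover have "card I' = (\<Sum>\<mu>\<in>D. card {j\<in>I'. l j = \<mu>})"
      unfolding D_def card_eq_sum using I'(1) by (rule sum.image_gen)
    ultimately show "card I' \<le> card (\<Union>\<mu>\<in>D. B \<mu>)" by simp
  next
    fix u assume u: "u \<in> span (\<Union>\<mu>\<in>D. B \<mu>)"
    obtain x where x: "\<And>\<mu>. \<mu> \<in> D \<Longrightarrow> x \<mu> \<in> ?E \<mu>" "u = (\<Sum>\<mu>\<in>D. x \<mu>)"
    proof -
      have "subspace (?E \<mu>)" "B \<mu> \<subseteq> ?E \<mu>" if "\<mu> \<in> D" for \<mu>
        using B[OF that] fd(1)[OF that] by (auto simp: finite_dim_subspace_def)
      then show thesis using span_UN_subset_sums[of D ?E B u] D u that by blast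
    qed
    obtain \<sigma> where \<sigma>: "\<forall>\<tau>\<in>S. inner \<sigma> \<tau> + inner (divg \<Omega> \<tau>) u = 0" "subspace S \<longrightarrow> \<sigma> \<in> S"
      and n: "(norm \<sigma>)\<^sup>2 = (\<Sum>\<mu>\<in>D. \<mu> * (norm (x \<mu>))\<^sup>2)" "(norm u)\<^sup>2 = (\<Sum>\<mu>\<in>D. (norm (x \<mu>))\<^sup>2)"
      using mixed_eigenspace_sum[OF D, of x \<Omega> S U] x by blast
    have "(norm \<sigma>)\<^sup>2 \<le> c * (norm u)\<^sup>2" if "\<forall>i\<in>I'. l i \<le> c" for c
      unfolding n sum_distrib_left using that by (intro sum_mono mult_right_mono) (auto simp: D_def)
    moreover have "c * (norm u)\<^sup>2 \<le> (norm \<sigma>)\<^sup>2" if "\<forall>i\<in>I'. c \<le> l i" for c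
      unfolding n sum_distrib_left using that by (intro sum_mono mult_right_mono) (auto simp: D_def)
    ultimately show "\<exists>\<sigma>. (\<forall>\<tau>\<in>S. inner \<sigma> \<tau> + inner (divg \<Omega> \<tau>) u = 0) \<and> (subspace S \<longrightarrow> \<sigma> \<in> S) \<and>
       (\<forall>c. (\<forall>i\<in>I'. l i \<le> c) \<longrightarrow> (norm \<sigma>)\<^sup>2 \<le> c * (norm u)\<^sup>2) \<and>
       (\<forall>c. (\<forall>i\<in>I'. c \<le> l i) \<longrightarrow> c * (norm u)\<^sup>2 \<le> (norm \<sigma>)\<^sup>2)"
      using \<sigma> by blast
  qed
qed

text \<open>The squared norm of the flux is \<open>\<mu>\<close> times that of \<open>u\<close>. The
  sign is used when an inequality is multiplied by the discrete eigenvalue and for the positivity of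
  the final denominator.\<close>

lemma mixed_eigenvalue_nonneg:
  fixes S :: "('a::euclidean_space, 'a) L2 set"
  assumes "mixed_eigenvalue \<Omega> S U \<mu>"
  shows "0 \<le> \<mu>"
proof -
  obtain u where u: "u \<in> mixed_eigenspace \<Omega> S U \<mu>" "u \<noteq> 0"
    using assms by (auto simp: mixed_eigenvalue_def)
  then have "\<exists>\<sigma>::('a, 'a) L2. (norm \<sigma>)\<^sup>2 = \<mu> * (norm u)\<^sup>2"
    using mixed_eigenspace_sum[of "{\<mu>}" "\<lambda>_. u" \<Omega> S U] by (auto simp del: split_paired_Ex)
  then have "0 \<le> \<mu> * (norm u)\<^sup>2" by (metis zero_le_power2)
  then show ?thesis using u(2) by (simp add: zero_le_mult_iff)
qed

section \<open>Smooth bump functions\<close>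

text \<open>Carrying all polynomial factors in 1 / t along with exp (- 1 / t) gives a family closed
  under differentiation, so smoothness becomes an induction with a varying polynomial.\<close>

definition exp_flat :: "real poly \<Rightarrow> real \<Rightarrow> real" where
  "exp_flat P t = (if t > 0 then poly P (1 / t) * exp (- (1 / t)) else 0)"

lemma exp_flat_tendsto_0: "(exp_flat P \<longlongrightarrow> 0) (at 0)"
proof -
  have "((\<lambda>z. \<Sum>i\<le>degree P. coeff P i * (z ^ i / exp z)) \<longlongrightarrow> (\<Sum>i\<le>degree P. coeff P i * 0)) at_top"
    by (intro tendsto_sum tendsto_mult tendsto_const tendsto_power_div_exp_0)
  then have "((\<lambda>z. poly P z * exp (- z)) \<longlongrightarrow> 0) at_top"
    by (simp add: poly_altdef sum_distrib_right exp_minus divide_inverse mult.assoc)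
  then have "((\<lambda>t. poly P (1 / t) * exp (- (1 / t))) \<longlongrightarrow> 0) (at_right 0)"
    by (simp add: filterlim_at_right_to_top divide_inverse)
  moreover have "eventually (\<lambda>t. poly P (1 / t) * exp (- (1 / t)) = exp_flat P t) (at_right 0)"
    by (auto simp: exp_flat_def eventually_at_filter)
  ultimately have "(exp_flat P \<longlongrightarrow> 0) (at_right 0)" by (rule Lim_transform_eventually)
  moreover have "eventually (\<lambda>t. 0 = exp_flat P t) (at_left 0)"
    by (auto simp: exp_flat_def eventually_at_filter)
  then have "(exp_flat P \<longlongrightarrow> 0) (at_left 0)" by (rule Lim_transform_eventually[OF tendsto_const])
  ultimately show ?thesis by (simp add: filterlim_split_at)
qed

text \<open>For t > 0 the derivative of P(1/t) exp(-1/t) is t^(-2) (P - P')(1/t) exp(-1/t); the two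
  zero coefficients put in front multiply the polynomial by the square of its variable.\<close>

lemma exp_flat_has_derivative:
  "(exp_flat P has_real_derivative exp_flat (pCons 0 (pCons 0 (P - pderiv P))) t) (at t)"
proof -
  let ?Q = "pCons 0 (pCons 0 (P - pderiv P))"
  consider "t > 0" | "t < 0" | "t = 0" by linarith
  then show ?thesis
  proof cases
    case 1
    have "((\<lambda>t. poly P (1 / t) * exp (- (1 / t))) has_real_derivative
       poly (pderiv P) (1 / t) * (- (1 / t\<^sup>2)) * exp (- (1 / t)) + poly P (1 / t) * (exp (- (1 / t)) * (1 / t\<^sup>2))) (at t)"
      using 1 by (auto intro!: derivative_eq_intros simp: power2_eq_square)
    moreover have "poly (pderiv P) (1 / t) * (- (1 / t\<^sup>2)) * exp (- (1 / t)) + poly P (1 / t) * (exp (- (1 / t)) * (1 / t\<^sup>2)) = exp_flat ?Q t"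
      using 1 by (simp add: exp_flat_def power2_eq_square field_simps)
    ultimately have "((\<lambda>t. poly P (1 / t) * exp (- (1 / t))) has_real_derivative exp_flat ?Q t) (at t)" by simp
    then show ?thesis
      by (rule has_field_derivative_transform_within_open[where S="{0<..}"]) (use 1 in \<open>auto simp: exp_flat_def\<close>)
  next
    case 2
    have "((\<lambda>t. 0) has_real_derivative exp_flat ?Q t) (at t)"
      using 2 by (simp add: exp_flat_def)
    then show ?thesis
      by (rule has_field_derivative_transform_within_open[where S="{..<0}"]) (use 2 in \<open>auto simp: exp_flat_def\<close>)
  next
    case 3
    \<comment> \<open>The difference quotient at 0 is again a member of the family, with
      \<open>P\<close> multiplied by its variable, and so tends to 0.\<close>
    have "eventually (\<lambda>h. exp_flat (pCons 0 P) h = exp_flat P h / h) (at 0)"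
      by (auto simp: exp_flat_def eventually_at_filter)
    then have "((\<lambda>h. exp_flat P h / h) \<longlongrightarrow> 0) (at 0)"
      by (rule Lim_transform_eventually[OF exp_flat_tendsto_0])
    then show ?thesis using 3 by (simp add: DERIV_def exp_flat_def)
  qed
qed

lemma exp_flat_nonneg: "exp_flat 1 t \<ge> 0"
  by (simp add: exp_flat_def)

lemma exp_flat_le_1: "exp_flat 1 t \<le> 1"
  by (simp add: exp_flat_def)

section \<open>Closure properties of the classes C^k and bumps supported in boxes\<close>

lemma C_k_const: "C_k k (\<lambda>x. c)"
  by (induction k arbitrary: c) auto

lemma C_k_Suc_imp: "C_k (Suc k) f \<Longrightarrow> C_k k f"
proof (induction k arbitrary: f)
  case 0
  then show ?case
    by (auto intro!: continuous_at_imp_continuous_on differentiable_imp_continuous_within)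
next
  case (Suc k)
  then show ?case by (metis C_k.simps(2))
qed

lemma C_k_add: "C_k k f \<Longrightarrow> C_k k g \<Longrightarrow> C_k k (\<lambda>x. f x + g x)"
proof (induction k arbitrary: f g)
  case (Suc k)
  have "frechet_derivative (\<lambda>x. f x + g x) (at x) =
      (\<lambda>h. frechet_derivative f (at x) h + frechet_derivative g (at x) h)" for x
    using Suc.prems by (intro frechet_derivative_at[symmetric] has_derivative_add)
      (auto simp: frechet_derivative_works[symmetric])
  then show ?case using Suc by (auto intro!: differentiable_add)
qed (auto intro!: continuous_intros)

lemma C_k_mult: "C_k k f \<Longrightarrow> C_k k g \<Longrightarrow> C_k k (\<lambda>x. f x * g x)"
proof (induction k arbitrary: f g)
  case (Suc k)
  have "frechet_derivative (\<lambda>x. f x * g x) (at x) =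
      (\<lambda>h. f x * frechet_derivative g (at x) h + frechet_derivative f (at x) h * g x)" for x
    using Suc.prems by (intro frechet_derivative_at[symmetric] has_derivative_mult)
      (auto simp: frechet_derivative_works[symmetric])
  then show ?case using Suc C_k_Suc_imp[OF Suc.prems(1)] C_k_Suc_imp[OF Suc.prems(2)]
    by (auto intro!: differentiable_mult C_k_add)
qed (auto intro!: continuous_intros)

lemma C_k_prod: "finite A \<Longrightarrow> (\<And>i. i \<in> A \<Longrightarrow> C_k k (f i)) \<Longrightarrow> C_k k (\<lambda>x. \<Prod>i\<in>A. f i x)"
  by (induction A rule: finite_induct) (auto intro!: C_k_mult C_k_const)

lemma C_k_exp_flat: "C_k k (\<lambda>x. exp_flat P (x \<bullet> v + c))"
proof (induction k arbitrary: P)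
  case 0
  have "isCont (exp_flat P) t" for t by (rule DERIV_isCont[OF exp_flat_has_derivative])
  then have "continuous_on UNIV (exp_flat P)" by (simp add: continuous_at_imp_continuous_on)
  then show ?case by (auto intro!: continuous_on_compose2[of UNIV "exp_flat P"] continuous_intros)
next
  case (Suc k)
  let ?Q = "pCons 0 (pCons 0 (P - pderiv P))"
  have D: "((\<lambda>x. exp_flat P (x \<bullet> v + c)) has_derivative (\<lambda>h. exp_flat ?Q (x \<bullet> v + c) * (h \<bullet> v))) (at x)" for x
  proof -
    have "(exp_flat P has_derivative (\<lambda>h. exp_flat ?Q (x \<bullet> v + c) * h)) (at (x \<bullet> v + c))"
      using exp_flat_has_derivative by (simp add: has_field_derivative_def)
    moreover have "((\<lambda>x. x \<bullet> v + c) has_derivative (\<lambda>h. h \<bullet> v)) (at x)"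
      by (auto intro!: derivative_eq_intros)
    ultimately show ?thesis by (rule has_derivative_compose[rotated])
  qed
  have "frechet_derivative (\<lambda>x. exp_flat P (x \<bullet> v + c)) (at x) b =
      exp_flat (smult (b \<bullet> v) ?Q) (x \<bullet> v + c)" for x b
    unfolding frechet_derivative_at[OF D, symmetric] by (simp add: exp_flat_def)
  moreover have "(\<lambda>x. exp_flat P (x \<bullet> v + c)) differentiable at x" for x
    using D by (rule differentiableI)
  ultimately show ?case using Suc.IH by simp
qed

text \<open>Dilating \<open>exp (- 1 / t)\<close> by \<open>m + 1\<close> takes its \<open>(m + 1)\<close>-th root; hence the bumps converge to the indicator
  function of the box.\<close>

definition box_bump :: "'a::euclidean_space \<Rightarrow> 'a \<Rightarrow> nat \<Rightarrow> 'a \<Rightarrow> real" where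
  "box_bump a b m x = (\<Prod>i\<in>Basis. exp_flat 1 (real (Suc m) * (x \<bullet> i - a \<bullet> i)) * exp_flat 1 (real (Suc m) * (b \<bullet> i - x \<bullet> i)))"

lemma C_k_box_bump: "C_k k (box_bump a b m)"
proof -
  have "C_k k (\<lambda>x. exp_flat 1 (x \<bullet> (s *\<^sub>R i) + - (t * s)))" for s t :: real and i :: 'a
    by (rule C_k_exp_flat)
  then have "C_k k (\<lambda>x. exp_flat 1 (s * (x \<bullet> i - t)))" for s t :: real and i :: 'a
    by (simp add: algebra_simps)
  moreover have "C_k k (\<lambda>x. exp_flat 1 (x \<bullet> (- s *\<^sub>R i) + t * s))" for s t :: real and i :: 'a
    by (rule C_k_exp_flat)
  then have "C_k k (\<lambda>x. exp_flat 1 (s * (t - x \<bullet> i)))" for s t :: real and i :: 'a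
    by (simp add: algebra_simps)
  ultimately show ?thesis unfolding box_bump_def by (intro C_k_prod C_k_mult) auto
qed

lemma box_bump_eq_0: "x \<notin> box a b \<Longrightarrow> box_bump a b m x = 0"
proof -
  assume "x \<notin> box a b"
  then obtain i where i: "i \<in> Basis" "x \<bullet> i \<le> a \<bullet> i \<or> b \<bullet> i \<le> x \<bullet> i"
    by (auto simp: mem_box not_less)
  then have "exp_flat 1 (real (Suc m) * (x \<bullet> i - a \<bullet> i)) * exp_flat 1 (real (Suc m) * (b \<bullet> i - x \<bullet> i)) = 0"
    by (auto simp: exp_flat_def zero_less_mult_iff)
  then show ?thesis unfolding box_bump_def using i(1) by (intro prod_zero) auto
qed

lemma box_bump_bounds: "0 \<le> box_bump a b m x" "box_bump a b m x \<le> 1"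
  unfolding box_bump_def
  by (auto intro!: prod_nonneg prod_le_1 mult_le_one mult_nonneg_nonneg exp_flat_nonneg exp_flat_le_1)

lemma test_function_box_bump:
  assumes "cbox a b \<subseteq> \<Omega>"
  shows "test_function \<Omega> (box_bump a b m)"
proof -
  have sub: "{x. box_bump a b m x \<noteq> 0} \<subseteq> cbox a b"
    using box_bump_eq_0 box_subset_cbox by blast
  then have "closure {x. box_bump a b m x \<noteq> 0} \<subseteq> cbox a b"
    by (rule closure_minimal) auto
  moreover have "compact (closure {x. box_bump a b m x \<noteq> 0})"
    using bounded_subset[OF bounded_cbox sub] by (simp add: compact_closure)
  ultimately show ?thesis
    using assms C_k_box_bump by (auto simp: test_function_def)
qed

lemma box_bump_tendsto_indicator: "(\<lambda>m. box_bump a b m x) \<longlonglongrightarrow> indicator (box a b) x"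
proof (cases "x \<in> box a b")
  case True
  have *: "(\<lambda>m. exp_flat 1 (real (Suc m) * t)) \<longlonglongrightarrow> 1" if "t > 0" for t
  proof -
    have "(\<lambda>m. 1 / t * inverse (real (Suc m))) \<longlonglongrightarrow> 1 / t * 0"
      by (intro tendsto_mult tendsto_const LIMSEQ_inverse_real_of_nat)
    then have "(\<lambda>m. exp (- (1 / t * inverse (real (Suc m))))) \<longlonglongrightarrow> exp (- 0)"
      by (intro tendsto_exp tendsto_minus) simp
    moreover have "exp_flat 1 (real (Suc m) * t) = exp (- (1 / t * inverse (real (Suc m))))" for m
      using that by (simp add: exp_flat_def zero_less_mult_iff divide_inverse mult.commute)
    ultimately show ?thesis by simp
  qed
  have "(\<lambda>m. box_bump a b m x) \<longlonglongrightarrow> (\<Prod>i\<in>(Basis :: 'a set). 1 * 1)"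
    unfolding box_bump_def using True by (intro tendsto_prod tendsto_mult *) (auto simp: mem_box)
  then show ?thesis using True by simp
qed (simp add: box_bump_eq_0)

section \<open>Uniqueness of the weak divergence\<close>

text \<open>Open boxes form an intersection-stable generator of the Borel sets, so the vanishing of
  the integrals extends to all Borel sets by induction over a Dynkin system; \<open>total\<close> is
  what the step to complements asks for. The sets where \<open>f\<close> is positive and where it is
  negative then finish the argument.\<close>

lemma AE_zero_if_box_integrals_zero:
  fixes f :: "'a::euclidean_space \<Rightarrow> real"
  assumes f: "integrable lborel f"
    and box: "\<And>a b. (LINT x|lborel. indicator (box a b) x * f x) = 0"
    and total: "(LINT x|lborel. f x) = 0"
  shows "AE x in lborel. f x = 0"
proof -
  have [measurable]: "f \<in> borel_measurable borel" using f by auto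
  have ind: "integrable lborel (\<lambda>x. indicator A x * f x)" if "A \<in> sets borel" for A
    using integrable_mult_indicator[of A lborel f] f that by simp
  have *: "(LINT x|lborel. indicator A x * f x) = 0" if "A \<in> sets borel" for A
  proof -
    have borel: "sets (borel :: 'a measure) = sigma_sets UNIV (range (\<lambda>(a, b). box a b))"
      by (simp add: borel_eq_box)
    have "Int_stable (range (\<lambda>(a, b). box a b :: 'a set))"
      by (auto simp: Int_stable_def box_Int_box)
    moreover have "range (\<lambda>(a, b). box a b :: 'a set) \<subseteq> Pow UNIV" by auto
    moreover have "A \<in> sigma_sets UNIV (range (\<lambda>(a, b). box a b))" using that borel by simp
    ultimately show ?thesis
    proof (induction rule: sigma_sets_induct_disjoint)
      case (basic A)
      then show ?case using box by auto
    next
      case empty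
      then show ?case by simp
    next
      case (compl A)
      then have A: "A \<in> sets borel" by (simp add: borel)
      have "(LINT x|lborel. indicator (UNIV - A) x * f x) = (LINT x|lborel. f x - indicator A x * f x)"
        by (intro Bochner_Integration.integral_cong) (auto simp: indicator_def)
      also have "\<dots> = 0" using compl A f ind total by simp
      finally show ?case .
    next
      case (union A)
      then have A: "\<And>i. A i \<in> sets borel" by (auto simp: borel)
      have "set_lebesgue_integral lborel (\<Union>i. A i) f = (\<Sum>i. set_lebesgue_integral lborel (A i) f)"
        using union(1) A ind[of "\<Union>i. A i"]
        by (intro lebesgue_integral_countable_add) (auto simp: disjoint_family_on_def set_integrable_def)
      then show ?case using union(3) by (simp add: set_lebesgue_integral_def)
    qed
  qed
  have "AE x in lborel. indicator {x. f x > 0} x * f x = 0"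
    using *[of "{x. f x > 0}"] ind[of "{x. f x > 0}"]
    by (subst integral_nonneg_eq_0_iff_AE[symmetric]) (auto simp: indicator_def)
  moreover have "AE x in lborel. - (indicator {x. f x < 0} x * f x) = 0"
    using *[of "{x. f x < 0}"] ind[of "{x. f x < 0}"]
    by (subst integral_nonneg_eq_0_iff_AE[symmetric]) (auto simp: indicator_def)
  ultimately show ?thesis by eventually_elim (auto simp: indicator_def split: if_splits)
qed

lemma square_integrable_indicator:
  assumes "A \<in> sets borel" "emeasure lborel A < \<infinity>"
  shows "square_integrable (indicator A :: 'a::euclidean_space \<Rightarrow> real)"
proof -
  have "(\<lambda>x. (norm (indicator A x :: real))\<^sup>2) = (indicator A :: 'a \<Rightarrow> real)" by (auto simp: indicator_def)
  then show ?thesis using assms by (simp add: square_integrable_def)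
qed

lemma square_integrable_imp_integrable_on_finite:
  fixes f :: "'a::euclidean_space \<Rightarrow> 'b::euclidean_space"
  assumes "square_integrable f" "A \<in> sets borel" "emeasure lborel A < \<infinity>"
  shows "integrable lborel (\<lambda>x. indicator A x *\<^sub>R f x)"
proof -
  have [measurable]: "f \<in> borel_measurable borel" "A \<in> sets borel" using assms by (auto simp: square_integrable_def)
  have "integrable lborel (\<lambda>x. (norm (f x))\<^sup>2 + indicator A x)"
    using assms by (auto simp: square_integrable_def)
  then show ?thesis
  proof (rule Bochner_Integration.integrable_bound)
    have "norm y \<le> (norm y)\<^sup>2 + 1" for y :: 'b
    proof -
      have "2 * norm y \<le> (norm y)\<^sup>2 + 1" using zero_le_power2[of "norm y - 1"] by (simp add: power2_diff)
      then show ?thesis using zero_le_power2[of "norm y"] by linarith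
    qed
    then show "AE x in lborel. norm (indicator A x *\<^sub>R f x) \<le> norm ((norm (f x))\<^sup>2 + indicator A x)"
      by (auto simp: indicator_def)
  qed measurable
qed

text \<open>The fundamental lemma of the calculus of variations. Bumps converging to the indicator
  of a box transfer the hypothesis to boxes whose closed box lies in \<open>\<Omega>\<close>; the
  box criterion applies inside each of these, and countably many closed boxes exhaust the open
  set.\<close>

lemma AE_zero_on_open_if_test_integrals_zero:
  fixes f :: "'a::euclidean_space \<Rightarrow> real"
  assumes f: "square_integrable f" and \<Omega>: "open \<Omega>"
    and test: "\<And>\<phi>. test_function \<Omega> \<phi> \<Longrightarrow> (LINT x|lborel. f x * \<phi> x) = 0"
  shows "AE x in lborel. x \<in> \<Omega> \<longrightarrow> f x = 0"
proof -
  have [measurable]: "f \<in> borel_measurable borel" using f by (auto simp: square_integrable_def)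
  have int: "integrable lborel (\<lambda>x. indicator (box a b) x * f x)" for a b
    using square_integrable_imp_integrable_on_finite[OF f, of "box a b"] emeasure_lborel_box_finite[of a b] by simp
  have box0: "(LINT x|lborel. indicator (box a b) x * f x) = 0" if "cbox a b \<subseteq> \<Omega>" for a b
  proof -
    have "(\<lambda>m. LINT x|lborel. f x * box_bump a b m x) \<longlonglongrightarrow> (LINT x|lborel. indicator (box a b) x * f x)"
    proof (rule integral_dominated_convergence[where w="\<lambda>x. norm (indicator (box a b) x * f x)"])
      have "continuous_on UNIV (box_bump a b m)" for m using C_k_box_bump[of 0] by simp
      then have [measurable]: "box_bump a b m \<in> borel_measurable borel" for m
        by (intro borel_measurable_continuous_onI)
      show "(\<lambda>x. f x * box_bump a b m x) \<in> borel_measurable lborel" for m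
        by measurable
      have "(\<lambda>m. f x * box_bump a b m x) \<longlonglongrightarrow> f x * indicator (box a b) x" for x
        by (intro tendsto_mult tendsto_const box_bump_tendsto_indicator)
      then show "AE x in lborel. (\<lambda>m. f x * box_bump a b m x) \<longlonglongrightarrow> indicator (box a b) x * f x"
        by (simp add: mult.commute)
      show "AE x in lborel. norm (f x * box_bump a b m x) \<le> norm (indicator (box a b) x * f x)" for m
        using box_bump_bounds[of a b m] box_bump_eq_0[of _ a b m]
        by (auto simp: indicator_def abs_mult intro!: mult_left_le)
    qed (use int in auto)
    moreover have "(LINT x|lborel. f x * box_bump a b m x) = 0" for m
      by (intro test test_function_box_bump that)
    ultimately show ?thesis by (simp add: LIMSEQ_const_iff)
  qed
  have AEbox: "AE x in lborel. x \<in> box a b \<longrightarrow> f x = 0" if "cbox a b \<subseteq> \<Omega>" for a b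
  proof -
    have "AE x in lborel. indicator (box a b) x * f x = 0"
    proof (rule AE_zero_if_box_integrals_zero)
      show "integrable lborel (\<lambda>x. indicator (box a b) x * f x)" by (rule int)
      show "(LINT x|lborel. indicator (box a b) x * f x) = 0" by (rule box0[OF that])
      fix a' b' :: 'a
      obtain c d where cd: "box a' b' \<inter> box a b = box c d" using box_Int_box by blast
      have eq: "indicator (box a' b') x * (indicator (box a b) x * f x) = indicator (box c d) x * f x" for x
        by (simp add: cd[symmetric] indicator_inter_arith)
      show "(LINT x|lborel. indicator (box a' b') x * (indicator (box a b) x * f x)) = 0"
      \<comment> \<open>If \<open>box c d\<close> is empty, \<open>cbox c d\<close> need not be its
        closure and may be a degenerate box outside \<open>\<Omega>\<close>; only nonempty boxes
        admit the closure argument.\<close>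
      proof (cases "box c d = {}")
        case True
        then show ?thesis unfolding eq by simp
      next
        case False
        then have "closure (box c d) = cbox c d" by (rule closure_box)
        moreover have "box c d \<subseteq> cbox a b" using cd box_subset_cbox[of a b] by blast
        then have "closure (box c d) \<subseteq> cbox a b" by (intro closure_minimal closed_cbox)
        ultimately have "cbox c d \<subseteq> \<Omega>" using that by simp
        then show ?thesis unfolding eq by (rule box0)
      qed
    qed
    then show ?thesis by eventually_elim (auto simp: indicator_def)
  qed
  obtain \<D> where D: "countable \<D>" "\<D> \<subseteq> Pow \<Omega>" "\<And>X. X \<in> \<D> \<Longrightarrow> \<exists>a b. X = cbox a b" "\<Union>\<D> = \<Omega>"
    using open_countable_Union_open_cbox[OF \<Omega>] by metis
  have "AE x in lborel. x \<in> X \<longrightarrow> f x = 0" if X: "X \<in> \<D>" for X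
  proof -
    obtain a b where ab: "X = cbox a b" using D X by blast
    have "AE x in lborel. x \<notin> cbox a b - box a b"
      by (intro AE_not_in) (simp add: null_sets_def emeasure_Diff emeasure_lborel_cbox_eq emeasure_lborel_box_eq box_subset_cbox)
    moreover have "AE x in lborel. x \<in> box a b \<longrightarrow> f x = 0" using D(2) X ab by (intro AEbox) auto
    ultimately show ?thesis by eventually_elim (auto simp: ab)
  qed
  then have "AE x in lborel. \<forall>X\<in>\<D>. x \<in> X \<longrightarrow> f x = 0" by (subst AE_ball_countable[OF D(1)]) blast
  then show ?thesis by eventually_elim (use D(4) in auto)
qed

section \<open>Representatives of L2 classes and uniqueness of the divergence\<close>

lemma rep_L2_diff: "AE x in lborel. rep_L2 (u - v) x = rep_L2 u x - rep_L2 v x"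
  unfolding minus_L2_def by (simp, intro rep_abs_L2 square_integrable_diff square_integrable_rep_L2)

lemma rep_L2_add: "AE x in lborel. rep_L2 (u + v) x = rep_L2 u x + rep_L2 v x"
  unfolding plus_L2_def by (simp, intro rep_abs_L2 square_integrable_add square_integrable_rep_L2)

lemma inner_L2_eq: "inner u v = (LINT x|lborel. rep_L2 u x \<bullet> rep_L2 v x)"
  by (simp add: inner_L2_def)

lemma borel_measurable_rep_L2 [measurable]: "rep_L2 f \<in> borel_measurable borel"
  using square_integrable_rep_L2[of f] by (simp add: square_integrable_def)

lemma L2_eq_iff_AE: "u = v \<longleftrightarrow> (AE x in lborel. rep_L2 u x = rep_L2 v x)"
  using Quotient_rel_rep[OF Quotient_L2, of u v] square_integrable_rep_L2 by blast

lemma inner_L2_abs: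
  assumes "square_integrable g"
  shows "inner u (abs_L2 g) = (LINT x|lborel. rep_L2 u x \<bullet> g x)"
proof -
  have [measurable]: "g \<in> borel_measurable borel" using assms by (simp add: square_integrable_def)
  show ?thesis unfolding inner_L2_eq using rep_abs_L2[OF assms]
    by (intro integral_cong_AE) auto
qed

lemma norm_L2_power2: "(norm u)\<^sup>2 = (LINT x|lborel. (norm (rep_L2 u x))\<^sup>2)"
  by (simp add: power2_norm_eq_inner inner_L2_eq)

lemma test_function_continuous: "test_function \<Omega> \<phi> \<Longrightarrow> continuous_on UNIV \<phi>"
  by (metis test_function_def C_k.simps(1))

lemma test_function_square_integrable:
  fixes \<phi> :: "'a::euclidean_space \<Rightarrow> real"
  assumes "test_function \<Omega> \<phi>"
  shows "square_integrable \<phi>"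
proof -
  let ?K = "closure {x. \<phi> x \<noteq> 0}"
  have c: "continuous_on UNIV \<phi>" and K: "compact ?K"
    using assms test_function_continuous by (auto simp: test_function_def)
  then have "integrable lborel (\<lambda>x. indicator ?K x *\<^sub>R (norm (\<phi> x))\<^sup>2)"
    by (intro borel_integrable_compact continuous_intros continuous_on_subset[OF c]) auto
  moreover have "(\<lambda>x. indicator ?K x *\<^sub>R (norm (\<phi> x))\<^sup>2) = (\<lambda>x. (norm (\<phi> x))\<^sup>2)"
    using closure_subset[of "{x. \<phi> x \<noteq> 0}"] by (auto simp: indicator_def fun_eq_iff)
  ultimately show ?thesis using c by (auto simp: square_integrable_def intro: borel_measurable_continuous_onI)
qed

text \<open>Gives the definite description in \<open>divg\<close> its meaning: two divergences have
  equal integrals against all test functions, hence agree in \<open>\<Omega>\<close>, and both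
  vanish outside.\<close>

lemma weak_div_unique:
  assumes \<Omega>: "open \<Omega>" and d: "d \<in> L2_on \<Omega>" "is_weak_div \<Omega> \<sigma> d"
    and e: "e \<in> L2_on \<Omega>" "is_weak_div \<Omega> \<sigma> e"
  shows "d = e"
proof -
  have "AE x in lborel. x \<in> \<Omega> \<longrightarrow> rep_L2 d x - rep_L2 e x = 0"
  proof (rule AE_zero_on_open_if_test_integrals_zero[OF _ \<Omega>])
    show "square_integrable (\<lambda>x. rep_L2 d x - rep_L2 e x)"
      by (intro square_integrable_diff square_integrable_rep_L2)
    fix \<phi> assume \<phi>: "test_function \<Omega> \<phi>"
    have "integrable lborel (\<lambda>x. rep_L2 w x * \<phi> x)" for w :: "('a, real) L2"
      using square_integrable_inner[OF square_integrable_rep_L2 test_function_square_integrable[OF \<phi>]] by simp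
    moreover have "(LINT x|lborel. rep_L2 d x * \<phi> x) = (LINT x|lborel. rep_L2 e x * \<phi> x)"
      using d(2)[unfolded is_weak_div_def, rule_format, OF \<phi>] e(2)[unfolded is_weak_div_def, rule_format, OF \<phi>]
      by simp
    ultimately show "(LINT x|lborel. (rep_L2 d x - rep_L2 e x) * \<phi> x) = 0"
      by (simp add: left_diff_distrib)
  qed
  moreover have "AE x in lborel. x \<notin> \<Omega> \<longrightarrow> rep_L2 d x = 0" "AE x in lborel. x \<notin> \<Omega> \<longrightarrow> rep_L2 e x = 0"
    using d(1) e(1) by (auto simp: L2_on_def)
  ultimately have "AE x in lborel. rep_L2 d x = rep_L2 e x" by eventually_elim auto
  then show ?thesis by (simp add: L2_eq_iff_AE)
qed

lemma divg_eqI: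
  assumes "open \<Omega>" "d \<in> L2_on \<Omega>" "is_weak_div \<Omega> \<sigma> d"
  shows "divg \<Omega> \<sigma> = d"
  unfolding divg_def using weak_div_unique assms by (intro the_equality) blast+

section \<open>Integrals depending on a parameter\<close>

text \<open>Dominated convergence along an arbitrary null sequence: by the mean value inequality,
  the bound \<open>w\<close> for the derivatives also bounds the difference quotients.\<close>

lemma has_real_derivative_integral:
  fixes f f' :: "real \<Rightarrow> 'x \<Rightarrow> real"
  assumes r: "r > 0"
    and der: "\<And>s x. \<bar>s - s0\<bar> < r \<Longrightarrow> x \<in> space M \<Longrightarrow> ((\<lambda>s. f s x) has_real_derivative f' s x) (at s)"
    and int: "\<And>s. \<bar>s - s0\<bar> < r \<Longrightarrow> integrable M (f s)"
    and meas: "f' s0 \<in> borel_measurable M"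
    and bound: "\<And>s x. \<bar>s - s0\<bar> < r \<Longrightarrow> x \<in> space M \<Longrightarrow> \<bar>f' s x\<bar> \<le> w x"
    and w: "integrable M w"
  shows "((\<lambda>s. LINT x|M. f s x) has_real_derivative (LINT x|M. f' s0 x)) (at s0)"
  unfolding DERIV_def tendsto_at_iff_sequentially
proof (intro allI impI)
  fix X :: "nat \<Rightarrow> real"
  assume X: "\<forall>i. X i \<in> UNIV - {0}" "X \<longlonglongrightarrow> 0"
  then obtain N where N: "\<And>n. n \<ge> N \<Longrightarrow> \<bar>X n\<bar> < r"
    using r X(2)[THEN LIMSEQ_D, of r] by auto
  \<comment> \<open>Only a tail of the sequence is known to stay where the hypotheses hold, hence
    the shift by \<open>N\<close>.\<close>
  let ?Y = "\<lambda>n. X (n + N)"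
  have Y: "\<bar>?Y n\<bar> < r" "?Y n \<noteq> 0" for n using N[of "n + N"] X by auto
  have Y0: "?Y \<longlonglongrightarrow> 0" using X(2) by (rule LIMSEQ_ignore_initial_segment)
  define q where "q n x = (f (s0 + ?Y n) x - f s0 x) / ?Y n" for n x
  have q_lim: "(\<lambda>n. q n x) \<longlonglongrightarrow> f' s0 x" if x: "x \<in> space M" for x
  proof -
    have "((\<lambda>h. (f (s0 + h) x - f s0 x) / h) \<longlongrightarrow> f' s0 x) (at 0)"
      using der[of s0 x] x r by (simp add: DERIV_def)
    moreover have "filterlim ?Y (at 0) sequentially"
      unfolding filterlim_at using Y0 Y(2) by auto
    ultimately show ?thesis
      unfolding q_def by (rule filterlim_compose[where g="\<lambda>h. (f (s0 + h) x - f s0 x) / h" and f="?Y"])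
  qed
  have q_bound: "norm (q n x) \<le> w x" if x: "x \<in> space M" for n x
  proof -
    have "norm (f (s0 + ?Y n) x - f s0 x) \<le> w x * norm (s0 + ?Y n - s0)"
    proof (rule field_differentiable_bound[where S="ball s0 r" and f="\<lambda>s. f s x" and f'="\<lambda>s. f' s x"])
      show "((\<lambda>s. f s x) has_field_derivative f' z x) (at z within ball s0 r)" if "z \<in> ball s0 r" for z
        using der[of z x] that x
        by (auto simp: dist_real_def intro: has_field_derivative_at_within)
      show "norm (f' z x) \<le> w x" if "z \<in> ball s0 r" for z
        using bound[of z x] that x by (auto simp: dist_real_def)
    qed (use Y[of n] r in \<open>auto simp: dist_real_def\<close>)
    then show ?thesis
      unfolding q_def using Y(2)[of n] by (simp add: norm_divide divide_le_eq)
  qed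
  have q_meas: "q n \<in> borel_measurable M" for n
    unfolding q_def
    using int[of "s0 + ?Y n", THEN borel_measurable_integrable] int[of s0, THEN borel_measurable_integrable] Y[of n] r
    by simp
  have "(\<lambda>n. LINT x|M. q n x) \<longlonglongrightarrow> (LINT x|M. f' s0 x)"
  proof (rule integral_dominated_convergence[OF meas q_meas w])
    show "AE x in M. (\<lambda>n. q n x) \<longlonglongrightarrow> f' s0 x" by (rule AE_I2) (rule q_lim)
    show "AE x in M. norm (q n x) \<le> w x" for n by (rule AE_I2) (rule q_bound)
  qed
  moreover have "(LINT x|M. q n x) = ((LINT x|M. f (s0 + ?Y n) x) - (LINT x|M. f s0 x)) / ?Y n" for n
    unfolding q_def using int[of "s0 + ?Y n"] int[of s0] Y[of n] r by simp
  ultimately have "(\<lambda>n. ((LINT x|M. f (s0 + ?Y n) x) - (LINT x|M. f s0 x)) / ?Y n) \<longlonglongrightarrow> (LINT x|M. f' s0 x)"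
    by simp
  then show "((\<lambda>h. ((LINT x|M. f (s0 + h) x) - (LINT x|M. f s0 x)) / h) \<circ> X) \<longlonglongrightarrow> (LINT x|M. f' s0 x)"
    unfolding o_def by (rule LIMSEQ_offset[where k=N])
qed

lemma continuous_on_integral:
  fixes F :: "'p::metric_space \<Rightarrow> 'x \<Rightarrow> 'b::{banach, second_countable_topology}"
  assumes cont: "\<And>x. x \<in> space M \<Longrightarrow> continuous_on UNIV (\<lambda>p. F p x)"
    and meas: "\<And>p. F p \<in> borel_measurable M"
    and bound: "\<And>p x. x \<in> space M \<Longrightarrow> norm (F p x) \<le> w x" and w: "integrable M w"
  shows "continuous_on UNIV (\<lambda>p. LINT x|M. F p x)"
  unfolding continuous_on_sequentially
proof (intro allI ballI impI, elim conjE)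
  fix X :: "nat \<Rightarrow> 'p" and p assume X: "X \<longlonglongrightarrow> p"
  show "((\<lambda>p. LINT x|M. F p x) \<circ> X) \<longlonglongrightarrow> (LINT x|M. F p x)"
    unfolding o_def
  proof (rule integral_dominated_convergence[where w=w])
    show "AE x in M. (\<lambda>n. F (X n) x) \<longlonglongrightarrow> F p x"
      using cont X by (intro AE_I2) (auto simp: continuous_on_sequentially o_def)
  qed (use meas bound w in auto)
qed

section \<open>Translations\<close>

lemma distr_lborel_reflect: "distr lborel borel (\<lambda>y. x - y) = (lborel :: 'a::euclidean_space measure)"
proof -
  have "(lborel :: 'a measure) = density (distr lborel borel (\<lambda>y. x + (-1) *\<^sub>R y)) (\<lambda>_. ennreal (\<bar>-1\<bar> ^ DIM('a)))"
    using lborel_affine[of "-1" x] by simp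
  then show ?thesis by (simp add: density_1)
qed

lemma distr_lborel_translate: "distr lborel borel (\<lambda>y. x + y) = (lborel :: 'a::euclidean_space measure)"
  using lborel_distr_plus[of x] by simp

lemma
  fixes f :: "'a::euclidean_space \<Rightarrow> 'b::{banach, second_countable_topology}"
  assumes [measurable]: "f \<in> borel_measurable borel"
  shows integral_lborel_reflect: "(LINT y|lborel. f (x - y)) = (LINT y|lborel. f y)"
    and integrable_lborel_reflect_iff: "integrable lborel (\<lambda>y. f (x - y)) \<longleftrightarrow> integrable lborel f"
    and integral_lborel_translate: "(LINT y|lborel. f (x + y)) = (LINT y|lborel. f y)"
    and integrable_lborel_translate_iff: "integrable lborel (\<lambda>y. f (x + y)) \<longleftrightarrow> integrable lborel f"
  using integral_distr[of "\<lambda>y. x - y" lborel borel f] integral_distr[of "\<lambda>y. x + y" lborel borel f]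
    integrable_distr_eq[of "\<lambda>y. x - y" lborel borel f] integrable_distr_eq[of "\<lambda>y. x + y" lborel borel f]
  by (simp_all add: distr_lborel_reflect distr_lborel_translate)

lemma nn_integral_lborel_translate:
  fixes f :: "'a::euclidean_space \<Rightarrow> ennreal"
  assumes [measurable]: "f \<in> borel_measurable borel"
  shows "(\<integral>\<^sup>+y. f (y - x) \<partial>lborel) = (\<integral>\<^sup>+y. f y \<partial>lborel)"
  using nn_integral_distr[of "\<lambda>y. - x + y" lborel borel f]
  by (simp add: distr_lborel_translate del: uminus_add_conv_diff) simp

section \<open>Scalar multiples of constant fields belong to H(div)\<close>

text \<open>Derivatives are assumed at \<open>t = 0\<close> only, but at every base point; moving
  the base point gives the derivative along the whole line.\<close>

lemma directional_derivative_shift: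
  fixes f :: "'a::real_normed_vector \<Rightarrow> real"
  assumes "\<And>x. ((\<lambda>t. f (x + t *\<^sub>R h)) has_real_derivative d x) (at 0)"
  shows "((\<lambda>t. f (x + t *\<^sub>R h)) has_real_derivative d (x + s *\<^sub>R h)) (at s)"
proof -
  have "((\<lambda>t. f (x + s *\<^sub>R h + t *\<^sub>R h)) has_real_derivative d (x + s *\<^sub>R h)) (at 0)" by (rule assms)
  then have "((\<lambda>t. f (x + (t + s) *\<^sub>R h)) has_real_derivative d (x + s *\<^sub>R h)) (at 0)"
    by (simp add: algebra_simps)
  then show ?thesis using DERIV_shift[of "\<lambda>t. f (x + t *\<^sub>R h)" "d (x + s *\<^sub>R h)" 0 s] by simp
qed

text \<open>By translation invariance \<open>s \<mapsto> \<integral> f (x + s h) dx\<close> is constant.\<close>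

lemma integral_directional_derivative_eq_0:
  fixes f d :: "'a::euclidean_space \<Rightarrow> real"
  assumes der: "\<And>x. ((\<lambda>t. f (x + t *\<^sub>R h)) has_real_derivative d x) (at 0)"
    and cont: "continuous_on UNIV f" "continuous_on UNIV d"
    and K: "compact K" and off: "\<And>x. x \<notin> K \<Longrightarrow> f x = 0" "\<And>x. x \<notin> K \<Longrightarrow> d x = 0"
  shows "(LINT x|lborel. d x) = 0"
proof -
  have [measurable]: "f \<in> borel_measurable borel" "d \<in> borel_measurable borel"
    using cont by (auto intro: borel_measurable_continuous_onI)
  obtain R where R: "\<And>x. x \<in> K \<Longrightarrow> norm x \<le> R"
    using compact_imp_bounded[OF K] by (auto simp: bounded_iff)
  have "bounded (d ` K)"
    using K cont by (intro compact_imp_bounded compact_continuous_image) (auto intro: continuous_on_subset)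
  then obtain C where C: "\<And>x. x \<in> K \<Longrightarrow> \<bar>d x\<bar> \<le> C" by (auto simp: bounded_iff)
  have "integrable lborel (\<lambda>x. indicator K x *\<^sub>R f x)"
    using K cont by (intro borel_integrable_compact) (auto intro: continuous_on_subset)
  moreover have "(\<lambda>x. indicator K x *\<^sub>R f x) = f" using off by (auto simp: indicator_def fun_eq_iff)
  ultimately have f: "integrable lborel f" by simp
  have "((\<lambda>s. LINT x|lborel. f (x + s *\<^sub>R h)) has_real_derivative (LINT x|lborel. d (x + 0 *\<^sub>R h))) (at 0)"
  \<comment> \<open>For |s| < 1 the translates of \<open>K\<close> by multiples
    \<open>s *\<^sub>R h\<close> stay in the ball of radius \<open>R + norm h\<close>, whose
    indicator gives one integrable bound for all these \<open>s\<close>.\<close>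
  proof (rule has_real_derivative_integral[where r=1 and w="\<lambda>x. \<bar>C\<bar> * indicator (cball 0 (R + norm h)) x"])
    show "((\<lambda>s. f (x + s *\<^sub>R h)) has_real_derivative d (x + s *\<^sub>R h)) (at s)" for s x
      using der by (rule directional_derivative_shift)
    show "integrable lborel (\<lambda>x. f (x + s *\<^sub>R h))" for s
      using integrable_lborel_translate_iff[of f "s *\<^sub>R h"] f by (simp add: add.commute)
    show "\<bar>d (x + s *\<^sub>R h)\<bar> \<le> \<bar>C\<bar> * indicator (cball 0 (R + norm h)) x" if s: "\<bar>s - 0\<bar> < 1" for s x
    proof (cases "x + s *\<^sub>R h \<in> K")
      case True
      have "norm x \<le> norm (x + s *\<^sub>R h) + norm (s *\<^sub>R h)" using norm_triangle_ineq4[of "x + s *\<^sub>R h" "s *\<^sub>R h"] by simp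
      also have "\<dots> \<le> R + norm h" using R[OF True] s by (intro add_mono) (auto simp: mult_left_le_one_le)
      finally show ?thesis using C[OF True] by (simp add: indicator_def)
    qed (use off in auto)
    show "integrable lborel (\<lambda>x. \<bar>C\<bar> * indicator (cball 0 (R + norm h)) x)"
      by (intro integrable_mult_right integrable_real_indicator) (auto intro!: emeasure_bounded_finite[unfolded infinity_ennreal_def])
  qed auto
  moreover have "(LINT x|lborel. f (x + s *\<^sub>R h)) = (LINT x|lborel. f x)" for s
    using integral_lborel_translate[of f "s *\<^sub>R h"] by (simp add: add.commute)
  ultimately have "((\<lambda>s. LINT x|lborel. f x) has_real_derivative (LINT x|lborel. d x)) (at (0::real))" by simp
  then show ?thesis using DERIV_const DERIV_unique by blast
qed

lemma test_function_derivative: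
  fixes \<phi> :: "'a::euclidean_space \<Rightarrow> real"
  assumes \<phi>: "test_function \<Omega> \<phi>"
  shows "((\<lambda>t. \<phi> (x + t *\<^sub>R h)) has_real_derivative frechet_derivative \<phi> (at x) h) (at 0)"
    and "continuous_on UNIV (\<lambda>x. frechet_derivative \<phi> (at x) h)"
    and "linear (frechet_derivative \<phi> (at x))"
    and "x \<notin> closure {x. \<phi> x \<noteq> 0} \<Longrightarrow> frechet_derivative \<phi> (at x) = (\<lambda>h. 0)"
proof -
  have 1: "C_k (Suc 0) \<phi>" using \<phi> by (simp only: test_function_def)
  then have D: "(\<phi> has_derivative frechet_derivative \<phi> (at x)) (at x)" for x
    by (simp add: frechet_derivative_works)
  show lin: "linear (frechet_derivative \<phi> (at x))" for x
    using D has_derivative_linear by blast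
  have "((\<lambda>t. x + t *\<^sub>R h) has_derivative (\<lambda>t. t *\<^sub>R h)) (at 0)"
    by (auto intro!: derivative_eq_intros)
  from has_derivative_compose[OF this, of \<phi> "frechet_derivative \<phi> (at x)"] D
  show "((\<lambda>t. \<phi> (x + t *\<^sub>R h)) has_real_derivative frechet_derivative \<phi> (at x) h) (at 0)"
    using lin by (simp add: has_field_derivative_def linear_cmul mult_commute_abs)
  \<comment> \<open>\<open>C_k\<close> speaks of derivatives in basis directions only; any other
    direction is expanded in coordinates.\<close>
  have "frechet_derivative \<phi> (at x) h = (\<Sum>b\<in>Basis. (h \<bullet> b) * frechet_derivative \<phi> (at x) b)" for x
    using linear_sum[OF lin, of x "\<lambda>b. (h \<bullet> b) *\<^sub>R b" Basis]
    by (simp add: linear_cmul[OF lin] euclidean_representation)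
  then show "continuous_on UNIV (\<lambda>x. frechet_derivative \<phi> (at x) h)"
    using 1 by (auto intro!: continuous_intros)
  show "frechet_derivative \<phi> (at x) = (\<lambda>h. 0)" if "x \<notin> closure {x. \<phi> x \<noteq> 0}"
  proof (rule frechet_derivative_at[symmetric])
    have "((\<lambda>x. 0) has_derivative (\<lambda>h. 0)) (at x)" by simp
    then show "(\<phi> has_derivative (\<lambda>h. 0)) (at x)"
      by (rule has_derivative_transform_within_open[where s="- closure {x. \<phi> x \<noteq> 0}"])
        (use that closure_subset[of "{x. \<phi> x \<noteq> 0}"] in auto)
  qed
qed

lemma square_integrable_bounded_support:
  fixes f :: "'a::euclidean_space \<Rightarrow> 'b::euclidean_space"
  assumes \<Omega>: "bounded \<Omega>" "\<Omega> \<in> sets borel" and f: "continuous_on UNIV f"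
  shows "square_integrable (\<lambda>x. indicator \<Omega> x *\<^sub>R f x)"
proof -
  have [measurable]: "f \<in> borel_measurable borel" "\<Omega> \<in> sets borel"
    using assms by (auto intro: borel_measurable_continuous_onI)
  have c: "compact (closure \<Omega>)" using \<Omega> by (simp add: compact_closure)
  have "integrable lborel (\<lambda>x. indicator (closure \<Omega>) x *\<^sub>R (norm (f x))\<^sup>2)"
    by (intro borel_integrable_compact c continuous_intros continuous_on_subset[OF f]) auto
  then have "integrable lborel (\<lambda>x. (norm (indicator \<Omega> x *\<^sub>R f x))\<^sup>2)"
    by (rule Bochner_Integration.integrable_bound)
      (use closure_subset[of \<Omega>] in \<open>auto simp: indicator_def\<close>)
  then show ?thesis by (simp add: square_integrable_def)
qed

lemma abs_L2_in_L2_on: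
  assumes "square_integrable f" "\<And>x. x \<notin> \<Omega> \<Longrightarrow> f x = 0"
  shows "abs_L2 f \<in> L2_on \<Omega>"
  using rep_abs_L2[OF assms(1)] assms(2) unfolding L2_on_def by (auto elim: AE_mp)

text \<open>The jump of the cut-off field across the boundary is invisible to test functions, whose
  supports are compact in \<open>\<Omega>\<close>. Integration by parts then amounts to the
  vanishing of the integral of the derivative of \<open>\<phi>\<close> times \<open>r\<close> in
  direction \<open>h\<close>.\<close>

lemma scalar_field_in_Hdiv:
  fixes r d :: "'a::euclidean_space \<Rightarrow> real"
  assumes \<Omega>: "open \<Omega>" "bounded \<Omega>"
    and der: "\<And>x. ((\<lambda>t. r (x + t *\<^sub>R h)) has_real_derivative d x) (at 0)"
    and cont: "continuous_on UNIV r" "continuous_on UNIV d"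
  shows "abs_L2 (\<lambda>x. indicator \<Omega> x *\<^sub>R (r x *\<^sub>R h)) \<in> Hdiv \<Omega>" (is "abs_L2 ?t \<in> _")
    and "divg \<Omega> (abs_L2 (\<lambda>x. indicator \<Omega> x *\<^sub>R (r x *\<^sub>R h))) = abs_L2 (\<lambda>x. indicator \<Omega> x *\<^sub>R d x)" (is "_ = abs_L2 ?d")
proof -
  have [measurable]: "r \<in> borel_measurable borel" "d \<in> borel_measurable borel" "\<Omega> \<in> sets borel"
    using cont \<Omega> by (auto intro: borel_measurable_continuous_onI)
  have t: "square_integrable ?t" and d: "square_integrable ?d"
    using \<Omega> cont by (intro square_integrable_bounded_support continuous_intros; simp)+
  have "is_weak_div \<Omega> (abs_L2 ?t) (abs_L2 ?d)"
    unfolding is_weak_div_def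
  proof (intro allI impI)
    fix \<phi> :: "'a \<Rightarrow> real" assume \<phi>: "test_function \<Omega> \<phi>"
    let ?D = "\<lambda>x. frechet_derivative \<phi> (at x)"
    define K where "K = closure {x. \<phi> x \<noteq> 0}"
    have K: "compact K" "K \<subseteq> \<Omega>" using \<phi> by (auto simp: test_function_def K_def)
    have \<phi>0: "\<phi> x = 0" if "x \<notin> K" for x using that closure_subset[of "{x. \<phi> x \<noteq> 0}"] by (auto simp: K_def)
    have D0: "?D x v = 0" if "x \<notin> K" for x v using test_function_derivative(4)[OF \<phi>] that by (simp add: K_def)
    have c\<phi>: "continuous_on UNIV \<phi>" by (rule test_function_continuous[OF \<phi>])
    note cD = test_function_derivative(2)[OF \<phi>]
    have [measurable]: "\<phi> \<in> borel_measurable borel" "(\<lambda>x. ?D x v) \<in> borel_measurable borel" for v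
      using c\<phi> cD by (auto intro: borel_measurable_continuous_onI)
    have D_eq: "?D x v = (\<Sum>b\<in>Basis. (v \<bullet> b) * ?D x b)" for x v
      using linear_sum[OF test_function_derivative(3)[OF \<phi>], of x "\<lambda>b. (v \<bullet> b) *\<^sub>R b" Basis]
      by (simp add: linear_cmul[OF test_function_derivative(3)[OF \<phi>]] euclidean_representation)
    have meas: "(\<lambda>x. ?D x (g x)) \<in> borel_measurable borel" if [measurable]: "g \<in> borel_measurable borel" for g
      by (subst D_eq) measurable
    have "(LINT x|lborel. ?D x (rep_L2 (abs_L2 ?t) x)) = (LINT x|lborel. ?D x (?t x))"
      using rep_abs_L2[OF t] by (intro integral_cong_AE) (auto intro!: meas elim: AE_mp)
    also have "\<dots> = (LINT x|lborel. ?D x h * r x)"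
    proof (intro Bochner_Integration.integral_cong refl)
      fix x show "?D x (?t x) = ?D x h * r x"
        using K(2) D0[of x] linear_cmul[OF test_function_derivative(3)[OF \<phi>, of x]]
        by (cases "x \<in> K") (auto simp: indicator_def)
    qed
    also have "\<dots> = - (LINT x|lborel. \<phi> x * d x)"
    proof -
      have der': "((\<lambda>t. \<phi> (x + t *\<^sub>R h) * r (x + t *\<^sub>R h)) has_real_derivative (?D x h * r x + \<phi> x * d x)) (at 0)" for x
        using DERIV_mult[OF test_function_derivative(1)[OF \<phi>, of x h] der[of x]] by (simp add: mult.commute add.commute)
      have "(LINT x|lborel. ?D x h * r x + \<phi> x * d x) = 0"
      proof (rule integral_directional_derivative_eq_0[OF der' _ _ K(1)])
        show "continuous_on UNIV (\<lambda>x. \<phi> x * r x)" by (intro continuous_intros c\<phi> cont)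
        show "continuous_on UNIV (\<lambda>x. ?D x h * r x + \<phi> x * d x)" by (intro continuous_intros c\<phi> cD cont)
      qed (simp_all add: \<phi>0 D0)
      moreover have "integrable lborel (\<lambda>x. g x)" if "continuous_on UNIV g" "\<And>x. x \<notin> K \<Longrightarrow> g x = 0" for g :: "'a \<Rightarrow> real"
      proof -
        have "integrable lborel (\<lambda>x. indicator K x *\<^sub>R g x)"
          using K(1) that(1) by (intro borel_integrable_compact) (auto intro: continuous_on_subset)
        moreover have "(\<lambda>x. indicator K x *\<^sub>R g x) = g" using that(2) by (auto simp: indicator_def fun_eq_iff)
        ultimately show ?thesis by simp
      qed
      from this[of "\<lambda>x. ?D x h * r x"] this[of "\<lambda>x. \<phi> x * d x"]
      have "integrable lborel (\<lambda>x. ?D x h * r x)" "integrable lborel (\<lambda>x. \<phi> x * d x)"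
        by (simp_all add: \<phi>0 D0 continuous_on_mult c\<phi> cD cont)
      ultimately show ?thesis by simp
    qed
    also have "(LINT x|lborel. \<phi> x * d x) = (LINT x|lborel. ?d x * \<phi> x)"
      using K(2) \<phi>0 by (intro Bochner_Integration.integral_cong refl) (auto simp: indicator_def)
    also have "\<dots> = (LINT x|lborel. rep_L2 (abs_L2 ?d) x * \<phi> x)"
      using rep_abs_L2[OF d] by (intro integral_cong_AE) (auto elim: AE_mp)
    finally show "(LINT x|lborel. ?D x (rep_L2 (abs_L2 ?t) x)) = - (LINT x|lborel. rep_L2 (abs_L2 ?d) x * \<phi> x)" .
  qed
  moreover have "abs_L2 ?t \<in> L2_on \<Omega>" "abs_L2 ?d \<in> L2_on \<Omega>"
    using t d by (auto intro!: abs_L2_in_L2_on)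
  ultimately show "abs_L2 ?t \<in> Hdiv \<Omega>" "divg \<Omega> (abs_L2 ?t) = abs_L2 ?d"
    using \<Omega> by (auto simp: Hdiv_def intro!: divg_eqI)
qed

text \<open>No test function is needed for \<open>r\<close>: \<open>u\<close> satisfies the Dirichlet condition, so its extension by
  zero is weakly differentiable on the whole space.\<close>

lemma weak_gradient_identity:
  fixes \<sigma> :: "('a::euclidean_space, 'a) L2"
  assumes \<Omega>: "open \<Omega>" "bounded \<Omega>"
    and eq: "\<And>\<tau>. \<tau> \<in> Hdiv \<Omega> \<Longrightarrow> inner \<sigma> \<tau> + inner (divg \<Omega> \<tau>) u = 0"
    and der: "\<And>x. ((\<lambda>t. r (x + t *\<^sub>R h)) has_real_derivative d x) (at 0)"
    and cont: "continuous_on UNIV r" "continuous_on UNIV d"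
  shows "(LINT x|lborel. r x * ((indicator \<Omega> x *\<^sub>R rep_L2 \<sigma> x) \<bullet> h)) = - (LINT x|lborel. d x * (indicator \<Omega> x *\<^sub>R rep_L2 u x))"
proof -
  have B: "\<Omega> \<in> sets borel" using \<Omega> by auto
  have "inner \<sigma> (abs_L2 (\<lambda>x. indicator \<Omega> x *\<^sub>R (r x *\<^sub>R h))) = (LINT x|lborel. rep_L2 \<sigma> x \<bullet> (indicator \<Omega> x *\<^sub>R (r x *\<^sub>R h)))"
    using \<Omega> B cont by (intro inner_L2_abs square_integrable_bounded_support continuous_intros)
  moreover have "inner u (abs_L2 (\<lambda>x. indicator \<Omega> x *\<^sub>R d x)) = (LINT x|lborel. rep_L2 u x \<bullet> (indicator \<Omega> x *\<^sub>R d x))"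
    using \<Omega> B cont by (intro inner_L2_abs square_integrable_bounded_support continuous_intros)
  moreover note eq[OF scalar_field_in_Hdiv(1)[OF \<Omega> der cont], unfolded scalar_field_in_Hdiv(2)[OF \<Omega> der cont]]
    inner_commute[of u "abs_L2 (\<lambda>x. indicator \<Omega> x *\<^sub>R d x)"]
  ultimately have "(LINT x|lborel. rep_L2 \<sigma> x \<bullet> (indicator \<Omega> x *\<^sub>R (r x *\<^sub>R h))) + (LINT x|lborel. rep_L2 u x \<bullet> (indicator \<Omega> x *\<^sub>R d x)) = 0"
    by linarith
  then show ?thesis by (simp add: mult_ac)
qed

section \<open>Mollification\<close>

text \<open>A C^1 truncation with explicit derivative, from which both the mollifier and the later
  kernels \<open>bump\<close> are built.\<close>

lemma power2_positive_part_derivative: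
  "((\<lambda>s::real. (max 0 s)\<^sup>2) has_real_derivative 2 * max 0 s) (at s)"
proof -
  consider "s > 0" | "s < 0" | "s = 0" by linarith
  then show ?thesis
  proof cases
    case 1
    have "((\<lambda>s. s\<^sup>2) has_real_derivative 2 * max 0 s) (at s)"
      using 1 by (auto intro!: derivative_eq_intros)
    then show ?thesis
      by (rule has_field_derivative_transform_within_open[where S="{0<..}"]) (use 1 in auto)
  next
    case 2
    have "((\<lambda>s. 0) has_real_derivative 2 * max 0 s) (at s)"
      using 2 by simp
    then show ?thesis
      by (rule has_field_derivative_transform_within_open[where S="{..<0}"]) (use 2 in auto)
  next
    case 3
    have "((\<lambda>h. (max 0 h)\<^sup>2 / h) \<longlongrightarrow> 0) (at (0::real))"
    proof (rule Lim_null_comparison[where g="\<lambda>h. \<bar>h\<bar>"])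
      show "eventually (\<lambda>h::real. norm ((max 0 h)\<^sup>2 / h) \<le> \<bar>h\<bar>) (at 0)"
        by (auto simp: eventually_at_filter max_def power2_eq_square)
      show "((\<lambda>h. \<bar>h\<bar>) \<longlongrightarrow> 0) (at (0::real))" by (auto intro!: tendsto_eq_intros)
    qed
    then show ?thesis using 3 by (simp add: DERIV_def)
  qed
qed

text \<open>The kernel is (e^2 - |z|^2)^2 cut off at the sphere of radius \<open>e\<close> and
  divided by its integral. The convolutions use one continuous derivative, and this kernel has the
  explicit gradient - 4 (e^2 - |z|^2) z inside the ball, up to the same factor.\<close>

lemma mollifier_exists:
  assumes e: "e > 0"
  obtains \<rho> :: "'a::euclidean_space \<Rightarrow> real" and D :: "'a \<Rightarrow> 'a" and C where
    "\<And>z. 0 \<le> \<rho> z" "continuous_on UNIV \<rho>" "continuous_on UNIV D"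
    "\<And>z h. ((\<lambda>t. \<rho> (z + t *\<^sub>R h)) has_real_derivative D z \<bullet> h) (at 0)"
    "\<And>z. e \<le> norm z \<Longrightarrow> \<rho> z = 0" "integrable lborel \<rho>" "(LINT z|lborel. \<rho> z) = 1"
    "\<And>z. \<rho> z \<le> C" "\<And>z. norm (D z) \<le> C"
proof -
  let ?r = "\<lambda>z::'a. (max 0 (e\<^sup>2 - z \<bullet> z))\<^sup>2"
  let ?D = "\<lambda>z::'a. (- 4 * max 0 (e\<^sup>2 - z \<bullet> z)) *\<^sub>R z"
  have cont: "continuous_on UNIV ?r" "continuous_on UNIV ?D"
    by (intro continuous_intros)+
  have off: "max 0 (e\<^sup>2 - z \<bullet> z) = 0" if "e \<le> norm z" for z :: 'a
    using e that by (simp add: dot_square_norm max_def)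
  have der: "((\<lambda>t. ?r (z + t *\<^sub>R h)) has_real_derivative ?D z \<bullet> h) (at 0)" for z h
  proof -
    have "((\<lambda>t. e\<^sup>2 - (z + t *\<^sub>R h) \<bullet> (z + t *\<^sub>R h)) has_real_derivative - 2 * (z \<bullet> h)) (at 0)"
      unfolding inner_add_left inner_add_right inner_scaleR_left inner_scaleR_right
      by (auto intro!: derivative_eq_intros simp: inner_commute)
    from DERIV_chain2[OF power2_positive_part_derivative this] show ?thesis by (simp add: mult_ac)
  qed
  have int: "integrable lborel ?r"
  proof -
    have "integrable lborel (\<lambda>z. indicator (cball 0 e) z *\<^sub>R ?r z)"
      using cont by (intro borel_integrable_compact) (auto intro: continuous_on_subset)
    moreover have "(\<lambda>z. indicator (cball 0 e) z *\<^sub>R ?r z) = ?r"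
      using off by (auto simp: indicator_def fun_eq_iff)
    ultimately show ?thesis by simp
  qed
  define c where "c = (LINT z|lborel. ?r z)"
  have "c > 0"
  proof -
    have "c \<noteq> 0"
    proof
      assume "c = 0"
      then have "AE z in lborel. ?r z = 0"
        using integral_nonneg_eq_0_iff_AE[OF int] by (simp add: c_def)
      then have "AE z in lborel. z \<notin> ball (0::'a) e"
      proof eventually_elim
        case (elim z)
        have "e\<^sup>2 > z \<bullet> z" if "norm z < e"
          using that by (simp add: dot_square_norm power_strict_mono)
        then show ?case using elim by auto
      qed
      then have "ball (0::'a) e \<in> null_sets lborel" by (simp add: AE_iff_null_sets)
      then have "measure lborel (ball (0::'a) e) = 0" by (simp add: measure_eq_0_null_sets)
      then show False using content_ball_pos[OF e, of "0::'a"] by simp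
    qed
    moreover have "c \<ge> 0" unfolding c_def by (intro integral_nonneg_AE) simp
    ultimately show ?thesis by simp
  qed
  have bdd: "\<exists>C. \<forall>z. norm (f z) \<le> C" if f: "continuous_on UNIV f" "\<And>z. e \<le> norm z \<Longrightarrow> f z = 0"
    for f :: "'a \<Rightarrow> 'c::real_normed_vector"
  proof -
    have "bounded (f ` cball 0 e)"
      using f(1) by (intro compact_imp_bounded compact_continuous_image) (auto intro: continuous_on_subset)
    then obtain C where C: "\<forall>z\<in>cball 0 e. norm (f z) \<le> C" by (auto simp: bounded_iff)
    have "norm (f z) \<le> max C 0" for z
      using C f(2)[of z] by (cases "norm z \<le> e") (auto simp: le_max_iff_disj)
    then show ?thesis by blast
  qed
  define \<rho> where "\<rho> z = ?r z / c" for z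
  define D where "D z = (1 / c) *\<^sub>R ?D z" for z
  have cont': "continuous_on UNIV \<rho>" "continuous_on UNIV D"
    unfolding \<rho>_def D_def using \<open>c > 0\<close> by (intro continuous_intros cont; simp)+
  have off': "\<rho> z = 0" "D z = 0" if "e \<le> norm z" for z using off[OF that] by (simp_all add: \<rho>_def D_def)
  obtain C1 C2 where C: "\<And>z. norm (\<rho> z) \<le> C1" "\<And>z. norm (D z) \<le> C2"
    using bdd[OF cont'(1) off'(1)] bdd[OF cont'(2) off'(2)] by blast
  show thesis
  proof (rule that[of \<rho> D "max C1 C2"])
    show "((\<lambda>t. \<rho> (z + t *\<^sub>R h)) has_real_derivative D z \<bullet> h) (at 0)" for z h
      using DERIV_cdivide[OF der[of z h], of c] by (simp add: \<rho>_def D_def)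
    show "integrable lborel \<rho>" unfolding \<rho>_def using int by simp
    show "(LINT z|lborel. \<rho> z) = 1" unfolding \<rho>_def using \<open>c > 0\<close> by (simp add: c_def)
    show "\<rho> z \<le> max C1 C2" "norm (D z) \<le> max C1 C2" for z
      using C(1)[of z] C(2)[of z] by auto
    show "0 \<le> \<rho> z" for z using \<open>c > 0\<close> by (simp add: \<rho>_def)
  qed (use cont' off' in auto)
qed

section \<open>Continuity of translations in L2\<close>

lemma norm_power2_add_le: "(norm (u + v :: 'b::real_normed_vector))\<^sup>2 \<le> 2 * (norm u)\<^sup>2 + 2 * (norm v)\<^sup>2"
proof -
  have "(norm (u + v))\<^sup>2 \<le> (norm u + norm v)\<^sup>2"
    by (intro power_mono norm_triangle_ineq) auto
  also have "\<dots> \<le> 2 * (norm u)\<^sup>2 + 2 * (norm v)\<^sup>2"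
    using zero_le_power2[of "norm u - norm v"] by (simp add: power2_eq_square algebra_simps)
  finally show ?thesis .
qed

lemma nn_integral_norm_power2_add_le:
  fixes f g :: "'x \<Rightarrow> 'b::{second_countable_topology, real_normed_vector}"
  assumes [measurable]: "f \<in> borel_measurable M" "g \<in> borel_measurable M"
  shows "(\<integral>\<^sup>+x. ennreal ((norm (f x + g x))\<^sup>2) \<partial>M) \<le>
    2 * (\<integral>\<^sup>+x. ennreal ((norm (f x))\<^sup>2) \<partial>M) + 2 * (\<integral>\<^sup>+x. ennreal ((norm (g x))\<^sup>2) \<partial>M)"
proof -
  have "(\<integral>\<^sup>+x. ennreal ((norm (f x + g x))\<^sup>2) \<partial>M) \<le> (\<integral>\<^sup>+x. 2 * ennreal ((norm (f x))\<^sup>2) + 2 * ennreal ((norm (g x))\<^sup>2) \<partial>M)"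
  proof (rule nn_integral_mono)
    fix x
    have "ennreal ((norm (f x + g x))\<^sup>2) \<le> ennreal (2 * (norm (f x))\<^sup>2 + 2 * (norm (g x))\<^sup>2)"
      by (intro ennreal_leI norm_power2_add_le)
    then show "ennreal ((norm (f x + g x))\<^sup>2) \<le> 2 * ennreal ((norm (f x))\<^sup>2) + 2 * ennreal ((norm (g x))\<^sup>2)"
      by (simp add: ennreal_plus ennreal_mult')
  qed
  also have "\<dots> = 2 * (\<integral>\<^sup>+x. ennreal ((norm (f x))\<^sup>2) \<partial>M) + 2 * (\<integral>\<^sup>+x. ennreal ((norm (g x))\<^sup>2) \<partial>M)"
    by (simp add: nn_integral_add nn_integral_cmult)
  finally show ?thesis .
qed

text \<open>Stated with the nonnegative integral, so that sums and limits carry no integrability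
  side conditions.\<close>

definition L2_translation_continuous :: "('a::euclidean_space \<Rightarrow> 'b::euclidean_space) \<Rightarrow> bool" where
  "L2_translation_continuous f \<longleftrightarrow> f \<in> borel_measurable borel \<and>
     (\<forall>\<eta>>0. \<exists>\<delta>>0. \<forall>t. norm t < \<delta> \<longrightarrow> (\<integral>\<^sup>+x. ennreal ((norm (f (x - t) - f x))\<^sup>2) \<partial>lborel) \<le> ennreal \<eta>)"

lemma L2_translation_continuousE:
  assumes "L2_translation_continuous f" "\<eta> > 0"
  obtains \<delta> where "\<delta> > 0" "\<And>t. norm t < \<delta> \<Longrightarrow> (\<integral>\<^sup>+x. ennreal ((norm (f (x - t) - f x))\<^sup>2) \<partial>lborel) \<le> ennreal \<eta>"
  using assms unfolding L2_translation_continuous_def by blast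

lemma L2_translation_continuous_add:
  assumes f: "L2_translation_continuous f" and g: "L2_translation_continuous g"
  shows "L2_translation_continuous (\<lambda>x. f x + g x)"
  unfolding L2_translation_continuous_def
proof (intro conjI allI impI)
  have [measurable]: "f \<in> borel_measurable borel" "g \<in> borel_measurable borel"
    using f g by (auto simp: L2_translation_continuous_def)
  show "(\<lambda>x. f x + g x) \<in> borel_measurable borel" by measurable
  fix \<eta> :: real assume \<eta>: "\<eta> > 0"
  then have "\<eta> / 4 > 0" by simp
  obtain d1 where d1: "d1 > 0" "\<And>t. norm t < d1 \<Longrightarrow> (\<integral>\<^sup>+x. ennreal ((norm (f (x - t) - f x))\<^sup>2) \<partial>lborel) \<le> ennreal (\<eta> / 4)"
    using L2_translation_continuousE[OF f \<open>\<eta> / 4 > 0\<close>] by blast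
  obtain d2 where d2: "d2 > 0" "\<And>t. norm t < d2 \<Longrightarrow> (\<integral>\<^sup>+x. ennreal ((norm (g (x - t) - g x))\<^sup>2) \<partial>lborel) \<le> ennreal (\<eta> / 4)"
    using L2_translation_continuousE[OF g \<open>\<eta> / 4 > 0\<close>] by blast
  show "\<exists>\<delta>>0. \<forall>t. norm t < \<delta> \<longrightarrow> (\<integral>\<^sup>+x. ennreal ((norm (f (x - t) + g (x - t) - (f x + g x)))\<^sup>2) \<partial>lborel) \<le> ennreal \<eta>"
  proof (intro exI[of _ "min d1 d2"] conjI allI impI)
    show "min d1 d2 > 0" using d1 d2 by simp
    fix t :: 'a assume t: "norm t < min d1 d2"
    have eq: "f (x - t) + g (x - t) - (f x + g x) = (f (x - t) - f x) + (g (x - t) - g x)" for x by simp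
    have "(\<integral>\<^sup>+x. ennreal ((norm (f (x - t) + g (x - t) - (f x + g x)))\<^sup>2) \<partial>lborel) \<le> 2 * (\<integral>\<^sup>+x. ennreal ((norm (f (x - t) - f x))\<^sup>2) \<partial>lborel) + 2 * (\<integral>\<^sup>+x. ennreal ((norm (g (x - t) - g x))\<^sup>2) \<partial>lborel)"
      unfolding eq by (rule nn_integral_norm_power2_add_le) measurable
    also have "\<dots> \<le> 2 * ennreal (\<eta> / 4) + 2 * ennreal (\<eta> / 4)"
      using d1 d2 t by (intro add_mono mult_left_mono) auto
    also have "2 * ennreal (\<eta> / 4) = ennreal (\<eta> / 2)"
      using ennreal_mult'[of 2 "\<eta> / 4"] by simp
    also have "ennreal (\<eta> / 2) + ennreal (\<eta> / 2) = ennreal \<eta>"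
      using \<eta> by (subst ennreal_plus[symmetric]) auto
    finally show "(\<integral>\<^sup>+x. ennreal ((norm (f (x - t) + g (x - t) - (f x + g x)))\<^sup>2) \<partial>lborel) \<le> ennreal \<eta>" .
  qed
qed

lemma L2_translation_continuous_zero: "L2_translation_continuous (\<lambda>x. 0)"
  unfolding L2_translation_continuous_def by (auto intro!: exI[of _ 1])

lemma L2_translation_continuous_sum:
  assumes "finite I" "\<And>i. i \<in> I \<Longrightarrow> L2_translation_continuous (f i)"
  shows "L2_translation_continuous (\<lambda>x. \<Sum>i\<in>I. f i x)"
  using assms by (induction I rule: finite_induct)
    (auto intro: L2_translation_continuous_add L2_translation_continuous_zero)

text \<open>Outer regularity of \<open>A\<close> and of its complement gives open sets
  \<open>U\<close> and \<open>V\<close> whose intersection has small measure. The complement of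
  \<open>V\<close> is compact in \<open>U\<close>, so it keeps a distance \<open>d\<close> from the
  complement of \<open>U\<close>. If a translation by less than \<open>d\<close> changes the
  membership in \<open>A\<close>, then the point or its translate lies in the intersection.\<close>

lemma L2_translation_continuous_indicator:
  fixes A :: "'a::euclidean_space set" and c :: "'b::euclidean_space"
  assumes A: "A \<in> sets borel" "bounded A"
  shows "L2_translation_continuous (\<lambda>x. indicator A x *\<^sub>R c)"
  unfolding L2_translation_continuous_def
proof (intro conjI allI impI)
  have [measurable]: "A \<in> sets borel" by (rule A)
  show "(\<lambda>x. indicator A x *\<^sub>R c) \<in> borel_measurable borel" by measurable
  fix \<eta> :: real assume \<eta>: "\<eta> > 0"
  \<comment> \<open>The intersection has measure at most \<open>2 * e\<close> and is counted twice,
    once translated, which gives the factor 4; the summand 1 covers \<open>c = 0\<close>.\<close>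
  define e where "e = \<eta> / (4 * ((norm c)\<^sup>2 + 1))"
  have pos: "(norm c)\<^sup>2 + 1 > 0" by (simp add: add_nonneg_pos)
  then have e: "e > 0" using \<eta> by (simp add: e_def)
  have e': "4 * e * (norm c)\<^sup>2 \<le> \<eta>"
    using \<eta> pos by (simp add: e_def field_simps)
  obtain U where U: "open U" "A \<subseteq> U" "emeasure lborel (U - A) < e"
    using outer_regular_lborel[OF A(1) e] by blast
  obtain V where V: "open V" "- A \<subseteq> V" "emeasure lborel (V - (- A)) < e"
    using outer_regular_lborel[of "- A", OF _ e] A by auto
  have "compact (- V)" using V A(2)
    by (auto simp: compact_eq_bounded_closed closed_Compl intro: bounded_subset)
  moreover have "- V \<subseteq> U" using V U by auto
  ultimately obtain d where d: "d > 0" "(\<Union>x\<in>- V. ball x d) \<subseteq> U"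
    using compact_subset_open_imp_ball_epsilon_subset U(1) by metis
  let ?W = "U \<inter> V"
  have [measurable]: "U \<in> sets borel" "V \<in> sets borel" using U V by auto
  have "emeasure lborel ?W \<le> emeasure lborel ((U - A) \<union> (V - (- A)))"
    by (intro emeasure_mono) auto
  also have "\<dots> \<le> emeasure lborel (U - A) + emeasure lborel (V - (- A))"
    by (intro emeasure_subadditive) auto
  also have "\<dots> \<le> ennreal e + ennreal e" using U V by (intro add_mono) auto
  also have "\<dots> = ennreal (2 * e)" using e by (subst ennreal_plus[symmetric]) auto
  finally have W: "emeasure lborel ?W \<le> ennreal (2 * e)" .
  show "\<exists>\<delta>>0. \<forall>t. norm t < \<delta> \<longrightarrow> (\<integral>\<^sup>+x. ennreal ((norm (indicator A (x - t) *\<^sub>R c - indicator A x *\<^sub>R c))\<^sup>2) \<partial>lborel) \<le> ennreal \<eta>"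
  proof (intro exI[of _ d] conjI allI impI d(1))
    fix t :: 'a assume t: "norm t < d"
    have key: "ennreal ((norm (indicator A (x - t) *\<^sub>R c - indicator A x *\<^sub>R c))\<^sup>2) \<le>
        ennreal ((norm c)\<^sup>2) * (indicator ?W x + indicator ?W (x - t))" for x
    proof -
      have near: "y \<in> U" if "z \<notin> V" "dist z y < d" for y z
      proof -
        have "y \<in> (\<Union>x\<in>- V. ball x d)" using that by (auto intro!: bexI[of _ z])
        then show ?thesis using d(2) by blast
      qed
      have "x \<in> ?W \<or> x - t \<in> ?W" if "x - t \<in> A \<longleftrightarrow> x \<notin> A"
        using that near[of x "x - t"] near[of "x - t" x] t U(2) V(2) by (auto simp: dist_norm)
      moreover have "a \<le> a * 2" for a :: ennreal by (metis le_iff_add mult_2_right)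
      ultimately show ?thesis by (auto simp: indicator_def)
    qed
    have "(\<integral>\<^sup>+x. ennreal ((norm (indicator A (x - t) *\<^sub>R c - indicator A x *\<^sub>R c))\<^sup>2) \<partial>lborel) \<le>
       (\<integral>\<^sup>+x. ennreal ((norm c)\<^sup>2) * (indicator ?W x + indicator ?W (x - t)) \<partial>lborel)"
      by (intro nn_integral_mono key)
    also have "\<dots> = ennreal ((norm c)\<^sup>2) * ((\<integral>\<^sup>+x. indicator ?W x \<partial>lborel) + (\<integral>\<^sup>+x. indicator ?W (x - t) \<partial>lborel))"
      by (subst nn_integral_cmult, simp, subst nn_integral_add) auto
    also have "(\<integral>\<^sup>+x. indicator ?W (x - t) \<partial>lborel) = (\<integral>\<^sup>+x. indicator ?W x \<partial>lborel)"
      by (rule nn_integral_lborel_translate) simp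
    also have "(\<integral>\<^sup>+x. indicator ?W x \<partial>lborel) = emeasure lborel ?W" by simp
    also have "ennreal ((norm c)\<^sup>2) * (emeasure lborel ?W + emeasure lborel ?W) \<le> ennreal ((norm c)\<^sup>2) * (ennreal (2 * e) + ennreal (2 * e))"
      by (intro mult_left_mono add_mono W) auto
    also have "\<dots> = ennreal (4 * e * (norm c)\<^sup>2)"
      using e by (subst ennreal_plus[symmetric]) (auto simp: ennreal_mult'[symmetric] mult_ac)
    also have "\<dots> \<le> ennreal \<eta>" using e' by (rule ennreal_leI)
    finally show "(\<integral>\<^sup>+x. ennreal ((norm (indicator A (x - t) *\<^sub>R c - indicator A x *\<^sub>R c))\<^sup>2) \<partial>lborel) \<le> ennreal \<eta>" .
  qed
qed

lemma L2_translation_continuous_limit: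
  fixes f :: "'a::euclidean_space \<Rightarrow> 'b::euclidean_space"
  assumes [measurable]: "f \<in> borel_measurable borel" and s: "\<And>n::nat. L2_translation_continuous (s n)"
    and lim: "(\<lambda>n. \<integral>\<^sup>+x. ennreal ((norm (s n x - f x))\<^sup>2) \<partial>lborel) \<longlonglongrightarrow> 0"
  shows "L2_translation_continuous f"
  unfolding L2_translation_continuous_def
proof (intro conjI allI impI assms(1))
  have [measurable]: "s n \<in> borel_measurable borel" for n
    using s by (auto simp: L2_translation_continuous_def)
  fix \<eta> :: real assume \<eta>: "\<eta> > 0"
  \<comment> \<open>The bound |a + b|^2 \<le> 2 |a|^2 + 2 |b|^2 is applied twice. The two
    approximation errors are met by both applications and get \<eta> / 16 each; the translation
    error of the approximant is met by one and gets \<eta> / 4.\<close>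
  have "eventually (\<lambda>n. (\<integral>\<^sup>+x. ennreal ((norm (s n x - f x))\<^sup>2) \<partial>lborel) < ennreal (\<eta> / 16)) sequentially"
    using \<eta> by (intro order_tendstoD[OF lim]) auto
  then obtain n where n: "(\<integral>\<^sup>+x. ennreal ((norm (s n x - f x))\<^sup>2) \<partial>lborel) \<le> ennreal (\<eta> / 16)"
    by (auto simp: eventually_sequentially intro: less_imp_le)
  have "\<eta> / 4 > 0" using \<eta> by simp
  then obtain d where d: "d > 0" "\<And>t. norm t < d \<Longrightarrow> (\<integral>\<^sup>+x. ennreal ((norm (s n (x - t) - s n x))\<^sup>2) \<partial>lborel) \<le> ennreal (\<eta> / 4)"
    using L2_translation_continuousE[OF s] by blast
  show "\<exists>\<delta>>0. \<forall>t. norm t < \<delta> \<longrightarrow> (\<integral>\<^sup>+x. ennreal ((norm (f (x - t) - f x))\<^sup>2) \<partial>lborel) \<le> ennreal \<eta>"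
  proof (intro exI[of _ d] conjI allI impI d(1))
    fix t :: 'a assume t: "norm t < d"
    let ?I = "\<lambda>g. \<integral>\<^sup>+x. ennreal ((norm (g x :: 'b))\<^sup>2) \<partial>lborel"
    have eq: "f (x - t) - f x = (s n (x - t) - s n x) + ((f (x - t) - s n (x - t)) + (s n x - f x))" for x
      by simp
    have 1: "?I (\<lambda>x. f (x - t) - s n (x - t)) = ?I (\<lambda>x. s n x - f x)"
      by (subst nn_integral_lborel_translate[of "\<lambda>x. ennreal ((norm (f x - s n x))\<^sup>2)"])
        (auto simp: norm_minus_commute)
    have "?I (\<lambda>x. (f (x - t) - s n (x - t)) + (s n x - f x)) \<le> 2 * ?I (\<lambda>x. f (x - t) - s n (x - t)) + 2 * ?I (\<lambda>x. s n x - f x)"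
      by (rule nn_integral_norm_power2_add_le) measurable
    also have "\<dots> \<le> 2 * ennreal (\<eta> / 16) + 2 * ennreal (\<eta> / 16)"
      unfolding 1 using n by (intro add_mono mult_left_mono) auto
    also have "2 * ennreal (\<eta> / 16) = ennreal (\<eta> / 8)"
      using ennreal_mult'[of 2 "\<eta> / 16"] by simp
    also have "ennreal (\<eta> / 8) + ennreal (\<eta> / 8) = ennreal (\<eta> / 4)"
      using \<eta> by (subst ennreal_plus[symmetric]) auto
    finally have 2: "?I (\<lambda>x. (f (x - t) - s n (x - t)) + (s n x - f x)) \<le> ennreal (\<eta> / 4)" .
    have "?I (\<lambda>x. f (x - t) - f x) \<le> 2 * ?I (\<lambda>x. s n (x - t) - s n x) + 2 * ?I (\<lambda>x. (f (x - t) - s n (x - t)) + (s n x - f x))"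
      unfolding eq by (rule nn_integral_norm_power2_add_le) measurable
    also have "\<dots> \<le> 2 * ennreal (\<eta> / 4) + 2 * ennreal (\<eta> / 4)"
      using d t 2 by (intro add_mono mult_left_mono) auto
    also have "2 * ennreal (\<eta> / 4) = ennreal (\<eta> / 2)"
      using ennreal_mult'[of 2 "\<eta> / 4"] by simp
    also have "ennreal (\<eta> / 2) + ennreal (\<eta> / 2) = ennreal \<eta>"
      using \<eta> by (subst ennreal_plus[symmetric]) auto
    finally show "?I (\<lambda>x. f (x - t) - f x) \<le> ennreal \<eta>" .
  qed
qed

text \<open>Simple functions bounded by \<open>2 * norm (f x)\<close> vanish wherever
  \<open>f\<close> does, so their nonzero level sets are bounded. The squared distances to
  \<open>f\<close> are dominated by 9 |f|^2 and tend to 0 pointwise.\<close>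

lemma L2_translation_continuous_bounded_support:
  fixes f :: "'a::euclidean_space \<Rightarrow> 'b::euclidean_space"
  assumes f: "square_integrable f" and \<Omega>: "bounded \<Omega>" "\<And>x. x \<notin> \<Omega> \<Longrightarrow> f x = 0"
  shows "L2_translation_continuous f"
proof -
  have [measurable]: "f \<in> borel_measurable borel" using f by (simp add: square_integrable_def)
  then have fm: "f \<in> borel_measurable lborel" by simp
  obtain s where s': "\<forall>i. simple_function lborel (s i)" "\<forall>x\<in>space lborel. (\<lambda>i. s i x) \<longlonglongrightarrow> f x"
    "\<forall>i. \<forall>x\<in>space lborel. dist (s i x) 0 \<le> 2 * dist (f x) 0"
    using borel_measurable_implies_sequence_metric[OF fm, of 0] by blast
  then have s: "\<And>i. simple_function lborel (s i)" "\<And>x. (\<lambda>i. s i x) \<longlonglongrightarrow> f x"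
    "\<And>i x. norm (s i x) \<le> 2 * norm (f x)"
    by simp_all
  have [measurable]: "s i \<in> borel_measurable borel" for i
    using borel_measurable_simple_function[OF s(1)] by simp
  show ?thesis
  proof (rule L2_translation_continuous_limit)
    show "f \<in> borel_measurable borel" by measurable
    show "L2_translation_continuous (s n)" for n
    proof -
      have fin: "finite (range (s n) - {0})" using s(1)[of n] by (simp add: simple_function_def)
      have "L2_translation_continuous (\<lambda>x. indicator (s n -` {y}) x *\<^sub>R y)" if "y \<in> range (s n) - {0}" for y
      proof (rule L2_translation_continuous_indicator)
        have "{x \<in> space borel. s n x = y} \<in> sets borel" by measurable
        then show "s n -` {y} \<in> sets borel" by (simp add: vimage_def)
        have "s n -` {y} \<subseteq> \<Omega>"
        proof
          fix x assume "x \<in> s n -` {y}"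
          then have "norm (s n x) > 0" using that by auto
          then show "x \<in> \<Omega>" using s(3)[of n x] \<Omega>(2)[of x] by force
        qed
        then show "bounded (s n -` {y})" using \<Omega>(1) bounded_subset by blast
      qed
      then have "L2_translation_continuous (\<lambda>x. \<Sum>y\<in>range (s n) - {0}. indicator (s n -` {y}) x *\<^sub>R y)"
        by (intro L2_translation_continuous_sum fin)
      moreover have "(\<Sum>y\<in>range (s n) - {0}. indicator (s n -` {y}) x *\<^sub>R y) = s n x" for x
      proof -
        have "(\<Sum>y\<in>range (s n) - {0}. indicator (s n -` {y}) x *\<^sub>R y) = (\<Sum>y\<in>range (s n) - {0}. if y = s n x then y else 0)"
          by (intro sum.cong) auto
        also have "\<dots> = s n x" using fin by (simp add: sum.delta)
        finally show ?thesis .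
      qed
      ultimately show ?thesis by simp
    qed
    have "(\<lambda>n. \<integral>\<^sup>+x. ennreal ((norm (s n x - f x))\<^sup>2) \<partial>lborel) \<longlonglongrightarrow> (\<integral>\<^sup>+(x::'a). 0 \<partial>lborel)"
    proof (rule nn_integral_dominated_convergence[where w="\<lambda>x. ennreal (9 * (norm (f x))\<^sup>2)"])
      show "AE x in lborel. ennreal ((norm (s n x - f x))\<^sup>2) \<le> ennreal (9 * (norm (f x))\<^sup>2)" for n
      proof (rule AE_I2, rule ennreal_leI)
        fix x
        have "norm (s n x - f x) \<le> 3 * norm (f x)"
          using norm_triangle_ineq4[of "s n x" "f x"] s(3)[of n x] by linarith
        then have "(norm (s n x - f x))\<^sup>2 \<le> (3 * norm (f x))\<^sup>2" by (intro power_mono) auto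
        then show "(norm (s n x - f x))\<^sup>2 \<le> 9 * (norm (f x))\<^sup>2" by (simp add: power_mult_distrib)
      qed
      have "integrable lborel (\<lambda>x. 9 * (norm (f x))\<^sup>2)" using f by (auto simp: square_integrable_def)
      then show "(\<integral>\<^sup>+x. ennreal (9 * (norm (f x))\<^sup>2) \<partial>lborel) < \<infinity>"
        by (subst nn_integral_eq_integral) auto
      show "AE x in lborel. (\<lambda>n. ennreal ((norm (s n x - f x))\<^sup>2)) \<longlonglongrightarrow> 0"
      proof (rule AE_I2)
        fix x
        have "(\<lambda>n. (norm (s n x - f x))\<^sup>2) \<longlonglongrightarrow> (norm (f x - f x))\<^sup>2"
          by (intro tendsto_intros s(2))
        then have "(\<lambda>n. ennreal ((norm (s n x - f x))\<^sup>2)) \<longlonglongrightarrow> ennreal ((norm (f x - f x))\<^sup>2)"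
          by (rule tendsto_ennrealI)
        then show "(\<lambda>n. ennreal ((norm (s n x - f x))\<^sup>2)) \<longlonglongrightarrow> 0" by simp
      qed
    qed measurable
    then show "(\<lambda>n. \<integral>\<^sup>+x. ennreal ((norm (s n x - f x))\<^sup>2) \<partial>lborel) \<longlonglongrightarrow> 0" by simp
  qed
qed

text \<open>Jensen's inequality for the square, from the nonnegative variance of
  \<open>norm (g z)\<close> under the probability density \<open>\<rho>\<close>. With values in the
  extended reals, a non-integrable right-hand side is harmless.\<close>

lemma norm_integral_power2_le:
  fixes g :: "'x \<Rightarrow> 'b::{banach, second_countable_topology}"
  assumes \<rho>: "\<And>z. 0 \<le> \<rho> z" "integrable M \<rho>" "(LINT z|M. \<rho> z) = 1"
    and g[measurable]: "g \<in> borel_measurable M" and int: "integrable M (\<lambda>z. \<rho> z *\<^sub>R g z)"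
  shows "ennreal ((norm (LINT z|M. \<rho> z *\<^sub>R g z))\<^sup>2) \<le> (\<integral>\<^sup>+z. ennreal (\<rho> z * (norm (g z))\<^sup>2) \<partial>M)"
proof (cases "integrable M (\<lambda>z. \<rho> z * (norm (g z))\<^sup>2)")
  case False
  have [measurable]: "\<rho> \<in> borel_measurable M" using \<rho>(2) by simp
  have "(\<lambda>z. \<rho> z * (norm (g z))\<^sup>2) \<in> borel_measurable M" by measurable
  then have "(\<integral>\<^sup>+z. ennreal (\<rho> z * (norm (g z))\<^sup>2) \<partial>M) = \<infinity>"
    using False \<rho>(1) by (subst (asm) integrable_iff_bounded) (auto simp: less_top[symmetric])
  then show ?thesis by simp
next
  case True
  define m where "m = (LINT z|M. \<rho> z * norm (g z))"
  have int': "integrable M (\<lambda>z. \<rho> z * norm (g z))"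
    using integrable_norm[OF int] \<rho>(1) by simp
  have "norm (LINT z|M. \<rho> z *\<^sub>R g z) \<le> m"
    unfolding m_def using integral_norm_bound[of M "\<lambda>z. \<rho> z *\<^sub>R g z"] \<rho>(1) by simp
  then have "(norm (LINT z|M. \<rho> z *\<^sub>R g z))\<^sup>2 \<le> m\<^sup>2" by (intro power_mono) auto
  also have "m\<^sup>2 \<le> (LINT z|M. \<rho> z * (norm (g z))\<^sup>2)"
  proof -
    have "0 \<le> (LINT z|M. \<rho> z * (norm (g z) - m)\<^sup>2)"
      by (intro integral_nonneg_AE) (auto simp: \<rho>(1))
    also have "\<dots> = (LINT z|M. \<rho> z * (norm (g z))\<^sup>2 - 2 * m * (\<rho> z * norm (g z)) + m\<^sup>2 * \<rho> z)"
      by (intro Bochner_Integration.integral_cong refl) (simp add: power2_diff algebra_simps)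
    also have "\<dots> = (LINT z|M. \<rho> z * (norm (g z))\<^sup>2) - 2 * m * m + m\<^sup>2"
      using True int' \<rho> by (simp add: m_def)
    finally show ?thesis by (simp add: power2_eq_square)
  qed
  finally show ?thesis
    using True \<rho>(1) by (subst nn_integral_eq_integral) (auto intro: ennreal_leI)
qed

text \<open>The error at \<open>x\<close> is the \<open>\<rho>\<close>-average of the differences
  \<open>f (x - z) - f x\<close>. Jensen's inequality moves the square inside, and exchanging the
  integrals leaves the translation error, which is at most \<eta> for every \<open>z\<close> in the
  support.\<close>

lemma mollification_L2_error:
  fixes f :: "'a::euclidean_space \<Rightarrow> 'b::euclidean_space"
  assumes \<rho>: "\<And>z. 0 \<le> \<rho> z" "integrable lborel \<rho>" "(LINT z|lborel. \<rho> z) = 1" "\<And>z. \<rho> z \<le> C"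
    and supp: "\<And>z. e \<le> norm z \<Longrightarrow> \<rho> z = 0"
    and f: "integrable lborel f"
    and trans: "\<And>t. norm t < e \<Longrightarrow> (\<integral>\<^sup>+x. ennreal ((norm (f (x - t) - f x))\<^sup>2) \<partial>lborel) \<le> ennreal \<eta>"
  shows "(\<integral>\<^sup>+x. ennreal ((norm ((LINT y|lborel. \<rho> (x - y) *\<^sub>R f y) - f x))\<^sup>2) \<partial>lborel) \<le> ennreal \<eta>"
proof -
  have [measurable]: "\<rho> \<in> borel_measurable borel" "f \<in> borel_measurable borel" using \<rho>(2) f by auto
  have conv: "(LINT y|lborel. \<rho> (x - y) *\<^sub>R f y) - f x = (LINT z|lborel. \<rho> z *\<^sub>R (f (x - z) - f x))"
    and int: "integrable lborel (\<lambda>z. \<rho> z *\<^sub>R (f (x - z) - f x))" for x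
  proof -
    have fx: "integrable lborel (\<lambda>z. f (x - z))" using f by (simp add: integrable_lborel_reflect_iff)
    have i1: "integrable lborel (\<lambda>z. \<rho> z *\<^sub>R f (x - z))"
    proof (rule Bochner_Integration.integrable_bound)
      show "integrable lborel (\<lambda>z. C *\<^sub>R f (x - z))" using fx by simp
      show "AE z in lborel. norm (\<rho> z *\<^sub>R f (x - z)) \<le> norm (C *\<^sub>R f (x - z))"
        using \<rho>(1,4) order_trans[OF \<rho>(1) \<rho>(4)] by (auto intro!: mult_right_mono simp: abs_of_nonneg)
    qed measurable
    have i2: "integrable lborel (\<lambda>z. \<rho> z *\<^sub>R f x)" using \<rho>(2) by simp
    show "integrable lborel (\<lambda>z. \<rho> z *\<^sub>R (f (x - z) - f x))"
      using Bochner_Integration.integrable_diff[OF i1 i2] by (simp add: scaleR_diff_right)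
    have "(LINT y|lborel. \<rho> (x - y) *\<^sub>R f y) = (LINT z|lborel. \<rho> z *\<^sub>R f (x - z))"
      using integral_lborel_reflect[of "\<lambda>z. \<rho> z *\<^sub>R f (x - z)" x] by simp
    then show "(LINT y|lborel. \<rho> (x - y) *\<^sub>R f y) - f x = (LINT z|lborel. \<rho> z *\<^sub>R (f (x - z) - f x))"
      using i1 i2 \<rho>(2,3) by (simp add: scaleR_diff_right)
  qed
  have "(\<integral>\<^sup>+x. ennreal ((norm ((LINT y|lborel. \<rho> (x - y) *\<^sub>R f y) - f x))\<^sup>2) \<partial>lborel) \<le>
      (\<integral>\<^sup>+x. (\<integral>\<^sup>+z. ennreal (\<rho> z * (norm (f (x - z) - f x))\<^sup>2) \<partial>lborel) \<partial>lborel)"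
    unfolding conv using \<rho> int by (intro nn_integral_mono norm_integral_power2_le) auto
  also have "\<dots> = (\<integral>\<^sup>+z. (\<integral>\<^sup>+x. ennreal (\<rho> z * (norm (f (x - z) - f x))\<^sup>2) \<partial>lborel) \<partial>lborel)"
    by (rule lborel_pair.Fubini') measurable
  also have "\<dots> \<le> (\<integral>\<^sup>+z. ennreal (\<rho> z) * ennreal \<eta> \<partial>lborel)"
  proof (rule nn_integral_mono)
    fix z
    have "(\<integral>\<^sup>+x. ennreal (\<rho> z * (norm (f (x - z) - f x))\<^sup>2) \<partial>lborel) = ennreal (\<rho> z) * (\<integral>\<^sup>+x. ennreal ((norm (f (x - z) - f x))\<^sup>2) \<partial>lborel)"
      using \<rho>(1) by (simp add: ennreal_mult' nn_integral_cmult)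
    also have "\<dots> \<le> ennreal (\<rho> z) * ennreal \<eta>"
      using supp[of z] trans[of z] by (cases "norm z < e") (auto intro: mult_left_mono)
    finally show "(\<integral>\<^sup>+x. ennreal (\<rho> z * (norm (f (x - z) - f x))\<^sup>2) \<partial>lborel) \<le> ennreal (\<rho> z) * ennreal \<eta>" .
  qed
  also have "\<dots> = (\<integral>\<^sup>+z. ennreal (\<rho> z) \<partial>lborel) * ennreal \<eta>"
    by (rule nn_integral_multc) measurable
  also have "(\<integral>\<^sup>+z. ennreal (\<rho> z) \<partial>lborel) = 1"
    using \<rho> by (subst nn_integral_eq_integral) auto
  finally show ?thesis by simp
qed

text \<open>Both functions are mollified with the same kernel. The identity \<open>ident\<close>,
  applied to the kernel centred at \<open>x\<close>, says that the gradient of the mollified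
  \<open>u\<close> is the mollified \<open>s\<close>. It also holds for kernels reaching across the
  boundary of \<open>\<Omega>\<close>, so the approximation is global.\<close>

lemma smooth_approximation:
  fixes u :: "'a::euclidean_space \<Rightarrow> real" and s :: "'a \<Rightarrow> 'a"
  assumes \<Omega>: "bounded \<Omega>" and u: "square_integrable u" "\<And>x. x \<notin> \<Omega> \<Longrightarrow> u x = 0"
    and s: "square_integrable s" "\<And>x. x \<notin> \<Omega> \<Longrightarrow> s x = 0"
    and ident: "\<And>r d h. (\<And>x. ((\<lambda>t. r (x + t *\<^sub>R h)) has_real_derivative d x) (at 0)) \<Longrightarrow>
      continuous_on UNIV r \<Longrightarrow> continuous_on UNIV d \<Longrightarrow>
      (LINT x|lborel. r x * (s x \<bullet> h)) = - (LINT x|lborel. d x * u x)"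
    and \<eta>: "\<eta> > 0"
  shows "\<exists>v g. continuous_on UNIV v \<and> continuous_on UNIV g \<and>
      (\<forall>x h. ((\<lambda>t. v (x + t *\<^sub>R h)) has_real_derivative g x \<bullet> h) (at 0)) \<and>
      (\<integral>\<^sup>+x. ennreal ((norm (v x - u x))\<^sup>2) \<partial>lborel) \<le> ennreal \<eta> \<and>
      (\<integral>\<^sup>+x. ennreal ((norm (g x - s x))\<^sup>2) \<partial>lborel) \<le> ennreal \<eta>"
proof -
  have int: "integrable lborel f" if f: "square_integrable f" "\<And>x. x \<notin> \<Omega> \<Longrightarrow> f x = 0" for f :: "'a \<Rightarrow> 'c::euclidean_space"
  proof -
    obtain R where R: "\<And>x. x \<in> \<Omega> \<Longrightarrow> norm x \<le> R" using \<Omega> by (auto simp: bounded_iff)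
    have "integrable lborel (\<lambda>x. indicator (cball 0 R) x *\<^sub>R f x)"
      using emeasure_bounded_finite[of "cball (0::'a) R"]
      by (intro square_integrable_imp_integrable_on_finite f) auto
    moreover have "(\<lambda>x. indicator (cball 0 R) x *\<^sub>R f x) = f"
      using R f(2) by (fastforce simp: indicator_def fun_eq_iff)
    ultimately show ?thesis by simp
  qed
  note iu = int[OF u] and ints = int[OF s]
  have [measurable]: "u \<in> borel_measurable borel" "s \<in> borel_measurable borel" using iu ints by auto
  obtain d1 where d1: "d1 > 0" "\<And>t. norm t < d1 \<Longrightarrow> (\<integral>\<^sup>+x. ennreal ((norm (u (x - t) - u x))\<^sup>2) \<partial>lborel) \<le> ennreal \<eta>"
    using L2_translation_continuousE[OF L2_translation_continuous_bounded_support[OF u(1) \<Omega> u(2)] \<eta>] by blast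
  obtain d2 where d2: "d2 > 0" "\<And>t. norm t < d2 \<Longrightarrow> (\<integral>\<^sup>+x. ennreal ((norm (s (x - t) - s x))\<^sup>2) \<partial>lborel) \<le> ennreal \<eta>"
    using L2_translation_continuousE[OF L2_translation_continuous_bounded_support[OF s(1) \<Omega> s(2)] \<eta>] by blast
  define e where "e = min d1 d2"
  have e: "e > 0" using d1 d2 by (simp add: e_def)
  obtain \<rho> :: "'a \<Rightarrow> real" and D :: "'a \<Rightarrow> 'a" and C where
    \<rho>: "\<And>z. 0 \<le> \<rho> z" "continuous_on UNIV \<rho>" "continuous_on UNIV D"
      "\<And>z h. ((\<lambda>t. \<rho> (z + t *\<^sub>R h)) has_real_derivative D z \<bullet> h) (at 0)"
      "\<And>z. e \<le> norm z \<Longrightarrow> \<rho> z = 0" "integrable lborel \<rho>" "(LINT z|lborel. \<rho> z) = 1"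
      "\<And>z. \<rho> z \<le> C" "\<And>z. norm (D z) \<le> C"
    using mollifier_exists[OF e] by blast
  have [measurable]: "\<rho> \<in> borel_measurable borel" "D \<in> borel_measurable borel"
    using \<rho>(2,3) by (auto intro: borel_measurable_continuous_onI)
  have c_shift: "continuous_on UNIV (\<lambda>x. \<rho> (x - y))" "continuous_on UNIV (\<lambda>y. \<rho> (x - y))" "continuous_on UNIV (\<lambda>y. D (x - y))" for x y
    by (intro continuous_on_compose2[OF \<rho>(2)] continuous_on_compose2[OF \<rho>(3)] continuous_intros subset_UNIV)+
  have conv_int: "integrable lborel (\<lambda>y. \<rho> (x - y) *\<^sub>R f y)" if f: "integrable lborel f" for f :: "'a \<Rightarrow> 'c::euclidean_space" and x
  proof (rule Bochner_Integration.integrable_bound)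
    have [measurable]: "f \<in> borel_measurable borel" using f by auto
    show "integrable lborel (\<lambda>y. C *\<^sub>R f y)" using f by simp
    show "(\<lambda>y. \<rho> (x - y) *\<^sub>R f y) \<in> borel_measurable lborel" by measurable
    show "AE y in lborel. norm (\<rho> (x - y) *\<^sub>R f y) \<le> norm (C *\<^sub>R f y)"
      using \<rho>(1,8) order_trans[OF \<rho>(1) \<rho>(8)] by (auto intro!: mult_right_mono simp: abs_of_nonneg)
  qed
  have conv_cont: "continuous_on UNIV (\<lambda>x. LINT y|lborel. \<rho> (x - y) *\<^sub>R f y)" if f: "integrable lborel f" for f :: "'a \<Rightarrow> 'c::euclidean_space"
  proof (rule continuous_on_integral[where w="\<lambda>y. norm (C *\<^sub>R f y)"])
    have [measurable]: "f \<in> borel_measurable borel" using f by auto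
    show "continuous_on UNIV (\<lambda>x. \<rho> (x - y) *\<^sub>R f y)" for y by (intro continuous_intros c_shift)
    show "(\<lambda>y. \<rho> (x - y) *\<^sub>R f y) \<in> borel_measurable lborel" for x by measurable
    show "norm (\<rho> (x - y) *\<^sub>R f y) \<le> norm (C *\<^sub>R f y)" for x y
      using \<rho>(1)[of "x - y"] \<rho>(8)[of "x - y"] by (auto intro!: mult_right_mono simp: abs_of_nonneg)
    show "integrable lborel (\<lambda>y. norm (C *\<^sub>R f y))" using f by (intro integrable_norm) simp
  qed
  show ?thesis
  proof (rule exI[of _ "\<lambda>x. LINT y|lborel. \<rho> (x - y) *\<^sub>R u y"], rule exI[of _ "\<lambda>x. LINT y|lborel. \<rho> (x - y) *\<^sub>R s y"],
      intro conjI allI)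
    show "continuous_on UNIV (\<lambda>x. LINT y|lborel. \<rho> (x - y) *\<^sub>R u y)" by (rule conv_cont[OF iu])
    show "continuous_on UNIV (\<lambda>x. LINT y|lborel. \<rho> (x - y) *\<^sub>R s y)" by (rule conv_cont[OF ints])
    show "(\<integral>\<^sup>+x. ennreal ((norm ((LINT y|lborel. \<rho> (x - y) *\<^sub>R u y) - u x))\<^sup>2) \<partial>lborel) \<le> ennreal \<eta>"
      using d1 by (intro mollification_L2_error[OF \<rho>(1,6,7,8,5) iu]) (auto simp: e_def)
    show "(\<integral>\<^sup>+x. ennreal ((norm ((LINT y|lborel. \<rho> (x - y) *\<^sub>R s y) - s x))\<^sup>2) \<partial>lborel) \<le> ennreal \<eta>"
      using d2 by (intro mollification_L2_error[OF \<rho>(1,6,7,8,5) ints]) (auto simp: e_def)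
    fix x h :: 'a
    have "((\<lambda>t. LINT y|lborel. \<rho> (x + t *\<^sub>R h - y) *\<^sub>R u y) has_real_derivative
        (LINT y|lborel. (D (x + 0 *\<^sub>R h - y) \<bullet> h) * u y)) (at 0)"
    proof (rule has_real_derivative_integral[where r=1 and w="\<lambda>y. (C * norm h) * \<bar>u y\<bar>"])
      show "((\<lambda>t. \<rho> (x + t *\<^sub>R h - y) *\<^sub>R u y) has_real_derivative (D (x + t *\<^sub>R h - y) \<bullet> h) * u y) (at t)" for t y
      proof -
        have "((\<lambda>t. \<rho> ((x - y) + t *\<^sub>R h)) has_real_derivative D ((x - y) + t *\<^sub>R h) \<bullet> h) (at t)"
          using directional_derivative_shift[of \<rho> h "\<lambda>z. D z \<bullet> h"] \<rho>(4) by blast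
        then have "((\<lambda>t. \<rho> ((x - y) + t *\<^sub>R h) * u y) has_real_derivative (D ((x - y) + t *\<^sub>R h) \<bullet> h) * u y) (at t)"
          by (rule DERIV_cmult_right)
        moreover have "(x - y) + t *\<^sub>R h = x + t *\<^sub>R h - y" for t by simp
        ultimately show ?thesis by simp
      qed
      show "integrable lborel (\<lambda>y. \<rho> (x + t *\<^sub>R h - y) *\<^sub>R u y)" for t by (rule conv_int[OF iu])
      show "(\<lambda>y. (D (x + 0 *\<^sub>R h - y) \<bullet> h) * u y) \<in> borel_measurable lborel" by measurable
      show "\<bar>(D (x + t *\<^sub>R h - y) \<bullet> h) * u y\<bar> \<le> (C * norm h) * \<bar>u y\<bar>" for t y
      proof -
        have "\<bar>D (x + t *\<^sub>R h - y) \<bullet> h\<bar> \<le> norm (D (x + t *\<^sub>R h - y)) * norm h" by (rule Cauchy_Schwarz_ineq2)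
        also have "\<dots> \<le> C * norm h" by (intro mult_right_mono \<rho>(9)) auto
        finally show ?thesis by (simp add: abs_mult mult_right_mono)
      qed
      show "integrable lborel (\<lambda>y. (C * norm h) * \<bar>u y\<bar>)" using iu by simp
    qed simp
    moreover have "(LINT y|lborel. \<rho> (x - y) *\<^sub>R s y) \<bullet> h = (LINT y|lborel. (D (x - y) \<bullet> h) * u y)"
    proof -
      have "(LINT y|lborel. \<rho> (x - y) *\<^sub>R s y) \<bullet> h = (LINT y|lborel. \<rho> (x - y) * (s y \<bullet> h))"
        by (subst integral_inner_left[symmetric]) (auto intro: conv_int[OF ints])
      also have "\<dots> = - (LINT y|lborel. (- (D (x - y) \<bullet> h)) * u y)"
      \<comment> \<open>Reflecting the kernel changes the sign of its derivative, which cancels the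
        minus sign of the identity.\<close>
      proof (rule ident)
        show "((\<lambda>t. \<rho> (x - (y + t *\<^sub>R h))) has_real_derivative - (D (x - y) \<bullet> h)) (at 0)" for y
          using \<rho>(4)[of "x - y" "- h"] by (simp add: algebra_simps)
        show "continuous_on UNIV (\<lambda>y. \<rho> (x - y))" by (rule c_shift)
        show "continuous_on UNIV (\<lambda>y. - (D (x - y) \<bullet> h))" by (intro continuous_intros c_shift)
      qed
      finally show ?thesis by simp
    qed
    ultimately show "((\<lambda>t. LINT y|lborel. \<rho> (x + t *\<^sub>R h - y) *\<^sub>R u y) has_real_derivative (LINT y|lborel. \<rho> (x - y) *\<^sub>R s y) \<bullet> h) (at 0)"
      by simp
  qed
qed

section \<open>The Brunn--Minkowski inequality for midpoints\<close>

lemma fmeasurable_bounded: "A \<in> sets borel \<Longrightarrow> bounded A \<Longrightarrow> A \<in> fmeasurable lborel"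
  using emeasure_bounded_finite by (auto simp: fmeasurable_def)

lemma AE_lborel_not_in_negligible:
  assumes "S \<in> sets borel" "negligible S"
  shows "AE x in lborel. x \<notin> S"
  using assms by (intro AE_not_in) (simp add: negligible_iff_null_sets null_sets_completion_iff)

lemma AE_not_in_hyperplane:
  assumes "e \<noteq> (0::'a::euclidean_space)"
  shows "AE x in lborel. x \<bullet> e \<noteq> c"
proof -
  have "AE x in lborel. x \<notin> {x. e \<bullet> x = c}"
    using assms by (intro AE_lborel_not_in_negligible negligible_hyperplane) auto
  then show ?thesis by (simp add: inner_commute)
qed

text \<open>Away from the null set \<open>w p x = 0\<close> the indicators are eventually constant
  along any convergent sequence of parameters, and \<open>norm (f x)\<close> dominates. This serves
  both the parallel cuts of boxes and the rotating hyperplanes.\<close>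

lemma continuous_on_integral_moving_halfspace:
  fixes w :: "'p::metric_space \<Rightarrow> 'a::euclidean_space \<Rightarrow> real" and f :: "'a \<Rightarrow> real"
  assumes f: "integrable lborel f"
    and w: "\<And>x. continuous_on UNIV (\<lambda>p. w p x)" "\<And>p. w p \<in> borel_measurable borel"
    and null: "\<And>p. AE x in lborel. w p x \<noteq> 0"
  shows "continuous_on UNIV (\<lambda>p. LINT x|lborel. indicator {x. w p x > 0} x * f x)"
  unfolding continuous_on_sequentially
proof (intro allI ballI impI, elim conjE)
  fix X :: "nat \<Rightarrow> 'p" and p assume X: "X \<longlonglongrightarrow> p"
  have [measurable]: "f \<in> borel_measurable borel" "w q \<in> borel_measurable borel" for q using f w(2) by auto
  show "((\<lambda>p. LINT x|lborel. indicator {x. w p x > 0} x * f x) \<circ> X) \<longlonglongrightarrow> (LINT x|lborel. indicator {x. w p x > 0} x * f x)"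
    unfolding o_def
  proof (rule integral_dominated_convergence[where w="\<lambda>x. norm (f x)"])
    show "AE x in lborel. (\<lambda>n. indicator {x. w (X n) x > 0} x * f x) \<longlonglongrightarrow> indicator {x. w p x > 0} x * f x"
      using null[of p]
    proof eventually_elim
      case (elim x)
      have lim: "(\<lambda>n. w (X n) x) \<longlonglongrightarrow> w p x"
        using w(1)[of x] X by (auto simp: continuous_on_sequentially o_def)
      have "eventually (\<lambda>n. (w (X n) x > 0) = (w p x > 0)) sequentially"
      proof (cases "w p x > 0")
        case True
        then show ?thesis using order_tendstoD(1)[OF lim True] by (auto elim: eventually_mono)
      next
        case False
        then have "w p x < 0" using elim by simp
        from order_tendstoD(2)[OF lim this] False show ?thesis by (auto elim: eventually_mono)
      qed
      then have "eventually (\<lambda>n. indicator {x. w (X n) x > 0} x * f x = indicator {x. w p x > 0} x * f x) sequentially"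
        by eventually_elim (simp add: indicator_def)
      then show ?case by (rule tendsto_eventually)
    qed
    show "AE x in lborel. norm (indicator {x. w (X n) x > 0} x * f x) \<le> norm (f x)" for n
      by (auto simp: indicator_def)
  qed (use f in auto)
qed

section \<open>Midpoint sets and the case of two boxes\<close>

definition midpoints :: "'a::real_vector set \<Rightarrow> 'a set \<Rightarrow> 'a set" where
  "midpoints A B = {(1/2) *\<^sub>R (x + y) | x y. x \<in> A \<and> y \<in> B}"

lemma midpoints_commute:
  fixes A B :: "'a::real_vector set"
  shows "midpoints A B = midpoints B A"
proof -
  have "z \<in> midpoints B A" if z: "z \<in> midpoints A B" for z and A B :: "'a set"
  proof -
    obtain x y where "z = (1/2) *\<^sub>R (x + y)" "x \<in> A" "y \<in> B" using z by (auto simp: midpoints_def)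
    moreover have "x + y = y + x" by (rule add.commute)
    ultimately show ?thesis unfolding midpoints_def by auto
  qed
  then show ?thesis by blast
qed

lemma midpoints_mono: "A \<subseteq> A' \<Longrightarrow> B \<subseteq> B' \<Longrightarrow> midpoints A B \<subseteq> midpoints A' B'"
  unfolding midpoints_def by blast

lemma open_midpoints:
  fixes A :: "'a::real_normed_vector set"
  assumes "open A" shows "open (midpoints A B)"
proof -
  have eq: "(1/2) *\<^sub>R (x + y) = (1/2) *\<^sub>R y + (1/2) *\<^sub>R x" for x y :: 'a
    by (simp add: scaleR_add_right add.commute)
  have "midpoints A B = (\<Union>y\<in>B. (\<lambda>x. (1/2) *\<^sub>R y + (1/2) *\<^sub>R x) ` A)"
    unfolding midpoints_def eq by blast
  then show ?thesis using assms by (auto intro!: open_affinity)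
qed

lemma bounded_midpoints:
  fixes A :: "'a::real_normed_vector set"
  assumes "bounded A" "bounded B" shows "bounded (midpoints A B)"
proof -
  obtain R S where RS: "\<And>x. x \<in> A \<Longrightarrow> norm x \<le> R" "\<And>x. x \<in> B \<Longrightarrow> norm x \<le> S"
    using assms by (auto simp: bounded_iff)
  have "norm ((1/2) *\<^sub>R (x + y)) \<le> R + S" if "x \<in> A" "y \<in> B" for x y
    using RS(1)[OF that(1)] RS(2)[OF that(2)] norm_triangle_ineq[of x y] norm_ge_zero[of x] norm_ge_zero[of y]
    unfolding norm_scaleR real_norm_def by linarith
  then show ?thesis unfolding bounded_iff midpoints_def by blast
qed

text \<open>The midpoints contain the box whose sides are the means of the given sides; the rest is
  the arithmetic-geometric mean inequality in each coordinate.\<close>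

lemma brunn_minkowski_box:
  fixes a b c d :: "'a::euclidean_space"
  assumes ne: "box a b \<noteq> {}" "box c d \<noteq> {}"
  shows "sqrt (measure lborel (box a b) * measure lborel (box c d)) \<le> measure lborel (midpoints (box a b) (box c d))"
proof -
  have ab: "a \<bullet> i < b \<bullet> i" and cd: "c \<bullet> i < d \<bullet> i" if "i \<in> Basis" for i
    using ne that by (auto simp: box_ne_empty)
  define m where "m = (1/2) *\<^sub>R (a + c)"
  define n where "n = (1/2) *\<^sub>R (b + d)"
  have sub: "box m n \<subseteq> midpoints (box a b) (box c d)"
  proof
    fix z assume z: "z \<in> box m n"
    \<comment> \<open>The relative position of \<open>z\<close> in each coordinate; the points at
      the same relative position in the two given boxes have \<open>z\<close> as midpoint.\<close>
    define \<theta> where "\<theta> i = (z \<bullet> i - m \<bullet> i) / (n \<bullet> i - m \<bullet> i)" for i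
    have mn: "m \<bullet> i < n \<bullet> i" if "i \<in> Basis" for i
      using ab[OF that] cd[OF that] by (simp add: m_def n_def inner_add_left)
    have \<theta>: "0 < \<theta> i" "\<theta> i < 1" if "i \<in> Basis" for i
      using z mn[OF that] that by (auto simp: \<theta>_def mem_box)
    define x where "x = (\<Sum>i\<in>Basis. (a \<bullet> i + \<theta> i * (b \<bullet> i - a \<bullet> i)) *\<^sub>R i)"
    define y where "y = (\<Sum>i\<in>Basis. (c \<bullet> i + \<theta> i * (d \<bullet> i - c \<bullet> i)) *\<^sub>R i)"
    have between: "s < s + t * (r - s)" "s + t * (r - s) < r" if "s < r" "0 < t" "t < 1" for s r t :: real
    proof -
      show "s < s + t * (r - s)" using that by simp
      have "t * (r - s) < 1 * (r - s)" using that by (intro mult_strict_right_mono) auto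
      then show "s + t * (r - s) < r" by simp
    qed
    have "x \<in> box a b" "y \<in> box c d"
      using between[OF ab \<theta>] between[OF cd \<theta>] by (auto simp: mem_box x_def y_def)
    moreover have "z = (1/2) *\<^sub>R (x + y)"
    proof (rule euclidean_eqI)
      fix i :: 'a assume i: "i \<in> Basis"
      have "((1/2) *\<^sub>R (x + y)) \<bullet> i = m \<bullet> i + \<theta> i * (n \<bullet> i - m \<bullet> i)"
      proof -
        have "x \<bullet> i = a \<bullet> i + \<theta> i * (b \<bullet> i - a \<bullet> i)" "y \<bullet> i = c \<bullet> i + \<theta> i * (d \<bullet> i - c \<bullet> i)"
          using i by (simp_all add: x_def y_def)
        then show ?thesis by (simp add: m_def n_def inner_add_left) (simp add: field_simps)
      qed
      also have "\<dots> = z \<bullet> i" using mn[OF i] by (simp add: \<theta>_def)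
      finally show "z \<bullet> i = ((1/2) *\<^sub>R (x + y)) \<bullet> i" by simp
    qed
    ultimately show "z \<in> midpoints (box a b) (box c d)" unfolding midpoints_def by blast
  qed
  have "measure lborel (box a b) * measure lborel (box c d) = (\<Prod>i\<in>Basis. ((b - a) \<bullet> i) * ((d - c) \<bullet> i))"
    using ab cd by (auto simp: measure_lborel_box_eq prod.distrib less_imp_le)
  also have "\<dots> \<le> (\<Prod>i\<in>Basis. ((n - m) \<bullet> i)\<^sup>2)"
  proof (rule prod_mono, intro conjI)
    fix i :: 'a assume i: "i \<in> Basis"
    show "0 \<le> ((b - a) \<bullet> i) * ((d - c) \<bullet> i)"
      using ab[OF i] cd[OF i] by (intro mult_nonneg_nonneg) (auto simp: inner_diff_left)
    have "p * q \<le> ((p + q) / 2)\<^sup>2" for p q :: real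
      using zero_le_power2[of "p - q"] by (simp add: power2_eq_square field_simps)
    moreover have "(n - m) \<bullet> i = ((b - a) \<bullet> i + (d - c) \<bullet> i) / 2"
      by (simp add: n_def m_def inner_diff_left inner_add_left field_simps)
    ultimately show "((b - a) \<bullet> i) * ((d - c) \<bullet> i) \<le> ((n - m) \<bullet> i)\<^sup>2" by metis
  qed
  also have "\<dots> = (measure lborel (box m n))\<^sup>2"
    using ab cd by (auto simp: measure_lborel_box_eq prod_power_distrib m_def n_def inner_add_left less_imp_le add_mono)
  finally have "sqrt (measure lborel (box a b) * measure lborel (box c d)) \<le> measure lborel (box m n)"
    by (simp add: real_le_lsqrt)
  also have "\<dots> \<le> measure lborel (midpoints (box a b) (box c d))"
    by (intro measure_mono_fmeasurable sub fmeasurable_bounded)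
      (auto intro!: borel_open open_midpoints bounded_midpoints)
  finally show ?thesis .
qed

text \<open>Members are nonempty so that the cardinality can serve as induction measure and two
  disjoint members are separated in some coordinate.\<close>

definition box_family :: "'a::euclidean_space set set \<Rightarrow> bool" where
  "box_family \<A> \<longleftrightarrow> finite \<A> \<and> (\<forall>X\<in>\<A>. X \<noteq> {} \<and> (\<exists>a b. X = box a b)) \<and> disjoint \<A>"

lemma box_family_Union:
  assumes "box_family \<A>"
  shows "open (\<Union>\<A>)" "bounded (\<Union>\<A>)"
  using assms unfolding box_family_def by (auto intro!: open_Union bounded_Union)

definition restrict_family :: "'a set \<Rightarrow> 'a set set \<Rightarrow> 'a set set" where
  "restrict_family H \<A> = (\<lambda>X. X \<inter> H) ` \<A> - {{}}"

lemma Union_restrict_family: "\<Union>(restrict_family H \<A>) = \<Union>\<A> \<inter> H"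
  by (auto simp: restrict_family_def)

lemma box_family_restrict:
  assumes \<A>: "box_family \<A>" and H: "\<And>a b. \<exists>a' b'. box a b \<inter> H = box a' b'"
  shows "box_family (restrict_family H \<A>)"
proof -
  have "\<exists>a b. Y = box a b" if "Y \<in> restrict_family H \<A>" for Y
  proof -
    from that obtain X where X: "X \<in> \<A>" "Y = X \<inter> H" by (auto simp: restrict_family_def)
    moreover from X(1) \<A> obtain a b where "X = box a b" unfolding box_family_def by blast
    ultimately show ?thesis using H[of a b] by simp
  qed
  moreover have "disjoint (restrict_family H \<A>)"
  proof (rule disjointI)
    fix Y Z assume "Y \<in> restrict_family H \<A>" "Z \<in> restrict_family H \<A>" "Y \<noteq> Z"
    then obtain X X' where "X \<in> \<A>" "X' \<in> \<A>" "X \<noteq> X'" "Y = X \<inter> H" "Z = X' \<inter> H"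
      unfolding restrict_family_def by auto
    moreover from this have "X \<inter> X' = {}" using \<A> unfolding box_family_def by (auto dest: disjointD)
    ultimately show "Y \<inter> Z = {}" by auto
  qed
  ultimately show ?thesis using \<A> by (auto simp: box_family_def restrict_family_def)
qed

lemma card_restrict_family:
  assumes "finite \<A>"
  shows "card (restrict_family H \<A>) \<le> card \<A>"
    and "X \<in> \<A> \<Longrightarrow> X \<inter> H = {} \<Longrightarrow> card (restrict_family H \<A>) < card \<A>"
proof -
  have "card (restrict_family H \<A>) \<le> card ((\<lambda>X. X \<inter> H) ` \<A>)"
    unfolding restrict_family_def using assms by (intro card_mono) auto
  also have "\<dots> \<le> card \<A>" using assms by (rule card_image_le)
  finally show "card (restrict_family H \<A>) \<le> card \<A>" .
  assume X: "X \<in> \<A>" "X \<inter> H = {}"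
  have "restrict_family H \<A> \<subseteq> (\<lambda>X. X \<inter> H) ` (\<A> - {X})"
    using X by (auto simp: restrict_family_def)
  then have "card (restrict_family H \<A>) \<le> card ((\<lambda>X. X \<inter> H) ` (\<A> - {X}))"
    using assms by (intro card_mono) auto
  also have "\<dots> \<le> card (\<A> - {X})" using assms by (intro card_image_le) auto
  also have "\<dots> < card \<A>" using assms X by (intro psubset_card_mono) auto
  finally show "card (restrict_family H \<A>) < card \<A>" .
qed

lemma box_Int_halfspace:
  fixes i :: "'a::euclidean_space"
  assumes i: "i \<in> Basis"
  shows "\<exists>a' b'. box a b \<inter> {x. x \<bullet> i < c} = box a' b'" "\<exists>a' b'. box a b \<inter> {x. c < x \<bullet> i} = box a' b'"
proof -
  have "box a b \<inter> {x. x \<bullet> i < c} = box a (\<Sum>j\<in>Basis. (if j = i then min (b \<bullet> j) c else b \<bullet> j) *\<^sub>R j)"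
    using i by (auto simp: mem_box split: if_splits)
  then show "\<exists>a' b'. box a b \<inter> {x. x \<bullet> i < c} = box a' b'" by blast
  have "box a b \<inter> {x. c < x \<bullet> i} = box (\<Sum>j\<in>Basis. (if j = i then max (a \<bullet> j) c else a \<bullet> j) *\<^sub>R j) b"
    using i by (auto simp: mem_box split: if_splits)
  then show "\<exists>a' b'. box a b \<inter> {x. c < x \<bullet> i} = box a' b'" by blast
qed

lemma measure_split_hyperplane:
  fixes A :: "'a::euclidean_space set"
  assumes A: "A \<in> sets borel" "bounded A" and i: "i \<noteq> 0"
  shows "measure lborel A = measure lborel (A \<inter> {x. x \<bullet> i < c}) + measure lborel (A \<inter> {x. c < x \<bullet> i})"
proof -
  have [measurable]: "A \<in> sets borel" by (rule A)
  have fin: "emeasure lborel (A \<inter> H) \<noteq> \<infinity>" for H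
    using emeasure_bounded_finite[of "A \<inter> H"] A(2) by (auto simp: bounded_Int)
  have "measure lborel A = measure lborel ((A \<inter> {x. x \<bullet> i < c}) \<union> (A \<inter> {x. c < x \<bullet> i}))"
    using AE_not_in_hyperplane[OF i, of c] by (intro measure_eq_AE) (auto elim!: AE_mp)
  also have "\<dots> = measure lborel (A \<inter> {x. x \<bullet> i < c}) + measure lborel (A \<inter> {x. c < x \<bullet> i})"
    by (intro measure_Union fin) auto
  finally show ?thesis .
qed

text \<open>Intermediate value theorem for the position of the hyperplane; hyperplanes are null
  sets, which gives continuity, and far positions have all or nothing of the bounded set on one
  side.\<close>

lemma exists_proportional_cut:
  fixes B :: "'a::euclidean_space set"
  assumes B: "B \<in> sets borel" "bounded B" and i: "i \<noteq> 0" and \<alpha>: "0 \<le> \<alpha>" "\<alpha> \<le> 1"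
  shows "\<exists>c. measure lborel (B \<inter> {x. x \<bullet> i < c}) = \<alpha> * measure lborel B"
proof -
  define F where "F c = measure lborel (B \<inter> {x. x \<bullet> i < c})" for c
  have [measurable]: "B \<in> sets borel" by (rule B)
  have "continuous_on UNIV (\<lambda>c. LINT x|lborel. indicator {x. c - x \<bullet> i > 0} x * (indicator B x :: real))"
  proof (rule continuous_on_integral_moving_halfspace[where w="\<lambda>c x. c - x \<bullet> i"])
    show "integrable lborel (indicator B :: 'a \<Rightarrow> real)"
      using fmeasurable_bounded[OF B] by (auto simp: fmeasurable_def)
    show "continuous_on UNIV (\<lambda>c. c - x \<bullet> i)" for x by (intro continuous_intros)
    show "AE x in lborel. c - x \<bullet> i \<noteq> 0" for c
      using AE_not_in_hyperplane[OF i, of c] by eventually_elim auto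
  qed measurable
  moreover have "(LINT x|lborel. indicator {x. c - x \<bullet> i > 0} x * (indicator B x :: real)) = F c" for c
  proof -
    have "(\<lambda>x. indicator {x. c - x \<bullet> i > 0} x * indicator B x) = (indicator (B \<inter> {x. x \<bullet> i < c}) :: 'a \<Rightarrow> real)"
      by (auto simp: indicator_def fun_eq_iff)
    then show ?thesis by (simp add: F_def)
  qed
  ultimately have cont: "continuous_on UNIV F" by simp
  obtain R where R: "\<And>x. x \<in> B \<Longrightarrow> norm x \<le> R" using B(2) by (auto simp: bounded_iff)
  have Ri: "\<bar>x \<bullet> i\<bar> \<le> \<bar>R\<bar> * norm i" if "x \<in> B" for x
  proof -
    have "\<bar>x \<bullet> i\<bar> \<le> norm x * norm i" by (rule Cauchy_Schwarz_ineq2)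
    also have "\<dots> \<le> \<bar>R\<bar> * norm i" using R[OF that] by (intro mult_right_mono) auto
    finally show ?thesis .
  qed
  define r where "r = \<bar>R\<bar> * norm i + 1"
  have 1: "B \<inter> {x. x \<bullet> i < - r} = {}" "B \<inter> {x. x \<bullet> i < r} = B"
    using Ri by (force simp: r_def)+
  have "\<exists>c\<ge>- r. c \<le> r \<and> F c = \<alpha> * measure lborel B"
  proof (rule IVT')
    show "F (- r) \<le> \<alpha> * measure lborel B" "\<alpha> * measure lborel B \<le> F r"
      using \<alpha> by (auto simp: F_def 1 mult_left_le_one_le)
    show "- r \<le> r" by (simp add: r_def)
    show "continuous_on {- r..r} F" using cont continuous_on_subset by blast
  qed
  then show ?thesis by (auto simp: F_def)
qed

text \<open>The Hadwiger--Ohmann argument: cutting both sets in the same proportion decreases the numbers of boxes, and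
  the midpoints of the lower parts are separated from those of the upper parts.\<close>

lemma brunn_minkowski_cut:
  fixes \<A> \<B> :: "'a::euclidean_space set set"
  assumes \<A>: "box_family \<A>" and \<B>: "box_family \<B>" and card: "card \<A> \<ge> 2"
    and IH: "\<And>\<A>' \<B>' :: 'a set set. box_family \<A>' \<Longrightarrow> box_family \<B>' \<Longrightarrow> card \<A>' < card \<A> \<Longrightarrow> card \<B>' \<le> card \<B> \<Longrightarrow>
      sqrt (measure lborel (\<Union>\<A>') * measure lborel (\<Union>\<B>')) \<le> measure lborel (midpoints (\<Union>\<A>') (\<Union>\<B>'))"
  shows "sqrt (measure lborel (\<Union>\<A>) * measure lborel (\<Union>\<B>)) \<le> measure lborel (midpoints (\<Union>\<A>) (\<Union>\<B>))"
proof (cases "measure lborel (\<Union>\<A>) = 0")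
  case True
  then show ?thesis by simp
next
  case False
  let ?A = "\<Union>\<A>" and ?B = "\<Union>\<B>"
  have fin: "finite \<A>" "finite \<B>" using \<A> \<B> by (auto simp: box_family_def)
  obtain X Y where XY: "X \<in> \<A>" "Y \<in> \<A>" "X \<noteq> Y"
    using card fin by (metis card_le_Suc0_iff_eq not_less_eq_eq numeral_2_eq_2)
  \<comment> \<open>Two disjoint nonempty boxes are separated in some coordinate. Cutting along a
    face between them leaves each side without one of the two, so both restricted families are
    smaller.\<close>
  have "\<exists>i\<in>Basis. \<exists>c. (\<exists>X\<in>\<A>. X \<inter> {x. x \<bullet> i < c} = {}) \<and> (\<exists>X\<in>\<A>. X \<inter> {x. c < x \<bullet> i} = {})"
  proof -
    have "X \<noteq> {} \<and> (\<exists>a b. X = box a b)" "Y \<noteq> {} \<and> (\<exists>a b. Y = box a b)"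
      using XY \<A> by (simp_all add: box_family_def)
    then obtain a b c d where ab: "X = box a b" "box a b \<noteq> {}" and cd: "Y = box c d" "box c d \<noteq> {}"
      by blast
    have "box a b \<inter> box c d = {}" using XY \<A> ab cd by (auto simp: box_family_def dest: disjointD)
    then obtain i where i: "i \<in> Basis" "b \<bullet> i \<le> c \<bullet> i \<or> d \<bullet> i \<le> a \<bullet> i"
      using ab(2) cd(2) unfolding disjoint_interval(4) box_ne_empty by (metis not_less)
    have X: "a \<bullet> i < x \<bullet> i \<and> x \<bullet> i < b \<bullet> i" if "x \<in> X" for x
      using that i(1) by (auto simp: ab(1) mem_box)
    have Y: "c \<bullet> i < x \<bullet> i \<and> x \<bullet> i < d \<bullet> i" if "x \<in> Y" for x
      using that i(1) by (auto simp: cd(1) mem_box)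
    from i(2) show ?thesis
    proof
      assume "b \<bullet> i \<le> c \<bullet> i"
      then have "Y \<inter> {x. x \<bullet> i < b \<bullet> i} = {}" "X \<inter> {x. b \<bullet> i < x \<bullet> i} = {}"
        using X Y by force+
      then show ?thesis using i(1) XY(1,2) by blast
    next
      assume "d \<bullet> i \<le> a \<bullet> i"
      then have "X \<inter> {x. x \<bullet> i < d \<bullet> i} = {}" "Y \<inter> {x. d \<bullet> i < x \<bullet> i} = {}"
        using X Y by force+
      then show ?thesis using i(1) XY(1,2) by blast
    qed
  qed
  then obtain i c where i: "i \<in> Basis" and c: "\<exists>X\<in>\<A>. X \<inter> {x. x \<bullet> i < c} = {}" "\<exists>X\<in>\<A>. X \<inter> {x. c < x \<bullet> i} = {}"
    by blast
  have i0: "i \<noteq> 0" using i by auto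
  have mA: "?A \<in> sets borel" "bounded ?A" and mB: "?B \<in> sets borel" "bounded ?B"
    using box_family_Union \<A> \<B> by (blast intro: borel_open)+
  let ?m = "measure lborel"
  define \<alpha> where "\<alpha> = ?m (?A \<inter> {x. x \<bullet> i < c}) / ?m ?A"
  have posA: "?m ?A > 0" using False by (simp add: zero_less_measure_iff)
  note splitA = measure_split_hyperplane[OF mA i0, of c]
  have A1: "?m (?A \<inter> {x. x \<bullet> i < c}) = \<alpha> * ?m ?A" using posA by (simp add: \<alpha>_def)
  have A2: "?m (?A \<inter> {x. c < x \<bullet> i}) = (1 - \<alpha>) * ?m ?A" using splitA A1 by (simp add: algebra_simps)
  have \<alpha>: "0 \<le> \<alpha>" "\<alpha> \<le> 1"
    using posA splitA measure_nonneg[of lborel "?A \<inter> {x. c < x \<bullet> i}"] by (auto simp: \<alpha>_def divide_le_eq)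
  obtain c' where B1: "?m (?B \<inter> {x. x \<bullet> i < c'}) = \<alpha> * ?m ?B"
    using exists_proportional_cut[OF mB i0 \<alpha>] by blast
  have B2: "?m (?B \<inter> {x. c' < x \<bullet> i}) = (1 - \<alpha>) * ?m ?B"
    using measure_split_hyperplane[OF mB i0, of c'] B1 by (simp add: algebra_simps)
  let ?M = "midpoints ?A ?B"
  let ?M1 = "midpoints (?A \<inter> {x. x \<bullet> i < c}) (?B \<inter> {x. x \<bullet> i < c'})"
  let ?M2 = "midpoints (?A \<inter> {x. c < x \<bullet> i}) (?B \<inter> {x. c' < x \<bullet> i})"
  have sub: "?M1 \<subseteq> ?M" "?M2 \<subseteq> ?M" by (intro midpoints_mono; blast)+
  have op: "open ?M" "open ?M1" "open ?M2"
    using box_family_Union(1)[OF \<A>]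
    by (auto intro!: open_midpoints open_Int open_halfspace_component_lt open_halfspace_component_gt)
  have bd: "bounded ?M" using mA mB by (intro bounded_midpoints)
  have "card (restrict_family {x. x \<bullet> i < c} \<A>) < card \<A>" "card (restrict_family {x. c < x \<bullet> i} \<A>) < card \<A>"
    using c card_restrict_family(2)[OF fin(1)] by blast+
  then have "sqrt ((\<alpha> * ?m ?A) * (\<alpha> * ?m ?B)) \<le> ?m ?M1"
      and "sqrt (((1 - \<alpha>) * ?m ?A) * ((1 - \<alpha>) * ?m ?B)) \<le> ?m ?M2"
    using IH[OF box_family_restrict[OF \<A> box_Int_halfspace(1)[OF i]] box_family_restrict[OF \<B> box_Int_halfspace(1)[OF i]]
        _ card_restrict_family(1)[OF fin(2)], of c c']
      IH[OF box_family_restrict[OF \<A> box_Int_halfspace(2)[OF i]] box_family_restrict[OF \<B> box_Int_halfspace(2)[OF i]]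
        _ card_restrict_family(1)[OF fin(2)], of c c']
    unfolding Union_restrict_family A1 B1 A2 B2 by simp_all
  \<comment> \<open>Both volumes carry the same proportion, so it comes out of the root with degree
    one, and the weights \<alpha> and 1 - \<alpha> of the two halves add up to 1.\<close>
  moreover have "sqrt ((t * p) * (t * q)) = t * sqrt (p * q)" if "t \<ge> 0" for t p q :: real
  proof -
    have "(t * p) * (t * q) = t\<^sup>2 * (p * q)" by (simp add: power2_eq_square)
    then show ?thesis using that by (simp add: real_sqrt_mult)
  qed
  ultimately have "\<alpha> * sqrt (?m ?A * ?m ?B) + (1 - \<alpha>) * sqrt (?m ?A * ?m ?B) \<le> ?m ?M1 + ?m ?M2"
    using \<alpha> by (intro add_mono) auto
  also have "?m ?M1 + ?m ?M2 = ?m (?M1 \<union> ?M2)"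
  proof (rule measure_Union[symmetric])
    have "?M1 \<subseteq> {z. z \<bullet> i < (c + c') / 2}" "?M2 \<subseteq> {z. (c + c') / 2 < z \<bullet> i}"
      by (auto simp: midpoints_def inner_add_left)
    then show "?M1 \<inter> ?M2 = {}" by force
    have "bounded ?M1" "bounded ?M2" using bounded_subset[OF bd] sub by blast+
    then show "emeasure lborel ?M1 \<noteq> \<infinity>" "emeasure lborel ?M2 \<noteq> \<infinity>"
      using emeasure_bounded_finite by fastforce+
  qed (use op in auto)
  also have "\<dots> \<le> ?m ?M"
    using op bd sub by (intro measure_mono_fmeasurable fmeasurable_bounded Un_least) auto
  finally show ?thesis by (simp add: algebra_simps)
qed

text \<open>Induction on the total number of boxes. A family with two members can be cut, which
  shrinks it without enlarging the other; symmetry of the midpoints covers a cut of the second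
  family, and single boxes are the base.\<close>

lemma brunn_minkowski_box_family:
  fixes \<A> \<B> :: "'a::euclidean_space set set"
  assumes "box_family \<A>" "box_family \<B>"
  shows "sqrt (measure lborel (\<Union>\<A>) * measure lborel (\<Union>\<B>)) \<le> measure lborel (midpoints (\<Union>\<A>) (\<Union>\<B>))"
  using assms
proof (induction "card \<A> + card \<B>" arbitrary: \<A> \<B> rule: less_induct)
  case less
  have fin: "finite \<A>" "finite \<B>" using less.prems by (auto simp: box_family_def)
  consider "card \<A> \<ge> 2" | "card \<B> \<ge> 2" | "card \<A> = 0 \<or> card \<B> = 0" | "card \<A> = 1" "card \<B> = 1"
    by linarith
  then show ?case
  proof cases
    case 1
    show ?thesis
      by (rule brunn_minkowski_cut[OF less.prems 1]) (rule less.hyps, auto)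
  next
    case 2
    have "sqrt (measure lborel (\<Union>\<B>) * measure lborel (\<Union>\<A>)) \<le> measure lborel (midpoints (\<Union>\<B>) (\<Union>\<A>))"
    proof (rule brunn_minkowski_cut[OF less.prems(2,1) 2])
      fix \<A>' \<B>' :: "'a set set"
      assume "box_family \<A>'" "box_family \<B>'" "card \<A>' < card \<B>" "card \<B>' \<le> card \<A>"
      then show "sqrt (measure lborel (\<Union>\<A>') * measure lborel (\<Union>\<B>')) \<le> measure lborel (midpoints (\<Union>\<A>') (\<Union>\<B>'))"
        by (intro less.hyps) auto
    qed
    then show ?thesis by (simp add: midpoints_commute mult.commute)
  next
    case 3
    then show ?thesis using fin by auto
  next
    case 4
    then obtain X Y where "\<A> = {X}" "\<B> = {Y}" by (auto simp: card_1_singleton_iff)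
    moreover from this have "X \<noteq> {} \<and> (\<exists>a b. X = box a b)" "Y \<noteq> {} \<and> (\<exists>a b. Y = box a b)"
      using less.prems by (simp_all add: box_family_def)
    then obtain a b c d where "X = box a b" "box a b \<noteq> {}" "Y = box c d" "box c d \<noteq> {}"
      by blast
    ultimately show ?thesis using brunn_minkowski_box[of a b c d] by simp
  qed
qed

text \<open>Finite unions from a countable cover by closed boxes are divided into boxes with
  disjoint interiors. Passing to the interiors loses only frontiers, which are null sets.\<close>

lemma open_box_family_approximation:
  fixes A :: "'a::euclidean_space set"
  assumes A: "open A" "bounded A"
  obtains \<A> :: "nat \<Rightarrow> 'a set set" where "\<And>n. box_family (\<A> n)" "\<And>n. \<Union>(\<A> n) \<subseteq> A"
    "(\<lambda>n. measure lborel (\<Union>(\<A> n))) \<longlonglongrightarrow> measure lborel A"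
proof -
  obtain \<D> where D: "countable \<D>" "\<D> \<subseteq> Pow A" "\<And>X. X \<in> \<D> \<Longrightarrow> \<exists>a b. X = cbox a b" "\<Union>\<D> = A"
    using open_countable_Union_open_cbox[OF A(1)] by metis
  \<comment> \<open>Enumerating needs a nonempty set, and \<D> is empty if \<open>A\<close> is; the
    added empty set is itself written as a closed box below.\<close>
  define d where "d = from_nat_into (insert {} \<D>)"
  have range_d: "range d = insert {} \<D>" unfolding d_def using D(1) by (intro range_from_nat_into) auto
  have "({} :: 'a set) = cbox One 0" using nonempty_Basis box_eq_empty(2)[of One "0::'a"] by fastforce
  then have d_box: "\<exists>a b. d n = cbox a b" for n
    using D(3)[of "d n"] range_d by (metis insertE rangeI)
  define U where "U n = (\<Union>k<n. d k)" for n
  have U_un: "(\<Union>n. U n) = A"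
  proof -
    have "(\<Union>n. U n) = \<Union>(range d)" by (auto simp: U_def)
    then show ?thesis using range_d D(4) by simp
  qed
  have Ub: "U n \<in> sets borel" for n
    unfolding U_def using d_box by (intro sets.finite_UN) (auto, metis borel_closed closed_cbox)
  have "(\<lambda>n. measure lborel (U n)) \<longlonglongrightarrow> measure lborel (\<Union>n. U n)"
  proof (rule Lim_measure_incseq)
    show "incseq U" unfolding U_def incseq_def by (intro allI impI UN_mono) auto
    show "emeasure lborel (\<Union>n. U n) \<noteq> \<infinity>" unfolding U_un using emeasure_bounded_finite[OF A(2)] by simp
  qed (use Ub in auto)
  moreover have "\<exists>\<A>. box_family \<A> \<and> \<Union>\<A> \<subseteq> A \<and> measure lborel (\<Union>\<A>) = measure lborel (U n)" for n
  proof -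
    have "U n = \<Union>(d ` {..<n})" by (simp add: U_def)
    then obtain p where p: "p division_of U n"
      using elementary_unions_intervals[of "d ` {..<n}"] d_box
      by (metis (no_types, lifting) finite_imageI finite_lessThan imageE)
    define \<A> where "\<A> = interior ` p - {{}}"
    have fam: "box_family \<A>"
      unfolding box_family_def
    proof (intro conjI ballI)
      show "finite \<A>" using division_ofD(1)[OF p] by (simp add: \<A>_def)
      show "X \<noteq> {}" if "X \<in> \<A>" for X using that by (simp add: \<A>_def)
      show "\<exists>a b. X = box a b" if X: "X \<in> \<A>" for X
      proof -
        obtain K where "K \<in> p" "X = interior K" using X by (auto simp: \<A>_def)
        then show ?thesis using division_ofD(4)[OF p] interior_cbox by metis
      qed
      show "disjoint \<A>"
        using division_ofD(5)[OF p] by (intro disjointI) (auto simp: \<A>_def)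
    qed
    have sub: "\<Union>\<A> \<subseteq> U n"
      using division_ofD(2)[OF p] interior_subset unfolding \<A>_def by blast
    have "AE x in lborel. x \<notin> frontier K" if "K \<in> p" for K
      using division_ofD(4)[OF p that]
      by (intro AE_lborel_not_in_negligible) (auto intro!: negligible_convex_frontier borel_closed)
    then have "AE x in lborel. \<forall>K\<in>p. x \<notin> frontier K"
      using division_ofD(1)[OF p] by (simp add: AE_finite_all)
    then have "measure lborel (\<Union>\<A>) = measure lborel (U n)"
    proof (intro measure_eq_AE, elim AE_mp, intro AE_I2 impI)
      fix x assume x: "\<forall>K\<in>p. x \<notin> frontier K"
      show "x \<in> \<Union>\<A> \<longleftrightarrow> x \<in> U n"
      proof
        assume "x \<in> U n"
        then obtain K where K: "K \<in> p" "x \<in> K" using division_ofD(6)[OF p] by blast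
        then have "x \<in> interior K" using x closure_subset by (auto simp: frontier_def)
        then show "x \<in> \<Union>\<A>" using K by (auto simp: \<A>_def)
      qed (use sub in blast)
    qed (use box_family_Union(1)[OF fam] Ub in auto)
    moreover have "\<Union>\<A> \<subseteq> A" using sub U_un by blast
    ultimately show ?thesis using fam by blast
  qed
  then obtain \<A> where "\<And>n. box_family (\<A> n)" "\<And>n. \<Union>(\<A> n) \<subseteq> A" "\<And>n. measure lborel (\<Union>(\<A> n)) = measure lborel (U n)"
    by metis
  ultimately show thesis using that[of \<A>] by (simp add: U_un)
qed

text \<open>Families of boxes exhaust both sets from inside, and taking midpoints is monotone. The
  form with midpoints and a geometric mean does not depend on the dimension and suffices for a
  second-derivative criterion of log-concavity.\<close>

theorem brunn_minkowski_midpoints: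
  fixes A B :: "'a::euclidean_space set"
  assumes A: "open A" "bounded A" and B: "open B" "bounded B"
  shows "measure lborel A * measure lborel B \<le> (measure lborel (midpoints A B))\<^sup>2"
proof -
  obtain \<A> where a: "\<And>n. box_family (\<A> n)" "\<And>n::nat. \<Union>(\<A> n) \<subseteq> A"
    "(\<lambda>n. measure lborel (\<Union>(\<A> n))) \<longlonglongrightarrow> measure lborel A"
    using open_box_family_approximation[OF A] by blast
  obtain \<B> where b: "\<And>n. box_family (\<B> n)" "\<And>n::nat. \<Union>(\<B> n) \<subseteq> B"
    "(\<lambda>n. measure lborel (\<Union>(\<B> n))) \<longlonglongrightarrow> measure lborel B"
    using open_box_family_approximation[OF B] by blast
  have le: "sqrt (measure lborel (\<Union>(\<A> n)) * measure lborel (\<Union>(\<B> n))) \<le> measure lborel (midpoints A B)" for n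
  proof -
    have "measure lborel (midpoints (\<Union>(\<A> n)) (\<Union>(\<B> n))) \<le> measure lborel (midpoints A B)"
      using a(2) b(2) A B box_family_Union(1)[OF a(1)]
      by (intro measure_mono_fmeasurable midpoints_mono fmeasurable_bounded)
        (auto intro!: borel_open open_midpoints bounded_midpoints)
    then show ?thesis using brunn_minkowski_box_family[OF a(1) b(1), of n n] by linarith
  qed
  have "(\<lambda>n. sqrt (measure lborel (\<Union>(\<A> n)) * measure lborel (\<Union>(\<B> n)))) \<longlonglongrightarrow> sqrt (measure lborel A * measure lborel B)"
    by (intro tendsto_intros a b)
  then have "sqrt (measure lborel A * measure lborel B) \<le> measure lborel (midpoints A B)"
    by (rule LIMSEQ_le_const2) (use le in auto)
  then show ?thesis by (rule sqrt_le_D)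
qed

section \<open>A weighted one-dimensional Poincare inequality\<close>

text \<open>Put \<open>F x = \<integral>\<^sub>\<alpha>\<^sup>x p v\<close>, \<open>k = \<pi> / (b - a)\<close> and \<open>B = k cot (k (x - a)) + p' / (2 p)\<close>. Completing the square
  in \<open>(p v - B F)\<^sup>2 / p\<close> and using log-concavity of \<open>p\<close> yields
  \<open>p v\<^sup>2 \<ge> k\<^sup>2 F\<^sup>2 / p + (B F\<^sup>2 / p)'\<close>, while \<open>p v\<^sup>2 = (F v)' - F v'\<close>.\<close>

lemma weighted_poincare_mean_zero:
  fixes p p' p'' v v' :: "real \<Rightarrow> real"
  assumes ab: "a < \<alpha>" "\<alpha> \<le> \<beta>" "\<beta> < b"
    and p: "\<And>x. (p has_real_derivative p' x) (at x)" "\<And>x. (p' has_real_derivative p'' x) (at x)"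
    and pos: "\<And>x. x \<in> {\<alpha>..\<beta>} \<Longrightarrow> p x > 0"
    and logconc: "\<And>x. x \<in> {\<alpha>..\<beta>} \<Longrightarrow> p x * p'' x \<le> (p' x)\<^sup>2"
    and v: "\<And>x. (v has_real_derivative v' x) (at x)" and v'c: "continuous_on UNIV v'"
    and mean: "integral {\<alpha>..\<beta>} (\<lambda>x. p x * v x) = 0"
  shows "integral {\<alpha>..\<beta>} (\<lambda>x. p x * (v x)\<^sup>2) \<le> ((b - a) / pi)\<^sup>2 * integral {\<alpha>..\<beta>} (\<lambda>x. p x * (v' x)\<^sup>2)"
proof -
  \<comment> \<open>The square of \<open>k\<close> is the first Dirichlet eigenvalue of the
    interval, with eigenfunction sin (k (x - a)). The function \<open>B\<close> below is the
    logarithmic derivative of this sine times the square root of \<open>p\<close>; for constant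
    \<open>p\<close> the completed square vanishes when \<open>F\<close> is that
    eigenfunction.\<close>
  define k where "k = pi / (b - a)"
  have k: "k > 0" using ab by (simp add: k_def)
  have pc: "continuous_on S p" and vc: "continuous_on S v" and v'c': "continuous_on S v'" for S
    using p(1) v continuous_on_subset[OF v'c subset_UNIV]
    by (auto intro!: continuous_at_imp_continuous_on intro: DERIV_isCont)
  define F where "F x = integral {\<alpha>..x} (\<lambda>x. p x * v x)" for x
  have F: "(F has_real_derivative p x * v x) (at x within {\<alpha>..\<beta>})" if "x \<in> {\<alpha>..\<beta>}" for x
    unfolding F_def using that by (intro integral_has_real_derivative continuous_intros pc vc)
  have F0: "F \<alpha> = 0" "F \<beta> = 0" using mean by (auto simp: F_def)
  define ct where "ct x = cos (k * (x - a)) / sin (k * (x - a))" for x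
  define B where "B x = k * ct x + p' x / (2 * p x)" for x
  define B' where "B' x = - k\<^sup>2 * (1 + (ct x)\<^sup>2) + (p'' x * p x - (p' x)\<^sup>2) / (2 * (p x)\<^sup>2)" for x
  \<comment> \<open>The strict inequalities \<open>a < \<alpha>\<close> and
    \<open>\<beta> < b\<close> keep the argument between 0 and pi, so the cotangent has no pole on
    the closed interval.\<close>
  have sin: "sin (k * (x - a)) > 0" if "x \<in> {\<alpha>..\<beta>}" for x
  proof (rule sin_gt_zero)
    show "0 < k * (x - a)" using k that ab by simp
    have "k * (x - a) < k * (b - a)" using k that ab by (intro mult_strict_left_mono) auto
    then show "k * (x - a) < pi" using ab by (simp add: k_def)
  qed
  have ct: "(ct has_real_derivative - k * (1 + (ct x)\<^sup>2)) (at x)" if x: "x \<in> {\<alpha>..\<beta>}" for x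
  proof -
    have "((\<lambda>x. cos (k * (x - a))) has_real_derivative - sin (k * (x - a)) * k) (at x)"
      and "((\<lambda>x. sin (k * (x - a))) has_real_derivative cos (k * (x - a)) * k) (at x)"
      by (auto intro!: derivative_eq_intros)
    from DERIV_divide[OF this] sin[OF x] have "(ct has_real_derivative
        (- sin (k * (x - a)) * k * sin (k * (x - a)) - cos (k * (x - a)) * (cos (k * (x - a)) * k)) / (sin (k * (x - a)) * sin (k * (x - a)))) (at x)"
      unfolding ct_def[abs_def] by simp
    moreover have "(- s * k * s - c * (c * k)) / (s * s) = - k * (1 + (c / s)\<^sup>2)" if "s > 0" for s c :: real
      using that by (simp add: power2_eq_square field_simps)
    ultimately show ?thesis using sin[OF x] by (simp add: ct_def)
  qed
  have B: "(B has_real_derivative B' x) (at x)" if x: "x \<in> {\<alpha>..\<beta>}" for x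
  proof -
    have "(B has_real_derivative k * (- k * (1 + (ct x)\<^sup>2)) + (p'' x * (2 * p x) - p' x * (2 * p' x)) / (2 * p x * (2 * p x))) (at x)"
      unfolding B_def[abs_def] using pos[OF x]
      by (intro DERIV_add DERIV_cmult ct[OF x] DERIV_divide p) auto
    moreover have "k * (- k * (1 + (ct x)\<^sup>2)) + (p'' x * (2 * p x) - p' x * (2 * p' x)) / (2 * p x * (2 * p x)) = B' x"
      using pos[OF x] by (simp add: B'_def power2_eq_square field_simps)
    ultimately show ?thesis by simp
  qed
  define H where "H x = B x * (F x)\<^sup>2 / p x" for x
  define H' where "H' x = B' x * (F x)\<^sup>2 / p x + 2 * B x * F x * v x - B x * (F x)\<^sup>2 * p' x / (p x)\<^sup>2" for x
  have H: "(H has_real_derivative H' x) (at x within {\<alpha>..\<beta>})" if x: "x \<in> {\<alpha>..\<beta>}" for x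
  proof -
    have 1: "((\<lambda>x. B x * (F x)\<^sup>2) has_real_derivative B' x * (F x)\<^sup>2 + (2 * F x * (p x * v x)) * B x) (at x within {\<alpha>..\<beta>})"
      using DERIV_mult[OF has_field_derivative_at_within[OF B[OF x]] DERIV_power[OF F[OF x], of 2]] by (simp add: mult_ac)
    have "((\<lambda>x. B x * (F x)\<^sup>2 / p x) has_real_derivative
        ((B' x * (F x)\<^sup>2 + (2 * F x * (p x * v x)) * B x) * p x - B x * (F x)\<^sup>2 * p' x) / (p x * p x)) (at x within {\<alpha>..\<beta>})"
      using pos[OF x] by (intro DERIV_divide 1 has_field_derivative_at_within[OF p(1)]) auto
    moreover have "((B' x * (F x)\<^sup>2 + (2 * F x * (p x * v x)) * B x) * p x - B x * (F x)\<^sup>2 * p' x) / (p x * p x) = H' x"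
      using pos[OF x] by (simp add: H'_def power2_eq_square field_simps)
    ultimately show ?thesis unfolding H_def[abs_def] by simp
  qed
  have key: "k\<^sup>2 * (F x)\<^sup>2 / p x + H' x \<le> p x * (v x)\<^sup>2" if x: "x \<in> {\<alpha>..\<beta>}" for x
  proof -
    have px: "p x > 0" by (rule pos[OF x])
    have "p x * (v x)\<^sup>2 - H' x = (p x * v x - B x * F x)\<^sup>2 / p x + (F x)\<^sup>2 / p x * (- (B x)\<^sup>2 - B' x + B x * p' x / p x)"
      using px by (simp add: H'_def power2_eq_square field_simps)
    also have "- (B x)\<^sup>2 - B' x + B x * p' x / p x = k\<^sup>2 + (3 * (p' x)\<^sup>2 - 2 * (p x * p'' x)) / (4 * (p x)\<^sup>2)"
      using px by (simp add: B_def B'_def power2_eq_square field_simps)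
    finally have eq: "p x * (v x)\<^sup>2 - H' x = (p x * v x - B x * F x)\<^sup>2 / p x +
        (F x)\<^sup>2 / p x * (k\<^sup>2 + (3 * (p' x)\<^sup>2 - 2 * (p x * p'' x)) / (4 * (p x)\<^sup>2))" .
    \<comment> \<open>This is p'^2 plus twice the nonnegative quantity p'^2 - p p'' of
      log-concavity; dropping it leaves the constant \<open>k\<^sup>2\<close>.\<close>
    have "3 * (p' x)\<^sup>2 - 2 * (p x * p'' x) \<ge> 0"
      using logconc[OF x] zero_le_power2[of "p' x"] by linarith
    then have "(F x)\<^sup>2 / p x * k\<^sup>2 \<le> (F x)\<^sup>2 / p x * (k\<^sup>2 + (3 * (p' x)\<^sup>2 - 2 * (p x * p'' x)) / (4 * (p x)\<^sup>2))"
      using px by (intro mult_left_mono) auto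
    moreover have "0 \<le> (p x * v x - B x * F x)\<^sup>2 / p x" using px by simp
    ultimately show ?thesis using eq by (simp add: mult.commute)
  qed
  \<comment> \<open>\<open>F\<close>, and with it \<open>H\<close>, vanishes at both ends, so the
    integral of this derivative is 0. Only half of \<open>H\<close> is taken, because the estimate
    of - v' F below consumes half of k^2 F^2 / p.\<close>
  have deriv: "((\<lambda>x. F x * v x - H x / 2) has_real_derivative (p x * v x * v x + v' x * F x - H' x / 2)) (at x within {\<alpha>..\<beta>})"
    if x: "x \<in> {\<alpha>..\<beta>}" for x
    using DERIV_diff[OF DERIV_mult[OF F[OF x] has_field_derivative_at_within[OF v]] DERIV_cdivide[OF H[OF x], of 2]] by simp
  have "((\<lambda>x. p x * v x * v x + v' x * F x - H' x / 2) has_integral (F \<beta> * v \<beta> - H \<beta> / 2) - (F \<alpha> * v \<alpha> - H \<alpha> / 2)) {\<alpha>..\<beta>}"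
    using deriv ab(2) by (intro fundamental_theorem_of_calculus) (auto simp: has_real_derivative_iff_has_vector_derivative)
  then have I0: "((\<lambda>x. p x * v x * v x + v' x * F x - H' x / 2) has_integral 0) {\<alpha>..\<beta>}"
    by (simp add: F0 H_def)
  have I1: "((\<lambda>x. p x * (v x)\<^sup>2) has_integral integral {\<alpha>..\<beta>} (\<lambda>x. p x * (v x)\<^sup>2)) {\<alpha>..\<beta>}"
    and I2: "((\<lambda>x. p x * (v' x)\<^sup>2) has_integral integral {\<alpha>..\<beta>} (\<lambda>x. p x * (v' x)\<^sup>2)) {\<alpha>..\<beta>}"
    by (intro integrable_integral integrable_continuous_real continuous_intros pc vc v'c')+
  have "integral {\<alpha>..\<beta>} (\<lambda>x. p x * (v x)\<^sup>2) / 2 - integral {\<alpha>..\<beta>} (\<lambda>x. p x * (v' x)\<^sup>2) / (2 * k\<^sup>2) \<le> 0"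
  proof (rule has_integral_le[OF has_integral_diff[OF has_integral_divide[OF I1] has_integral_divide[OF I2]] I0])
    fix x assume x: "x \<in> {\<alpha>..\<beta>}"
    have px: "p x > 0" by (rule pos[OF x])
    \<comment> \<open>Young's inequality, weighted so that its F-term is half of the one supplied by
      \<open>key\<close>.\<close>
    have "- (v' x * F x) \<le> k\<^sup>2 * (F x)\<^sup>2 / p x / 2 + p x * (v' x)\<^sup>2 / (2 * k\<^sup>2)"
    proof -
      have "0 \<le> (k\<^sup>2 * F x + p x * v' x)\<^sup>2 / (2 * k\<^sup>2 * p x)" using px by simp
      also have "\<dots> = k\<^sup>2 * (F x)\<^sup>2 / p x / 2 + p x * (v' x)\<^sup>2 / (2 * k\<^sup>2) + v' x * F x"
        using px k by (simp add: power2_eq_square field_simps)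
      finally show ?thesis by linarith
    qed
    moreover have "W / 2 - M \<le> W + G - h / 2" if "- G \<le> A / 2 + M" "A + h \<le> W" for W M G h A :: real
      using that by linarith
    moreover have "p x * v x * v x = p x * (v x)\<^sup>2" by (simp add: power2_eq_square)
    ultimately show "p x * (v x)\<^sup>2 / 2 - p x * (v' x)\<^sup>2 / (2 * k\<^sup>2) \<le> p x * v x * v x + v' x * F x - H' x / 2"
      using key[OF x] by metis
  qed
  then have "integral {\<alpha>..\<beta>} (\<lambda>x. p x * (v x)\<^sup>2) \<le> integral {\<alpha>..\<beta>} (\<lambda>x. p x * (v' x)\<^sup>2) / k\<^sup>2" by simp
  then show ?thesis by (simp add: k_def power_divide mult.commute)
qed

text \<open>Applies the case of mean zero to \<open>v\<close> minus its weighted mean.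
  Multiplication by the mass of \<open>p\<close> removes the division; this form passes to limits
  and is homogeneous of degree two in \<open>p\<close>.\<close>

lemma weighted_poincare_interval:
  fixes p p' p'' v v' :: "real \<Rightarrow> real"
  assumes ab: "a < \<alpha>" "\<alpha> < \<beta>" "\<beta> < b"
    and p: "\<And>x. (p has_real_derivative p' x) (at x)" "\<And>x. (p' has_real_derivative p'' x) (at x)"
    and pos: "\<And>x. x \<in> {\<alpha>..\<beta>} \<Longrightarrow> p x > 0"
    and logconc: "\<And>x. x \<in> {\<alpha>..\<beta>} \<Longrightarrow> p x * p'' x \<le> (p' x)\<^sup>2"
    and v: "\<And>x. (v has_real_derivative v' x) (at x)" and v'c: "continuous_on UNIV v'"
  shows "integral {\<alpha>..\<beta>} p * integral {\<alpha>..\<beta>} (\<lambda>x. p x * (v x)\<^sup>2) - (integral {\<alpha>..\<beta>} (\<lambda>x. p x * v x))\<^sup>2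
    \<le> ((b - a) / pi)\<^sup>2 * (integral {\<alpha>..\<beta>} p * integral {\<alpha>..\<beta>} (\<lambda>x. p x * (v' x)\<^sup>2))"
proof -
  have pc: "continuous_on S p" and vc: "continuous_on S v" for S
    using p(1) v by (auto intro!: continuous_at_imp_continuous_on DERIV_isCont)
  let ?I = "integral {\<alpha>..\<beta>}"
  have ip: "p integrable_on {\<alpha>..\<beta>}" "(\<lambda>x. p x * v x) integrable_on {\<alpha>..\<beta>}" "(\<lambda>x. p x * (v x)\<^sup>2) integrable_on {\<alpha>..\<beta>}"
    by (intro integrable_continuous_real continuous_intros pc vc)+
  have P: "?I p > 0"
  proof -
    have "?I p \<ge> 0" using pos by (intro integral_nonneg ip) (auto intro: less_imp_le)
    moreover have "?I p \<noteq> 0"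
    proof
      assume "?I p = 0"
      then have "\<forall>x\<in>{\<alpha>..\<beta>}. p x = 0"
        using integral_eq_0_iff[OF pc] pos ab(2) by (auto intro: less_imp_le)
      then show False using pos[of \<alpha>] ab(2) by auto
    qed
    ultimately show ?thesis by simp
  qed
  define m where "m = ?I (\<lambda>x. p x * v x) / ?I p"
  have "?I (\<lambda>x. p x * (v x - m)) = ?I (\<lambda>x. p x * v x - m * p x)" by (simp add: algebra_simps)
  also have "\<dots> = ?I (\<lambda>x. p x * v x) - m * ?I p"
    using ip by (subst integral_diff) (auto intro: integrable_on_mult_right)
  also have "\<dots> = 0" using P by (simp add: m_def)
  finally have "?I (\<lambda>x. p x * (v x - m)\<^sup>2) \<le> ((b - a) / pi)\<^sup>2 * ?I (\<lambda>x. p x * (v' x)\<^sup>2)"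
    by (intro weighted_poincare_mean_zero[OF ab(1) less_imp_le[OF ab(2)] ab(3) p pos logconc _ v'c])
      (auto intro!: derivative_eq_intros v)
  moreover have "?I (\<lambda>x. p x * (v x - m)\<^sup>2) = ?I (\<lambda>x. p x * (v x)\<^sup>2) - 2 * m * ?I (\<lambda>x. p x * v x) + m\<^sup>2 * ?I p"
  proof -
    have "?I (\<lambda>x. p x * (v x - m)\<^sup>2) = ?I (\<lambda>x. p x * (v x)\<^sup>2 - 2 * m * (p x * v x) + m\<^sup>2 * p x)"
      by (simp add: power2_diff algebra_simps)
    also have "\<dots> = ?I (\<lambda>x. p x * (v x)\<^sup>2) - 2 * m * ?I (\<lambda>x. p x * v x) + m\<^sup>2 * ?I p"
      by (intro integral_unique has_integral_add has_integral_diff has_integral_mult_right integrable_integral ip)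
    finally show ?thesis .
  qed
  moreover have "2 * m * ?I (\<lambda>x. p x * v x) = 2 * m\<^sup>2 * ?I p" using P by (simp add: m_def power2_eq_square)
  ultimately have "?I (\<lambda>x. p x * (v x)\<^sup>2) - m\<^sup>2 * ?I p \<le> ((b - a) / pi)\<^sup>2 * ?I (\<lambda>x. p x * (v' x)\<^sup>2)" by (simp add: mult.commute)
  then have "?I p * (?I (\<lambda>x. p x * (v x)\<^sup>2) - m\<^sup>2 * ?I p) \<le> ?I p * (((b - a) / pi)\<^sup>2 * ?I (\<lambda>x. p x * (v' x)\<^sup>2))"
    using P by (intro mult_left_mono) auto
  moreover have "?I p * (m\<^sup>2 * ?I p) = (?I (\<lambda>x. p x * v x))\<^sup>2" using P by (simp add: m_def power2_eq_square)
  ultimately show ?thesis by (simp add: right_diff_distrib mult_ac)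
qed

text \<open>The smoothed marginals used later vanish at the ends of their support, so positivity is
  available on the open interval only. Shrunken intervals, compared with the full length, exhaust
  it.\<close>

lemma weighted_poincare:
  fixes p p' p'' v v' :: "real \<Rightarrow> real"
  assumes ab: "a < b"
    and p: "\<And>x. (p has_real_derivative p' x) (at x)" "\<And>x. (p' has_real_derivative p'' x) (at x)"
    and pos: "\<And>x. x \<in> {a<..<b} \<Longrightarrow> p x > 0"
    and logconc: "\<And>x. x \<in> {a<..<b} \<Longrightarrow> p x * p'' x \<le> (p' x)\<^sup>2"
    and v: "\<And>x. (v has_real_derivative v' x) (at x)" and v'c: "continuous_on UNIV v'"
  shows "integral {a..b} p * integral {a..b} (\<lambda>x. p x * (v x)\<^sup>2) - (integral {a..b} (\<lambda>x. p x * v x))\<^sup>2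
    \<le> ((b - a) / pi)\<^sup>2 * (integral {a..b} p * integral {a..b} (\<lambda>x. p x * (v' x)\<^sup>2))"
proof -
  have pc: "continuous_on S p" and vc: "continuous_on S v" and v'c': "continuous_on S v'" for S
    using p(1) v continuous_on_subset[OF v'c subset_UNIV]
    by (auto intro!: continuous_at_imp_continuous_on intro: DERIV_isCont)
  \<comment> \<open>The summand 3 gives 2 r < b - a already for n = 0, so the shrunken intervals are
    never degenerate.\<close>
  define r where "r n = (b - a) / (real n + 3)" for n
  have r: "0 < r n" "2 * r n < b - a" for n
  proof -
    show "0 < r n" using ab by (simp add: r_def)
    have "(b - a) * (2 / (real n + 3)) < (b - a) * 1" using ab by (intro mult_strict_left_mono) auto
    then show "2 * r n < b - a" by (simp add: r_def mult.commute)
  qed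
  have "(\<lambda>n. (b - a) * (1 / real (n + 3))) \<longlonglongrightarrow> (b - a) * 0"
    by (intro tendsto_intros LIMSEQ_ignore_initial_segment[OF lim_1_over_n])
  then have r0: "r \<longlonglongrightarrow> 0" by (simp add: r_def[abs_def] add_ac)
  have lim: "(\<lambda>n. integral {a + r n..b - r n} f) \<longlonglongrightarrow> integral {a..b} f" if f: "continuous_on UNIV f" for f :: "real \<Rightarrow> real"
  proof -
    have fi: "f integrable_on {c..d}" for c d using f by (intro integrable_continuous_real) (auto intro: continuous_on_subset)
    define \<Phi> where "\<Phi> x = integral {a..x} f" for x
    have \<Phi>c: "continuous_on {a..b} \<Phi>" unfolding \<Phi>_def[abs_def] by (intro indefinite_integral_continuous_1 fi)
    have eq: "integral {a + r n..b - r n} f = \<Phi> (b - r n) - \<Phi> (a + r n)" for n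
      using Henstock_Kurzweil_Integration.integral_combine[of a "a + r n" "b - r n" f] r[of n] fi by (simp add: \<Phi>_def)
    have mem: "b - r n \<in> {a..b}" "a + r n \<in> {a..b}" for n using r[of n] by auto
    have "(\<lambda>n. \<Phi> (b - r n)) \<longlonglongrightarrow> \<Phi> (b - 0)"
      by (rule continuous_on_tendsto_compose[OF \<Phi>c]) (use mem ab in \<open>auto intro!: tendsto_eq_intros r0\<close>)
    moreover have "(\<lambda>n. \<Phi> (a + r n)) \<longlonglongrightarrow> \<Phi> (a + 0)"
      by (rule continuous_on_tendsto_compose[OF \<Phi>c]) (use mem ab in \<open>auto intro!: tendsto_eq_intros r0\<close>)
    ultimately have "(\<lambda>n. \<Phi> (b - r n) - \<Phi> (a + r n)) \<longlonglongrightarrow> \<Phi> (b - 0) - \<Phi> (a + 0)" by (rule tendsto_diff)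
    then show ?thesis unfolding eq by (simp add: \<Phi>_def)
  qed
  let ?J = "\<lambda>n f. integral {a + r n..b - r n} f"
  have ineq: "?J n p * ?J n (\<lambda>x. p x * (v x)\<^sup>2) - (?J n (\<lambda>x. p x * v x))\<^sup>2 \<le> ((b - a) / pi)\<^sup>2 * (?J n p * ?J n (\<lambda>x. p x * (v' x)\<^sup>2))" for n
    using r[of n] by (intro weighted_poincare_interval[OF _ _ _ p _ _ v v'c] pos logconc) auto
  have l1: "(\<lambda>n. ?J n p * ?J n (\<lambda>x. p x * (v x)\<^sup>2) - (?J n (\<lambda>x. p x * v x))\<^sup>2) \<longlonglongrightarrow>
      integral {a..b} p * integral {a..b} (\<lambda>x. p x * (v x)\<^sup>2) - (integral {a..b} (\<lambda>x. p x * v x))\<^sup>2"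
    by (intro tendsto_intros lim continuous_intros pc vc)
  have l2: "(\<lambda>n. ((b - a) / pi)\<^sup>2 * (?J n p * ?J n (\<lambda>x. p x * (v' x)\<^sup>2))) \<longlonglongrightarrow>
      ((b - a) / pi)\<^sup>2 * (integral {a..b} p * integral {a..b} (\<lambda>x. p x * (v' x)\<^sup>2))"
    by (intro tendsto_intros lim continuous_intros pc v'c')
  show ?thesis by (rule LIMSEQ_le[OF l1 l2]) (use ineq in auto)
qed

section \<open>The Poincare inequality for projections of convex sets\<close>

text \<open>The third power is twice continuously differentiable across the cut-off, as required of
  the weight in the one-dimensional inequality. The kernel is left unnormalized; its mass is divided
  out in the limit.\<close>

definition bump :: "real \<Rightarrow> real \<Rightarrow> real" where
  "bump \<eta> t = (max 0 (\<eta>\<^sup>2 - t\<^sup>2)) ^ 3"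

definition bump' :: "real \<Rightarrow> real \<Rightarrow> real" where
  "bump' \<eta> t = - 6 * t * (max 0 (\<eta>\<^sup>2 - t\<^sup>2))\<^sup>2"

definition bump'' :: "real \<Rightarrow> real \<Rightarrow> real" where
  "bump'' \<eta> t = - 6 * (max 0 (\<eta>\<^sup>2 - t\<^sup>2))\<^sup>2 + 24 * t\<^sup>2 * max 0 (\<eta>\<^sup>2 - t\<^sup>2)"

lemma bump_has_derivative: "(bump \<eta> has_real_derivative bump' \<eta> t) (at t)"
proof -
  have eq: "(\<lambda>s::real. (max 0 s) ^ 3) = (\<lambda>s. s * (max 0 s)\<^sup>2)"
    by (auto simp: fun_eq_iff max_def power2_eq_square power3_eq_cube)
  have "((\<lambda>s. (max 0 s) ^ 3) has_real_derivative 3 * (max 0 s)\<^sup>2) (at s)" for s :: real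
    unfolding eq by (rule DERIV_cong[OF DERIV_mult[OF DERIV_ident power2_positive_part_derivative]])
      (auto simp: max_def power2_eq_square)
  moreover have "((\<lambda>t. \<eta>\<^sup>2 - t\<^sup>2) has_real_derivative - 2 * t) (at t)"
    by (auto intro!: derivative_eq_intros)
  ultimately have "((\<lambda>t. (max 0 (\<eta>\<^sup>2 - t\<^sup>2)) ^ 3) has_real_derivative 3 * (max 0 (\<eta>\<^sup>2 - t\<^sup>2))\<^sup>2 * (- 2 * t)) (at t)"
    by (rule DERIV_chain2[where f="\<lambda>s. (max 0 s) ^ 3" and g="\<lambda>t. \<eta>\<^sup>2 - t\<^sup>2"])
  then show ?thesis unfolding bump_def[abs_def] by (rule DERIV_cong) (simp add: bump'_def)
qed

lemma bump'_has_derivative: "(bump' \<eta> has_real_derivative bump'' \<eta> t) (at t)"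
proof -
  have "((\<lambda>t. \<eta>\<^sup>2 - t\<^sup>2) has_real_derivative - 2 * t) (at t)"
    by (auto intro!: derivative_eq_intros)
  with power2_positive_part_derivative
  have 1: "((\<lambda>t. (max 0 (\<eta>\<^sup>2 - t\<^sup>2))\<^sup>2) has_real_derivative 2 * max 0 (\<eta>\<^sup>2 - t\<^sup>2) * (- 2 * t)) (at t)"
    by (rule DERIV_chain2[where f="\<lambda>s. (max 0 s)\<^sup>2" and g="\<lambda>t. \<eta>\<^sup>2 - t\<^sup>2"])
  have "((\<lambda>t. - 6 * t) has_real_derivative - 6) (at t)"
    by (auto intro!: derivative_eq_intros)
  from DERIV_mult[OF this 1] show ?thesis unfolding bump'_def[abs_def]
    by (rule DERIV_cong) (simp add: bump''_def power2_eq_square)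
qed

lemma continuous_on_bump: "continuous_on S (bump \<eta>)" "continuous_on S (bump' \<eta>)" "continuous_on S (bump'' \<eta>)"
  unfolding bump_def[abs_def] bump'_def[abs_def] bump''_def[abs_def] by (intro continuous_intros)+

lemma bump_nonneg: "0 \<le> bump \<eta> t" by (simp add: bump_def)

lemma bump_eq_0:
  assumes "0 \<le> \<eta>" "\<eta> \<le> \<bar>t\<bar>"
  shows "bump \<eta> t = 0" "bump' \<eta> t = 0" "bump'' \<eta> t = 0"
proof -
  have "\<eta>\<^sup>2 \<le> t\<^sup>2" using assms by (simp add: abs_le_square_iff[symmetric])
  then have "max 0 (\<eta>\<^sup>2 - t\<^sup>2) = 0" by simp
  then show "bump \<eta> t = 0" "bump' \<eta> t = 0" "bump'' \<eta> t = 0"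
    unfolding bump_def bump'_def bump''_def by simp_all
qed

lemma bump_pos: "\<bar>t\<bar> < \<eta> \<Longrightarrow> 0 < bump \<eta> t"
proof -
  assume "\<bar>t\<bar> < \<eta>"
  then have "t\<^sup>2 < \<eta>\<^sup>2" using power_strict_mono[of "\<bar>t\<bar>" \<eta> 2] by simp
  then show ?thesis by (simp add: bump_def)
qed

lemma bump_bounded:
  assumes "0 \<le> \<eta>"
  shows "\<exists>C. \<forall>t. \<bar>bump \<eta> t\<bar> \<le> C \<and> \<bar>bump' \<eta> t\<bar> \<le> C \<and> \<bar>bump'' \<eta> t\<bar> \<le> C"
proof -
  have *: "\<exists>C. \<forall>t. \<bar>f t\<bar> \<le> C" if f: "continuous_on {- \<eta>..\<eta>} f" "\<And>t. \<eta> \<le> \<bar>t\<bar> \<Longrightarrow> f t = 0" for f :: "real \<Rightarrow> real"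
  proof -
    have "bounded (f ` {- \<eta>..\<eta>})" using f(1) by (intro compact_imp_bounded compact_continuous_image) auto
    then obtain C where C: "\<forall>t\<in>{- \<eta>..\<eta>}. \<bar>f t\<bar> \<le> C" by (auto simp: bounded_iff)
    have "\<bar>f t\<bar> \<le> max 0 C" for t
    proof (cases "\<eta> \<le> \<bar>t\<bar>")
      case False
      then have "t \<in> {- \<eta>..\<eta>}" by auto
      then show ?thesis using C by (simp add: le_max_iff_disj)
    qed (simp add: f(2))
    then show ?thesis by blast
  qed
  obtain C1 C2 C3 where C: "\<And>t. \<bar>bump \<eta> t\<bar> \<le> C1" "\<And>t. \<bar>bump' \<eta> t\<bar> \<le> C2" "\<And>t. \<bar>bump'' \<eta> t\<bar> \<le> C3"
    using *[OF continuous_on_bump(1)] *[OF continuous_on_bump(2)] *[OF continuous_on_bump(3)] bump_eq_0[OF assms] by metis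
  show ?thesis
    by (rule exI[of _ "max C1 (max C2 C3)"]) (use C in \<open>auto simp: le_max_iff_disj\<close>)
qed

section \<open>Smoothed marginals of convex sets\<close>

lemma integrable_indicator_bounded:
  fixes f :: "'a::euclidean_space \<Rightarrow> real"
  assumes W: "W \<in> sets borel" "bounded W" and f: "f \<in> borel_measurable borel" "\<And>x. x \<in> W \<Longrightarrow> \<bar>f x\<bar> \<le> C"
  shows "integrable lborel (\<lambda>x. indicator W x * f x)"
proof (rule Bochner_Integration.integrable_bound)
  have [measurable]: "W \<in> sets borel" "f \<in> borel_measurable borel" using W f by auto
  show "integrable lborel (\<lambda>x. C * indicator W x)"
    using fmeasurable_bounded[OF W] by (intro integrable_mult_right integrable_real_indicator) (auto simp: fmeasurable_def)
  show "(\<lambda>x. indicator W x * f x) \<in> borel_measurable lborel" by measurable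
  show "AE x in lborel. norm (indicator W x * f x) \<le> norm (C * indicator W x)"
    using f(2) by (intro AE_I2) (fastforce simp: indicator_def)
qed

lemma has_real_derivative_projected_integral:
  fixes f f' :: "real \<Rightarrow> real" and W :: "'a::euclidean_space set"
  assumes W: "W \<in> sets borel" "bounded W"
    and f: "\<And>t. (f has_real_derivative f' t) (at t)" "\<And>t. \<bar>f t\<bar> \<le> C" "\<And>t. \<bar>f' t\<bar> \<le> C" "continuous_on UNIV f'"
  shows "((\<lambda>s. LINT x|lborel. indicator W x * f (s - x \<bullet> e)) has_real_derivative (LINT x|lborel. indicator W x * f' (s - x \<bullet> e))) (at s)"
proof (rule has_real_derivative_integral[where r=1 and w="\<lambda>x. indicator W x * C"])
  have "continuous_on UNIV f" using f(1) by (auto intro!: continuous_at_imp_continuous_on intro: DERIV_isCont)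
  then have [measurable]: "f \<in> borel_measurable borel" "f' \<in> borel_measurable borel" "W \<in> sets borel"
    using f(4) W by (auto intro: borel_measurable_continuous_onI)
  have "((\<lambda>s. f (s - x \<bullet> e)) has_real_derivative f' (s - x \<bullet> e)) (at s)" for s x
    using DERIV_shift[of f "f' (s - x \<bullet> e)" s "- (x \<bullet> e)"] f(1) by simp
  then show "((\<lambda>s. indicator W x * f (s - x \<bullet> e)) has_real_derivative indicator W x * f' (s - x \<bullet> e)) (at s)" for s x
    by (rule DERIV_cmult)
  show "integrable lborel (\<lambda>x. indicator W x * f (s - x \<bullet> e))" for s
    using f(2) by (intro integrable_indicator_bounded W) auto
  show "(\<lambda>x. indicator W x * f' (s - x \<bullet> e)) \<in> borel_measurable lborel" by measurable
  show "\<bar>indicator W x * f' (t - x \<bullet> e)\<bar> \<le> indicator W x * C" for t x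
    using f(3) by (auto simp: indicator_def)
  show "integrable lborel (\<lambda>x. indicator W x * C)"
    by (intro integrable_indicator_bounded[where C="\<bar>C\<bar>"] W) auto
qed simp

text \<open>The one-dimensional marginal of \<open>W\<close> in direction \<open>e\<close>,
  convolved with the kernel. Writing it as an integral over \<open>W\<close> avoids slicing the set
  by hyperplanes.\<close>

definition bump_projection :: "real \<Rightarrow> 'a::euclidean_space \<Rightarrow> 'a set \<Rightarrow> real \<Rightarrow> real" where
  "bump_projection \<eta> e W s = (LINT x|lborel. indicator W x * bump \<eta> (s - x \<bullet> e))"

text \<open>The cube of the concave function \<open>\<eta>\<^sup>2 - t\<^sup>2\<close> makes \<open>bump_projection \<eta> e W s\<close> the volume of a section of a
  convex set with three more dimensions, so that Brunn--Minkowski applies to it.\<close>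

lemma bump_projection_log_concave:
  fixes W :: "'a::euclidean_space set"
  assumes W: "open W" "bounded W" "convex W" and \<eta>: "0 \<le> \<eta>"
  shows "bump_projection \<eta> e W s * bump_projection \<eta> e W t \<le> (bump_projection \<eta> e W ((s + t) / 2))\<^sup>2"
proof -
  define c where "c s x = \<eta>\<^sup>2 - (s - x \<bullet> e)\<^sup>2" for s x
  \<comment> \<open>Over each point of \<open>W\<close> stands an open cube of side
    \<open>c s x\<close> in three further coordinates. Its volume is the cube of the truncated side,
    since it is empty where \<open>c s x\<close> is not positive.\<close>
  define A where "A s = {z :: 'a \<times> real \<times> real \<times> real. fst z \<in> W \<and> (\<forall>i\<in>Basis. 0 < snd z \<bullet> i \<and> snd z \<bullet> i < c s (fst z))}" for s
  have A_eq: "A s = (fst -` W) \<inter> (\<Inter>i\<in>Basis. {z. 0 < snd z \<bullet> i} \<inter> {z. snd z \<bullet> i < c s (fst z)})" for s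
    by (auto simp: A_def)
  have A_open: "open (A s)" for s
    unfolding A_eq c_def using W(1)
    by (intro open_Int open_INT finite_Basis ballI open_Collect_less continuous_intros open_vimage_fst)
  have A_bdd: "bounded (A s)" for s
  proof -
    have "A s \<subseteq> W \<times> cbox 0 (\<Sum>i\<in>Basis. \<eta>\<^sup>2 *\<^sub>R i)"
    proof
      fix z assume z: "z \<in> A s"
      have "snd z \<bullet> i \<le> \<eta>\<^sup>2" if "i \<in> Basis" for i
      proof -
        have "snd z \<bullet> i < \<eta>\<^sup>2 - (s - fst z \<bullet> e)\<^sup>2" using z that by (simp add: A_def c_def)
        then show ?thesis using zero_le_power2[of "s - fst z \<bullet> e"] by linarith
      qed
      then have "snd z \<in> cbox 0 (\<Sum>i\<in>Basis. \<eta>\<^sup>2 *\<^sub>R i)"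
        using z by (simp add: mem_box A_def less_imp_le)
      then show "z \<in> W \<times> cbox 0 (\<Sum>i\<in>Basis. \<eta>\<^sup>2 *\<^sub>R i)" using z by (auto simp: A_def mem_Times_iff)
    qed
    then show ?thesis using W(2) bounded_Times bounded_cbox bounded_subset by blast
  qed
  have A_measure: "measure lborel (A s) = bump_projection \<eta> e W s" for s
  proof -
    have [measurable]: "W \<in> sets borel" using W by auto
    have sect: "emeasure lborel (Pair x -` A s) = ennreal (indicator W x * bump \<eta> (s - x \<bullet> e))" for x
    proof (cases "x \<in> W")
      case True
      have "Pair x -` A s = box 0 (\<Sum>i\<in>Basis. c s x *\<^sub>R i)"
      proof (rule set_eqI)
        fix y show "y \<in> Pair x -` A s \<longleftrightarrow> y \<in> box 0 (\<Sum>i\<in>Basis. c s x *\<^sub>R i)"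
          using True by (simp add: A_def mem_box)
      qed
      moreover have "emeasure lborel (box 0 (\<Sum>i\<in>Basis. c s x *\<^sub>R i :: real \<times> real \<times> real)) = ennreal ((max 0 (c s x)) ^ 3)"
      proof (cases "0 \<le> c s x")
        case True
        then have "emeasure lborel (box 0 (\<Sum>i\<in>Basis. c s x *\<^sub>R i :: real \<times> real \<times> real)) = ennreal (\<Prod>i\<in>(Basis :: (real \<times> real \<times> real) set). c s x)"
          by (subst emeasure_lborel_box_eq) (auto intro!: prod.cong simp: prod_ennreal)
        also have "(\<Prod>i\<in>(Basis :: (real \<times> real \<times> real) set). c s x) = (max 0 (c s x)) ^ 3"
          using True by (simp add: max_def power3_eq_cube)
        finally show ?thesis .
      next
        case False
        have "\<exists>i::real \<times> real \<times> real. i \<in> Basis" using nonempty_Basis by blast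
        with False have "box 0 (\<Sum>i\<in>Basis. c s x *\<^sub>R i :: real \<times> real \<times> real) = {}"
          by (auto simp: box_eq_empty)
        then show ?thesis using False by (simp add: max_def)
      qed
      ultimately show ?thesis using True by (simp add: bump_def c_def)
    next
      case False
      then have "Pair x -` A s = {}" by (auto simp: A_def)
      then show ?thesis using False by simp
    qed
    obtain C where C: "\<And>t. \<bar>bump \<eta> t\<bar> \<le> C" "\<And>t. \<bar>bump' \<eta> t\<bar> \<le> C" "\<And>t. \<bar>bump'' \<eta> t\<bar> \<le> C" using bump_bounded[OF \<eta>] by blast
    have bm[measurable]: "bump \<eta> \<in> borel_measurable borel"
      using continuous_on_bump(1)[of UNIV] by (rule borel_measurable_continuous_onI)
    have int: "integrable lborel (\<lambda>x. indicator W x * bump \<eta> (s - x \<bullet> e))"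
      using C(1) W by (intro integrable_indicator_bounded) auto
    have "emeasure lborel (A s) = (\<integral>\<^sup>+x. emeasure lborel (Pair x -` A s) \<partial>lborel)"
    proof -
      have "A s \<in> sets (lborel \<Otimes>\<^sub>M lborel)" unfolding lborel_prod using A_open[of s] by (simp add: borel_open)
      from lborel.emeasure_pair_measure_alt[OF this] show ?thesis unfolding lborel_prod .
    qed
    also have "\<dots> = ennreal (bump_projection \<eta> e W s)"
      unfolding sect bump_projection_def using int bump_nonneg
      by (intro nn_integral_eq_integral) (auto simp: indicator_def)
    finally show ?thesis
      unfolding measure_def bump_projection_def using bump_nonneg by (simp add: integral_nonneg_AE)
  qed
  \<comment> \<open>\<open>s - x \<bullet> e\<close> is linear in \<open>s\<close> and
    \<open>x\<close> together, so \<open>c\<close> is jointly concave; with the convexity of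
    \<open>W\<close> this puts the midpoints into the body for the middle parameter.\<close>
  have "midpoints (A s) (A t) \<subseteq> A ((s + t) / 2)"
  proof
    fix z assume "z \<in> midpoints (A s) (A t)"
    then obtain z1 z2 where z: "z = (1/2) *\<^sub>R (z1 + z2)" "z1 \<in> A s" "z2 \<in> A t" by (auto simp: midpoints_def)
    have f: "fst z = (1/2) *\<^sub>R fst z1 + (1/2) *\<^sub>R fst z2" by (simp add: z(1) scaleR_add_right)
    have "fst z \<in> W" unfolding f using z W(3) by (intro convexD) (auto simp: A_def)
    moreover have "0 < snd z \<bullet> i \<and> snd z \<bullet> i < c ((s + t) / 2) (fst z)" if i: "i \<in> Basis" for i
    proof -
      have 1: "0 < snd z1 \<bullet> i" "snd z1 \<bullet> i < c s (fst z1)" "0 < snd z2 \<bullet> i" "snd z2 \<bullet> i < c t (fst z2)"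
        using z i by (auto simp: A_def)
      have 2: "snd z \<bullet> i = (snd z1 \<bullet> i + snd z2 \<bullet> i) / 2" by (simp add: z(1) inner_add_left)
      have 3: "(s + t) / 2 - fst z \<bullet> e = ((s - fst z1 \<bullet> e) + (t - fst z2 \<bullet> e)) / 2"
        by (simp add: f inner_add_left)
      have 4: "((q + r) / 2)\<^sup>2 \<le> (q\<^sup>2 + r\<^sup>2) / 2" for q r :: real
        using zero_le_power2[of "q - r"] by (simp add: power2_eq_square field_simps)
      have "(c s (fst z1) + c t (fst z2)) / 2 \<le> c ((s + t) / 2) (fst z)"
        unfolding c_def 3 using 4[of "s - fst z1 \<bullet> e" "t - fst z2 \<bullet> e"] by (simp add: field_simps)
      moreover have "(snd z1 \<bullet> i + snd z2 \<bullet> i) / 2 < (c s (fst z1) + c t (fst z2)) / 2"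
        using 1 by (intro divide_strict_right_mono add_strict_mono) auto
      ultimately show ?thesis unfolding 2 using 1 by (auto intro: less_le_trans add_pos_pos)
    qed
    ultimately show "z \<in> A ((s + t) / 2)" by (simp add: A_def)
  qed
  then have "measure lborel (midpoints (A s) (A t)) \<le> measure lborel (A ((s + t) / 2))"
    using A_open A_bdd by (intro measure_mono_fmeasurable fmeasurable_bounded) (auto intro!: borel_open open_midpoints)
  then have "(measure lborel (midpoints (A s) (A t)))\<^sup>2 \<le> (measure lborel (A ((s + t) / 2)))\<^sup>2"
    by (intro power_mono) auto
  with brunn_minkowski_midpoints[OF A_open[of s] A_bdd[of s] A_open[of t] A_bdd[of t]]
  show ?thesis unfolding A_measure by linarith
qed

text \<open>The even function \<open>h \<mapsto> p (s + h) p (s - h)\<close> has its maximum at \<open>0\<close>.\<close>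

lemma log_concave_second_derivative:
  fixes p p' p'' :: "real \<Rightarrow> real"
  assumes p: "\<And>x. (p has_real_derivative p' x) (at x)" "\<And>x. (p' has_real_derivative p'' x) (at x)"
    and lc: "\<And>s t. p s * p t \<le> (p ((s + t) / 2))\<^sup>2"
  shows "p s * p'' s \<le> (p' s)\<^sup>2"
proof (rule ccontr)
  assume "\<not> p s * p'' s \<le> (p' s)\<^sup>2"
  then have pos: "0 < 2 * (p s * p'' s - (p' s)\<^sup>2)" by simp
  define g where "g h = p (s + h) * p (s - h)" for h
  define g' where "g' h = p' (s + h) * p (s - h) - p (s + h) * p' (s - h)" for h
  have plus: "((\<lambda>h. f (s + h)) has_real_derivative f' (s + h)) (at h)" if "\<And>x. (f has_real_derivative f' x) (at x)" for f f' h
    using DERIV_shift[of f "f' (s + h)" h s] that[of "s + h"] by (simp add: add.commute)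
  have minus: "((\<lambda>h. f (s - h)) has_real_derivative - f' (s - h)) (at h)" if "\<And>x. (f has_real_derivative f' x) (at x)" for f f' h
  proof -
    have "((\<lambda>h. s - h) has_real_derivative - 1) (at h)" by (auto intro!: derivative_eq_intros)
    from DERIV_chain2[where f=f and g="\<lambda>h. s - h", OF that this] show ?thesis by simp
  qed
  have g: "(g has_real_derivative g' h) (at h)" for h
    unfolding g_def[abs_def] g'_def
    by (rule DERIV_cong[OF DERIV_mult[OF plus[OF p(1)] minus[OF p(1)]]]) (simp add: algebra_simps)
  have "(g' has_real_derivative 2 * (p s * p'' s - (p' s)\<^sup>2)) (at 0)"
    unfolding g'_def[abs_def]
    by (rule DERIV_cong[OF DERIV_diff[OF DERIV_mult[OF plus[OF p(2)] minus[OF p(1)]] DERIV_mult[OF plus[OF p(1)] minus[OF p(2)]]]])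
      (simp add: power2_eq_square algebra_simps)
  \<comment> \<open>As \<open>g'\<close> vanishes at 0 and has positive derivative there,
    \<open>g\<close> increases to the right of 0, against the midpoint inequality for
    \<open>s + d / 2\<close> and \<open>s - d / 2\<close>.\<close>
  from DERIV_pos_inc_right[OF this pos] obtain d where d: "d > 0" "\<And>h. 0 < h \<Longrightarrow> h < d \<Longrightarrow> g' 0 < g' (0 + h)" by blast
  have "g' 0 = 0" by (simp add: g'_def)
  with d(2) have g'pos: "g' h > 0" if "0 < h" "h < d" for h using that by force
  obtain z where z: "0 < z" "z < d / 2" "g (d / 2) - g 0 = (d / 2 - 0) * g' z"
    using MVT2[of 0 "d / 2" g g'] d(1) g by auto
  have "(d / 2 - 0) * g' z > 0" using g'pos[of z] z d(1) by simp
  then have "g (d / 2) > g 0" using z(3) by simp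
  moreover have "g (d / 2) \<le> g 0"
    using lc[of "s + d / 2" "s - d / 2"] by (simp add: g_def power2_eq_square)
  ultimately show False by simp
qed

lemma bump_projection_has_derivative:
  fixes W :: "'a::euclidean_space set"
  assumes W: "open W" "bounded W" and \<eta>: "0 \<le> \<eta>"
  shows "(bump_projection \<eta> e W has_real_derivative (LINT x|lborel. indicator W x * bump' \<eta> (s - x \<bullet> e))) (at s)"
    and "((\<lambda>s. LINT x|lborel. indicator W x * bump' \<eta> (s - x \<bullet> e)) has_real_derivative (LINT x|lborel. indicator W x * bump'' \<eta> (s - x \<bullet> e))) (at s)"
proof -
  obtain C where C: "\<And>t. \<bar>bump \<eta> t\<bar> \<le> C" "\<And>t. \<bar>bump' \<eta> t\<bar> \<le> C" "\<And>t. \<bar>bump'' \<eta> t\<bar> \<le> C"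
    using bump_bounded[OF \<eta>] by blast
  show "(bump_projection \<eta> e W has_real_derivative (LINT x|lborel. indicator W x * bump' \<eta> (s - x \<bullet> e))) (at s)"
    unfolding bump_projection_def[abs_def]
    using W by (intro has_real_derivative_projected_integral[OF _ _ bump_has_derivative C(1,2) continuous_on_bump(2)]) auto
  show "((\<lambda>s. LINT x|lborel. indicator W x * bump' \<eta> (s - x \<bullet> e)) has_real_derivative (LINT x|lborel. indicator W x * bump'' \<eta> (s - x \<bullet> e))) (at s)"
    using W by (intro has_real_derivative_projected_integral[OF _ _ bump'_has_derivative C(2,3) continuous_on_bump(3)]) auto
qed

lemma bump_projection_pos:
  fixes W :: "'a::euclidean_space set"
  assumes W: "open W" "bounded W" and \<eta>: "0 \<le> \<eta>" and x: "x \<in> W" "\<bar>s - x \<bullet> e\<bar> < \<eta>"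
  shows "0 < bump_projection \<eta> e W s"
proof -
  let ?f = "\<lambda>x. indicator W x * bump \<eta> (s - x \<bullet> e)"
  obtain C where C: "\<And>t. \<bar>bump \<eta> t\<bar> \<le> C" "\<And>t. \<bar>bump' \<eta> t\<bar> \<le> C" "\<And>t. \<bar>bump'' \<eta> t\<bar> \<le> C" using bump_bounded[OF \<eta>] by blast
  have [measurable]: "bump \<eta> \<in> borel_measurable borel"
    using continuous_on_bump(1)[of UNIV] by (rule borel_measurable_continuous_onI)
  have int: "integrable lborel ?f" using C(1) W by (intro integrable_indicator_bounded) auto
  have nn: "0 \<le> ?f y" for y by (simp add: bump_nonneg)
  have "(LINT x|lborel. ?f x) \<noteq> 0"
  proof
    assume "(LINT x|lborel. ?f x) = 0"
    then have "AE x in lborel. ?f x = 0" using integral_nonneg_eq_0_iff_AE[OF int] nn by auto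
    moreover define V where "V = W \<inter> {x. \<bar>s - x \<bullet> e\<bar> < \<eta>}"
    ultimately have "AE x in lborel. x \<notin> V"
      by (elim AE_mp, intro AE_I2) (auto simp: V_def dest: bump_pos)
    moreover have V: "open V" "x \<in> V"
      unfolding V_def using W x by (auto intro!: open_Int open_Collect_less continuous_intros)
    ultimately have "V \<in> null_sets lborel" by (simp add: AE_iff_null_sets borel_open)
    then have "negligible V" using V by (simp add: negligible_iff_null_sets null_sets_completion_iff borel_open)
    then show False using open_not_negligible V by auto
  qed
  moreover have "0 \<le> (LINT x|lborel. ?f x)" using nn by (simp add: integral_nonneg_AE)
  ultimately show ?thesis by (simp add: bump_projection_def)
qed

text \<open>Smoothing widens the range of \<open>x \<bullet> e\<close> over \<open>W\<close> by at
  most \<eta> on each side, hence the length \<open>L + 2 * \<eta>\<close>. Brunn-Minkowski supplies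
  the log-concavity of the weight, and convexity of \<open>W\<close> makes its positivity set an
  interval.\<close>

lemma bump_projection_poincare:
  fixes W :: "'a::euclidean_space set" and v v' :: "real \<Rightarrow> real"
  assumes W: "open W" "bounded W" "convex W" "W \<noteq> {}" and \<eta>: "0 < \<eta>"
    and L: "\<And>x y. x \<in> W \<Longrightarrow> y \<in> W \<Longrightarrow> x \<bullet> e - y \<bullet> e \<le> L"
    and v: "\<And>x. (v has_real_derivative v' x) (at x)" and v'c: "continuous_on UNIV v'"
  defines "p \<equiv> bump_projection \<eta> e W"
  shows "(LINT s|lborel. p s) * (LINT s|lborel. p s * (v s)\<^sup>2) - (LINT s|lborel. p s * v s)\<^sup>2
    \<le> ((L + 2 * \<eta>) / pi)\<^sup>2 * ((LINT s|lborel. p s) * (LINT s|lborel. p s * (v' s)\<^sup>2))"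
proof -
  have \<eta>0: "0 \<le> \<eta>" using \<eta> by simp
  note der = bump_projection_has_derivative[OF W(1,2) \<eta>0, of e, folded p_def]
  have pc: "continuous_on S p" for S using der(1) by (auto intro!: continuous_at_imp_continuous_on intro: DERIV_isCont)
  have vc: "continuous_on S v" for S using v by (auto intro!: continuous_at_imp_continuous_on intro: DERIV_isCont)
  have v'c': "continuous_on S v'" for S using continuous_on_subset[OF v'c subset_UNIV] .
  define S where "S = {s. \<exists>x\<in>W. \<bar>s - x \<bullet> e\<bar> < \<eta>}"
  have ppos: "p s > 0" if "s \<in> S" for s
    using that bump_projection_pos[OF W(1,2) \<eta>0] by (auto simp: S_def p_def)
  have pzero: "p s = 0" if "s \<notin> S" for s
  proof -
    have eq: "indicator W x * bump \<eta> (s - x \<bullet> e) = 0" for x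
      using that bump_eq_0(1)[OF \<eta>0, of "s - x \<bullet> e"] by (cases "x \<in> W") (auto simp: S_def not_less)
    show ?thesis unfolding p_def bump_projection_def eq by simp
  qed
  obtain x0 where x0: "x0 \<in> W" using W(4) by blast
  \<comment> \<open>Two distinct members, so that the infimum and supremum of \<open>S\<close> bound
    a nondegenerate interval.\<close>
  have Smem: "x0 \<bullet> e \<in> S" "x0 \<bullet> e + \<eta> / 2 \<in> S" using x0 \<eta> by (auto simp: S_def intro!: bexI[of _ x0])
  have Sdiff: "t - s \<le> L + 2 * \<eta>" if st: "s \<in> S" "t \<in> S" for s t
  proof -
    from st obtain x y where "x \<in> W" "y \<in> W" "\<bar>s - x \<bullet> e\<bar> < \<eta>" "\<bar>t - y \<bullet> e\<bar> < \<eta>" by (auto simp: S_def)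
    then show ?thesis using L[of y x] by linarith
  qed
  have bdd: "bdd_above S" "bdd_below S"
    using Sdiff[OF Smem(1)] Sdiff[OF _ Smem(1)] unfolding bdd_above_def bdd_below_def
    by (metis add.commute diff_le_eq, metis add.commute diff_le_eq le_diff_eq)
  define a where "a = Inf S"
  define b where "b = Sup S"
  have S_sub: "a \<le> s" "s \<le> b" if "s \<in> S" for s
    using that bdd by (auto simp: a_def b_def intro: cInf_lower cSup_upper)
  have "a < b" using S_sub(1)[OF Smem(1)] S_sub(2)[OF Smem(2)] \<eta> by linarith
  have ba: "b - a \<le> L + 2 * \<eta>"
  proof -
    have "b \<le> s + (L + 2 * \<eta>)" if s: "s \<in> S" for s
      unfolding b_def using Smem Sdiff[OF s] by (intro cSup_least) (auto simp: algebra_simps)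
    then have "b - (L + 2 * \<eta>) \<le> a" unfolding a_def using Smem by (intro cInf_greatest) (auto simp: algebra_simps)
    then show ?thesis by simp
  qed
  have S_interval: "s \<in> S" if s: "a < s" "s < b" for s
  proof -
    from s(1) obtain r where r: "r \<in> S" "r < s" unfolding a_def using cInf_lessD[of S s] Smem by auto
    from s(2) obtain t where t: "t \<in> S" "s < t" unfolding b_def using less_cSupD[of S s] Smem by auto
    obtain x y where xy: "x \<in> W" "y \<in> W" "\<bar>r - x \<bullet> e\<bar> < \<eta>" "\<bar>t - y \<bullet> e\<bar> < \<eta>" using r(1) t(1) by (auto simp: S_def)
    \<comment> \<open>The relative position of \<open>s\<close> between \<open>r\<close> and
      \<open>t\<close>. At the same combination of \<open>x\<close> and \<open>y\<close> the
      deviation is the combination of two deviations below \<eta>, hence below \<eta>.\<close>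
    define q where "q = (s - r) / (t - r)"
    have q: "0 \<le> q" "q \<le> 1" using r t by (auto simp: q_def)
    have "q * (t - r) = s - r" using r t by (simp add: q_def)
    then have sq: "s = (1 - q) * r + q * t" by (simp add: algebra_simps)
    have "s - ((1 - q) *\<^sub>R x + q *\<^sub>R y) \<bullet> e = (1 - q) * (r - x \<bullet> e) + q * (t - y \<bullet> e)"
      unfolding sq by (simp add: inner_add_left algebra_simps)
    also have "\<bar>\<dots>\<bar> \<le> (1 - q) * \<bar>r - x \<bullet> e\<bar> + q * \<bar>t - y \<bullet> e\<bar>"
      using q by (intro order_trans[OF abs_triangle_ineq]) (simp add: abs_mult)
    also have "\<dots> \<le> (1 - q) * max \<bar>r - x \<bullet> e\<bar> \<bar>t - y \<bullet> e\<bar> + q * max \<bar>r - x \<bullet> e\<bar> \<bar>t - y \<bullet> e\<bar>"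
      using q by (intro add_mono mult_left_mono) auto
    also have "\<dots> = max \<bar>r - x \<bullet> e\<bar> \<bar>t - y \<bullet> e\<bar>" by (simp add: algebra_simps)
    also have "\<dots> < \<eta>" using xy by simp
    finally have "\<bar>s - ((1 - q) *\<^sub>R x + q *\<^sub>R y) \<bullet> e\<bar> < \<eta>" .
    moreover have "(1 - q) *\<^sub>R x + q *\<^sub>R y \<in> W" using q xy W(3) by (intro convexD) auto
    ultimately show ?thesis by (auto simp: S_def)
  qed
  have p_nonneg: "p s \<ge> 0" for s using ppos[of s] pzero[of s] by (cases "s \<in> S") (auto intro: less_imp_le)
  have p_off: "p s = 0" if "s \<notin> {a..b}" for s using that S_sub pzero[of s] by auto
  have transfer: "(LINT s|lborel. p s * f s) = integral {a..b} (\<lambda>s. p s * f s)" if f: "continuous_on UNIV f" for f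
  proof -
    have "set_integrable lborel {a..b} (\<lambda>s. p s * f s)"
      by (intro borel_integrable_atLeastAtMost' continuous_intros pc continuous_on_subset[OF f]) auto
    then have "(LINT s:{a..b}|lborel. p s * f s) = integral {a..b} (\<lambda>s. p s * f s)"
      by (rule set_borel_integral_eq_integral)
    moreover have "(LINT s:{a..b}|lborel. p s * f s) = (LINT s|lborel. p s * f s)"
      unfolding set_lebesgue_integral_def
      by (intro Bochner_Integration.integral_cong refl) (use p_off in \<open>auto simp: indicator_def\<close>)
    ultimately show ?thesis by simp
  qed
  have lc: "p s * p t \<le> (p ((s + t) / 2))\<^sup>2" for s t
    unfolding p_def by (rule bump_projection_log_concave[OF W(1-3) \<eta>0])
  have "integral {a..b} p * integral {a..b} (\<lambda>x. p x * (v x)\<^sup>2) - (integral {a..b} (\<lambda>x. p x * v x))\<^sup>2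
    \<le> ((b - a) / pi)\<^sup>2 * (integral {a..b} p * integral {a..b} (\<lambda>x. p x * (v' x)\<^sup>2))"
    by (rule weighted_poincare[OF \<open>a < b\<close> der _ log_concave_second_derivative[OF der lc] v v'c])
      (use ppos S_interval in auto)
  also have "\<dots> \<le> ((L + 2 * \<eta>) / pi)\<^sup>2 * (integral {a..b} p * integral {a..b} (\<lambda>x. p x * (v' x)\<^sup>2))"
  proof (rule mult_right_mono)
    show "((b - a) / pi)\<^sup>2 \<le> ((L + 2 * \<eta>) / pi)\<^sup>2"
      using ba \<open>a < b\<close> by (intro power_mono divide_right_mono) auto
    show "0 \<le> integral {a..b} p * integral {a..b} (\<lambda>x. p x * (v' x)\<^sup>2)"
      using p_nonneg by (intro mult_nonneg_nonneg integral_nonneg integrable_continuous_real continuous_intros pc v'c') auto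
  qed
  finally show ?thesis
    using transfer[of "\<lambda>_. 1"] transfer[of "\<lambda>s. (v s)\<^sup>2"] transfer[of v] transfer[of "\<lambda>s. (v' s)\<^sup>2"]
    by (simp add: continuous_on_power vc v'c')
qed

text \<open>By Fubini the left integral averages over \<open>W\<close> the convolution of the kernel
  with \<open>f\<close>, evaluated at \<open>x \<bullet> e\<close>; at each point this differs from
  \<open>c * f (x \<bullet> e)\<close> by at most \<open>c * \<omega>\<close>.\<close>

lemma bump_projection_integral_error:
  fixes W :: "'a::euclidean_space set" and f :: "real \<Rightarrow> real"
  assumes W: "open W" "bounded W" and \<eta>: "0 < \<eta>" and f: "continuous_on UNIV f"
    and \<omega>: "\<And>x t. x \<in> W \<Longrightarrow> \<bar>t\<bar> \<le> \<eta> \<Longrightarrow> \<bar>f (x \<bullet> e + t) - f (x \<bullet> e)\<bar> \<le> \<omega>"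
  defines "c \<equiv> (LINT t|lborel. bump \<eta> t)"
  shows "\<bar>(LINT s|lborel. bump_projection \<eta> e W s * f s) - c * (LINT x|lborel. indicator W x * f (x \<bullet> e))\<bar> \<le> c * \<omega> * measure lborel W"
proof -
  have \<eta>0: "0 \<le> \<eta>" using \<eta> by simp
  have [measurable]: "bump \<eta> \<in> borel_measurable borel" "f \<in> borel_measurable borel" "W \<in> sets borel"
    using continuous_on_bump(1)[of UNIV] f W by (auto intro: borel_measurable_continuous_onI)
  obtain R where R: "\<And>x. x \<in> W \<Longrightarrow> norm x \<le> R" using W(2) by (auto simp: bounded_iff)
  \<comment> \<open>The values \<open>x \<bullet> e\<close> stay \<eta> away from the ends of the
    interval from -r to r, so one compact product carries the whole double integral.\<close>
  define r where "r = \<bar>R\<bar> * norm e + \<eta>"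
  have xr: "\<bar>x \<bullet> e\<bar> \<le> r - \<eta>" if "x \<in> W" for x
  proof -
    have "\<bar>x \<bullet> e\<bar> \<le> norm x * norm e" by (rule Cauchy_Schwarz_ineq2)
    also have "\<dots> \<le> \<bar>R\<bar> * norm e" using R[OF that] by (intro mult_right_mono) auto
    finally show ?thesis by (simp add: r_def)
  qed
  define F where "F x s = indicator W x * bump \<eta> (s - x \<bullet> e) * f s" for x s
  have bint: "integrable lborel (bump \<eta>)"
  proof -
    have "integrable lborel (\<lambda>t. indicator {- \<eta>..\<eta>} t *\<^sub>R bump \<eta> t)"
      by (intro borel_integrable_compact continuous_on_bump) auto
    moreover have "(\<lambda>t. indicator {- \<eta>..\<eta>} t *\<^sub>R bump \<eta> t) = bump \<eta>"
      using bump_eq_0(1)[OF \<eta>0] by (force simp: indicator_def fun_eq_iff)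
    ultimately show ?thesis by simp
  qed
  have Fint: "integrable (lborel \<Otimes>\<^sub>M lborel) (\<lambda>(x, s). F x s)"
  proof -
    have "integrable lborel (\<lambda>z::'a \<times> real. indicator (cball 0 R \<times> {- r..r}) z *\<^sub>R (bump \<eta> (snd z - fst z \<bullet> e) * f (snd z)))"
      by (intro borel_integrable_compact compact_Times continuous_intros continuous_on_compose2[OF continuous_on_bump(1)[of UNIV]] continuous_on_compose2[OF f])
        auto
    then have "integrable lborel (\<lambda>z::'a \<times> real. F (fst z) (snd z))"
    proof (rule Bochner_Integration.integrable_bound)
      have Feq: "F (fst z) (snd z) = indicator (W \<times> UNIV) z * bump \<eta> (snd z - fst z \<bullet> e) * f (snd z)" for z
        by (cases z) (simp add: F_def indicator_def)
      have "W \<times> UNIV \<in> sets (borel :: ('a \<times> real) measure)" using W by (auto intro!: borel_open open_Times)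
      moreover have "continuous_on UNIV (\<lambda>z::'a \<times> real. bump \<eta> (snd z - fst z \<bullet> e))" "continuous_on UNIV (\<lambda>z::'a \<times> real. f (snd z))"
        by (intro continuous_on_compose2[OF continuous_on_bump(1)[of UNIV]] continuous_on_compose2[OF f] continuous_intros subset_UNIV)+
      ultimately have "(\<lambda>z::'a \<times> real. indicator (W \<times> UNIV) z * bump \<eta> (snd z - fst z \<bullet> e) * f (snd z)) \<in> borel_measurable borel"
        by (intro borel_measurable_times borel_measurable_indicator borel_measurable_continuous_onI)
      then show "(\<lambda>z::'a \<times> real. F (fst z) (snd z)) \<in> borel_measurable lborel" unfolding Feq by simp
      show "AE z in lborel. norm (F (fst z) (snd z)) \<le> norm (indicator (cball 0 R \<times> {- r..r}) z *\<^sub>R (bump \<eta> (snd z - fst z \<bullet> e) * f (snd z)))"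
      proof (rule AE_I2)
        fix z :: "'a \<times> real"
        show "norm (F (fst z) (snd z)) \<le> norm (indicator (cball 0 R \<times> {- r..r}) z *\<^sub>R (bump \<eta> (snd z - fst z \<bullet> e) * f (snd z)))"
        proof (cases "fst z \<in> W \<and> \<bar>snd z - fst z \<bullet> e\<bar> < \<eta>")
          case True
          then have "z \<in> cball 0 R \<times> {- r..r}" using xr[of "fst z"] R[of "fst z"] by (auto simp: mem_Times_iff)
          then show ?thesis using True by (simp add: F_def)
        next
          case False
          then have "F (fst z) (snd z) = 0" using bump_eq_0(1)[OF \<eta>0] by (auto simp: F_def not_less)
          then show ?thesis by simp
        qed
      qed
    qed
    then show ?thesis by (simp add: lborel_prod split_def)
  qed
  have "(LINT s|lborel. bump_projection \<eta> e W s * f s) = (LINT s|lborel. LINT x|lborel. F x s)"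
    by (simp add: bump_projection_def F_def)
  also have "\<dots> = (LINT x|lborel. LINT s|lborel. F x s)"
    by (rule lborel_pair.Fubini_integral[OF Fint])
  finally have Fub: "(LINT s|lborel. bump_projection \<eta> e W s * f s) = (LINT x|lborel. LINT s|lborel. F x s)" .
  have inner_int: "integrable lborel (\<lambda>x. LINT s|lborel. F x s)"
    using lborel_pair.integrable_fst'[OF Fint] by simp
  have fbound: "\<exists>C. \<forall>x\<in>W. \<bar>f (x \<bullet> e)\<bar> \<le> C"
  proof -
    have "bounded (f ` {- r..r})" by (intro compact_imp_bounded compact_continuous_image continuous_on_subset[OF f]) auto
    then obtain C where "\<forall>t\<in>{- r..r}. \<bar>f t\<bar> \<le> C" by (auto simp: bounded_iff)
    moreover have "x \<bullet> e \<in> {- r..r}" if "x \<in> W" for x using xr[OF that] \<eta> by auto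
    ultimately show ?thesis by blast
  qed
  then obtain C where C: "\<And>x. x \<in> W \<Longrightarrow> \<bar>f (x \<bullet> e)\<bar> \<le> C" by blast
  have Jint: "integrable lborel (\<lambda>x. indicator W x * f (x \<bullet> e))"
    using W C by (intro integrable_indicator_bounded[where C=C]) auto
  have pointwise: "\<bar>(LINT s|lborel. F x s) - c * (indicator W x * f (x \<bullet> e))\<bar> \<le> c * \<omega> * indicator W x" for x
  proof (cases "x \<in> W")
    case True
    have "(LINT s|lborel. F x s) = (LINT t|lborel. bump \<eta> t * f (x \<bullet> e + t))"
      using integral_lborel_translate[of "\<lambda>s. bump \<eta> (s - x \<bullet> e) * f s" "x \<bullet> e"] True by (simp add: F_def)
    moreover have i1: "integrable lborel (\<lambda>t. bump \<eta> t * f (x \<bullet> e + t))"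
    proof -
      have "integrable lborel (\<lambda>t. indicator {- \<eta>..\<eta>} t *\<^sub>R (bump \<eta> t * f (x \<bullet> e + t)))"
        by (intro borel_integrable_compact continuous_intros continuous_on_bump continuous_on_compose2[OF f]) auto
      moreover have "(\<lambda>t. indicator {- \<eta>..\<eta>} t *\<^sub>R (bump \<eta> t * f (x \<bullet> e + t))) = (\<lambda>t. bump \<eta> t * f (x \<bullet> e + t))"
        using bump_eq_0(1)[OF \<eta>0] by (force simp: indicator_def fun_eq_iff)
      ultimately show ?thesis by simp
    qed
    moreover have i2: "integrable lborel (\<lambda>t. bump \<eta> t * f (x \<bullet> e))" using bint by simp
    ultimately have "(LINT s|lborel. F x s) - c * f (x \<bullet> e) = (LINT t|lborel. bump \<eta> t * (f (x \<bullet> e + t) - f (x \<bullet> e)))"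
      by (simp add: c_def right_diff_distrib)
    also have "\<bar>\<dots>\<bar> \<le> (LINT t|lborel. bump \<eta> t * \<omega>)"
    proof (rule integral_abs_bound[THEN order_trans], rule integral_mono)
      show "integrable lborel (\<lambda>t. \<bar>bump \<eta> t * (f (x \<bullet> e + t) - f (x \<bullet> e))\<bar>)"
        using Bochner_Integration.integrable_diff[OF i1 i2] by (simp add: right_diff_distrib)
      show "integrable lborel (\<lambda>t. bump \<eta> t * \<omega>)" using bint by simp
      fix t
      show "\<bar>bump \<eta> t * (f (x \<bullet> e + t) - f (x \<bullet> e))\<bar> \<le> bump \<eta> t * \<omega>"
        using \<omega>[OF True, of t] bump_nonneg[of \<eta> t] bump_eq_0(1)[OF \<eta>0, of t]
        by (cases "\<bar>t\<bar> \<le> \<eta>") (auto simp: abs_mult intro!: mult_left_mono)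
    qed
    finally show ?thesis using True by (simp add: c_def)
  qed (simp add: F_def)
  have Wint: "integrable lborel (\<lambda>x. c * \<omega> * indicator W x)"
    using fmeasurable_bounded[of W] W by (intro integrable_mult_right integrable_real_indicator) (auto simp: fmeasurable_def)
  have "(LINT s|lborel. bump_projection \<eta> e W s * f s) - c * (LINT x|lborel. indicator W x * f (x \<bullet> e)) =
      (LINT x|lborel. (LINT s|lborel. F x s) - c * (indicator W x * f (x \<bullet> e)))"
    unfolding Fub using inner_int Jint by simp
  also have "\<bar>\<dots>\<bar> \<le> (LINT x|lborel. c * \<omega> * indicator W x)"
    by (rule integral_abs_bound[THEN order_trans], rule integral_mono)
      (use inner_int Jint Wint pointwise in auto)
  also have "\<dots> = c * \<omega> * measure lborel W" by simp
  finally show ?thesis .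
qed

text \<open>The width of the smoothing tends to 0. Both sides have degree two in the weight, so
  dividing by the square of the mass \<open>c n\<close> keeps the inequality and makes each integral
  converge to the unsmoothed one.\<close>

lemma projection_poincare:
  fixes W :: "'a::euclidean_space set" and v v' :: "real \<Rightarrow> real"
  assumes W: "open W" "bounded W" "convex W" "W \<noteq> {}"
    and L: "\<And>x y. x \<in> W \<Longrightarrow> y \<in> W \<Longrightarrow> x \<bullet> e - y \<bullet> e \<le> L"
    and v: "\<And>x. (v has_real_derivative v' x) (at x)" and v'c: "continuous_on UNIV v'"
  shows "measure lborel W * (LINT x|lborel. indicator W x * (v (x \<bullet> e))\<^sup>2) - (LINT x|lborel. indicator W x * v (x \<bullet> e))\<^sup>2
    \<le> (L / pi)\<^sup>2 * (measure lborel W * (LINT x|lborel. indicator W x * (v' (x \<bullet> e))\<^sup>2))"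
proof -
  have vc: "continuous_on S v" for S using v by (auto intro!: continuous_at_imp_continuous_on intro: DERIV_isCont)
  define \<eta> where "\<eta> n = 1 / real (Suc n)" for n
  have \<eta>: "0 < \<eta> n" "\<eta> n \<le> 1" for n by (auto simp: \<eta>_def)
  have \<eta>0: "\<eta> \<longlonglongrightarrow> 0" unfolding \<eta>_def[abs_def] using LIMSEQ_inverse_real_of_nat by (simp add: inverse_eq_divide)
  define c where "c n = (LINT t|lborel. bump (\<eta> n) t)" for n
  define I where "I n f = (LINT s|lborel. bump_projection (\<eta> n) e W s * f s)" for n f
  define J where "J f = (LINT x|lborel. indicator W x * f (x \<bullet> e))" for f :: "real \<Rightarrow> real"
  \<comment> \<open>Positivity of the mass is borrowed from the smoothed marginal of the interval
    from -1 to 1, taken at 0.\<close>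
  have cpos: "c n > 0" for n
  proof -
    have "bump_projection (\<eta> n) (1::real) (ball 0 1) 0 > 0"
      using \<eta>[of n] by (intro bump_projection_pos[where x=0]) auto
    also have "bump_projection (\<eta> n) (1::real) (ball 0 1) 0 \<le> c n"
      unfolding bump_projection_def c_def
    proof (rule integral_mono)
      have bm[measurable]: "bump (\<eta> n) \<in> borel_measurable borel"
        using continuous_on_bump(1)[of UNIV] by (rule borel_measurable_continuous_onI)
      obtain C where C: "\<And>t. \<bar>bump (\<eta> n) t\<bar> \<le> C" using bump_bounded[of "\<eta> n"] \<eta>[of n] by (meson less_imp_le)
      show "integrable lborel (\<lambda>x. indicator (ball 0 1) x * bump (\<eta> n) (0 - x \<bullet> 1))"
        using C by (intro integrable_indicator_bounded) auto
      have "integrable lborel (\<lambda>x. indicator {-1..1} x * bump (\<eta> n) x)"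
        using C by (intro integrable_indicator_bounded) auto
      moreover have "(\<lambda>x. indicator {-1..1} x * bump (\<eta> n) x) = bump (\<eta> n)"
        using \<eta>[of n] bump_eq_0(1)[of "\<eta> n"] by (force simp: indicator_def fun_eq_iff)
      ultimately show "integrable lborel (bump (\<eta> n))" by simp
      have "bump (\<eta> n) (- x) = bump (\<eta> n) x" for x by (simp add: bump_def)
      then show "indicator (ball 0 1) x * bump (\<eta> n) (0 - x \<bullet> 1) \<le> bump (\<eta> n) x" for x
        using bump_nonneg[of "\<eta> n" x] by (auto simp: indicator_def)
    qed
    finally show ?thesis .
  qed
  obtain R where R: "\<And>x. x \<in> W \<Longrightarrow> norm x \<le> R" using W(2) by (auto simp: bounded_iff)
  define r where "r = \<bar>R\<bar> * norm e"
  have xr: "\<bar>x \<bullet> e\<bar> \<le> r" if "x \<in> W" for x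
  proof -
    have "\<bar>x \<bullet> e\<bar> \<le> norm x * norm e" by (rule Cauchy_Schwarz_ineq2)
    also have "\<dots> \<le> \<bar>R\<bar> * norm e" using R[OF that] by (intro mult_right_mono) auto
    finally show ?thesis by (simp add: r_def)
  qed
  have lim: "(\<lambda>n. I n f / c n) \<longlonglongrightarrow> J f" if f: "continuous_on UNIV f" for f
  proof (rule LIMSEQ_I)
    fix \<epsilon> :: real assume \<epsilon>: "\<epsilon> > 0"
    obtain m where m: "m = measure lborel W" "0 \<le> m" by simp
    define \<omega> where "\<omega> = \<epsilon> / (2 * (m + 1))"
    have \<omega>: "\<omega> > 0" "\<omega> * measure lborel W < \<epsilon>"
    proof -
      show "\<omega> > 0" using \<epsilon> m(2) by (simp add: \<omega>_def)
      have "\<omega> * m < \<omega> * (2 * (m + 1))"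
        using \<open>\<omega> > 0\<close> m(2) by (intro mult_strict_left_mono) auto
      also have "\<dots> = \<epsilon>" using m(2) by (simp add: \<omega>_def)
      finally show "\<omega> * measure lborel W < \<epsilon>" using m(1) by simp
    qed
    \<comment> \<open>The interval is enlarged by 1 because the shifts are at most
      \<open>\<eta> n \<le> 1\<close>.\<close>
    have "uniformly_continuous_on {- (r + 1)..r + 1} f"
      by (intro compact_uniformly_continuous continuous_on_subset[OF f]) auto
    then obtain d where d: "d > 0" "\<And>s t. s \<in> {- (r + 1)..r + 1} \<Longrightarrow> t \<in> {- (r + 1)..r + 1} \<Longrightarrow> dist t s < d \<Longrightarrow> dist (f t) (f s) < \<omega>"
      using \<omega>(1) unfolding uniformly_continuous_on_def by metis
    obtain N where N: "\<And>n. n \<ge> N \<Longrightarrow> \<eta> n < d"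
      using LIMSEQ_D[OF \<eta>0 d(1)] \<eta> by (auto simp: abs_of_pos)
    show "\<exists>N. \<forall>n\<ge>N. norm (I n f / c n - J f) < \<epsilon>"
    proof (intro exI allI impI)
      fix n assume n: "N \<le> n"
      have "\<bar>f (x \<bullet> e + t) - f (x \<bullet> e)\<bar> \<le> \<omega>" if "x \<in> W" "\<bar>t\<bar> \<le> \<eta> n" for x t
        using d(2)[of "x \<bullet> e" "x \<bullet> e + t"] xr[OF that(1)] that(2) \<eta>[of n] N[OF n]
        by (auto simp: dist_real_def abs_le_iff abs_less_iff)
      then have "\<bar>I n f - c n * J f\<bar> \<le> c n * \<omega> * measure lborel W"
        unfolding I_def J_def c_def by (intro bump_projection_integral_error W \<eta> f) auto
      moreover have "I n f - c n * J f = c n * (I n f / c n - J f)" using cpos[of n] by (simp add: field_simps)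
      ultimately have "c n * \<bar>I n f / c n - J f\<bar> \<le> c n * (\<omega> * measure lborel W)"
        using cpos[of n] by (simp add: abs_mult mult.assoc)
      then have "\<bar>I n f / c n - J f\<bar> \<le> \<omega> * measure lborel W" using cpos[of n] by simp
      then show "norm (I n f / c n - J f) < \<epsilon>" using \<omega>(2) by simp
    qed
  qed
  have ineq: "(I n (\<lambda>_. 1) / c n) * (I n (\<lambda>s. (v s)\<^sup>2) / c n) - (I n v / c n)\<^sup>2 \<le>
      ((L + 2 * \<eta> n) / pi)\<^sup>2 * ((I n (\<lambda>_. 1) / c n) * (I n (\<lambda>s. (v' s)\<^sup>2) / c n))" for n
  proof -
    have "I n (\<lambda>_. 1) * I n (\<lambda>s. (v s)\<^sup>2) - (I n v)\<^sup>2 \<le> ((L + 2 * \<eta> n) / pi)\<^sup>2 * (I n (\<lambda>_. 1) * I n (\<lambda>s. (v' s)\<^sup>2))"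
      using bump_projection_poincare[OF W \<eta>(1)[of n] L v v'c] by (simp add: I_def)
    then have "(I n (\<lambda>_. 1) * I n (\<lambda>s. (v s)\<^sup>2) - (I n v)\<^sup>2) / (c n)\<^sup>2 \<le> (((L + 2 * \<eta> n) / pi)\<^sup>2 * (I n (\<lambda>_. 1) * I n (\<lambda>s. (v' s)\<^sup>2))) / (c n)\<^sup>2"
      by (intro divide_right_mono) auto
    then show ?thesis by (simp add: diff_divide_distrib power_divide power2_eq_square[of "c n"])
  qed
  have l1: "(\<lambda>n. (I n (\<lambda>_. 1) / c n) * (I n (\<lambda>s. (v s)\<^sup>2) / c n) - (I n v / c n)\<^sup>2) \<longlonglongrightarrow> J (\<lambda>_. 1) * J (\<lambda>s. (v s)\<^sup>2) - (J v)\<^sup>2"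
    by (intro tendsto_intros lim continuous_intros vc)
  have l2: "(\<lambda>n. ((L + 2 * \<eta> n) / pi)\<^sup>2 * ((I n (\<lambda>_. 1) / c n) * (I n (\<lambda>s. (v' s)\<^sup>2) / c n))) \<longlonglongrightarrow>
      ((L + 2 * 0) / pi)\<^sup>2 * (J (\<lambda>_. 1) * J (\<lambda>s. (v' s)\<^sup>2))"
    by (intro tendsto_intros lim continuous_intros v'c \<eta>0) simp
  have "J (\<lambda>_. 1) * J (\<lambda>s. (v s)\<^sup>2) - (J v)\<^sup>2 \<le> ((L + 2 * 0) / pi)\<^sup>2 * (J (\<lambda>_. 1) * J (\<lambda>s. (v' s)\<^sup>2))"
    by (rule LIMSEQ_le[OF l1 l2]) (use ineq in auto)
  then show ?thesis by (simp add: J_def)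
qed

section \<open>Localization to needles\<close>

lemma integrable_indicator_compact:
  fixes f :: "'a::euclidean_space \<Rightarrow> real"
  assumes "compact K" "continuous_on UNIV f"
  shows "integrable lborel (\<lambda>x. indicator K x * f x)"
  using borel_integrable_compact[OF assms(1) continuous_on_subset[OF assms(2) subset_UNIV]] by simp

text \<open>Turning the hyperplane by \<open>\<pi>\<close> exchanges its two sides.\<close>

lemma halving_hyperplane:
  fixes u g :: "'a::euclidean_space \<Rightarrow> real"
  assumes K: "compact K" and u: "continuous_on UNIV u" and g: "continuous_on UNIV g"
    and u0: "(LINT x|lborel. indicator K x * u x) = 0" and g0: "(LINT x|lborel. indicator K x * g x) > 0"
    and ij: "i \<in> Basis" "j \<in> Basis" "i \<noteq> j"
  shows "\<exists>\<theta>. let H = {x. 0 \<le> cos \<theta> * (x \<bullet> i - a) + sin \<theta> * (x \<bullet> j - b)} in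
    (LINT x|lborel. indicator (K \<inter> H) x * u x) = 0 \<and> (LINT x|lborel. indicator (K \<inter> H) x * g x) > 0"
proof -
  define w where "w \<theta> x = cos \<theta> * (x \<bullet> i - a) + sin \<theta> * (x \<bullet> j - b)" for \<theta> x
  have w_pi: "w (\<theta> + pi) x = - w \<theta> x" for \<theta> x by (simp add: w_def)
  have wnull: "AE x in lborel. w \<theta> x \<noteq> 0" for \<theta>
  proof -
    let ?n = "cos \<theta> *\<^sub>R i + sin \<theta> *\<^sub>R j"
    have "?n \<bullet> i = cos \<theta>" "?n \<bullet> j = sin \<theta>" using ij by (simp_all add: inner_add_left inner_not_same_Basis)
    then have "?n \<noteq> 0" using sin_cos_squared_add[of \<theta>] by (metis inner_zero_left power_zero_numeral add.right_neutral zero_neq_one)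
    from AE_not_in_hyperplane[OF this, of "cos \<theta> * a + sin \<theta> * b"]
    show ?thesis by eventually_elim (simp add: w_def inner_add_right algebra_simps)
  qed
  have wm[measurable]: "w \<theta> \<in> borel_measurable borel" for \<theta> unfolding w_def by measurable
  define \<Phi> where "\<Phi> f \<theta> = (LINT x|lborel. indicator {x. w \<theta> x > 0} x * (indicator K x * f x))" for f :: "'a \<Rightarrow> real" and \<theta>
  have int: "integrable lborel (\<lambda>x. indicator K x * f x)" if "continuous_on UNIV f" for f :: "'a \<Rightarrow> real"
    using that K by (rule integrable_indicator_compact[rotated])
  have intw: "integrable lborel (\<lambda>x. indicator {x. w \<theta> x > 0} x * (indicator K x * f x))" if f: "continuous_on UNIV f" for f :: "'a \<Rightarrow> real" and \<theta>
    using integrable_mult_indicator[of "{x. w \<theta> x > 0}" lborel, OF _ int[OF f]] by simp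
  have split: "\<Phi> f \<theta> + \<Phi> f (\<theta> + pi) = (LINT x|lborel. indicator K x * f x)" if f: "continuous_on UNIV f" for f \<theta>
  proof -
    have "\<Phi> f \<theta> + \<Phi> f (\<theta> + pi) = (LINT x|lborel. indicator {x. w \<theta> x > 0} x * (indicator K x * f x) + indicator {x. w (\<theta> + pi) x > 0} x * (indicator K x * f x))"
      unfolding \<Phi>_def using intw[OF f] by simp
    also have "\<dots> = (LINT x|lborel. indicator K x * f x)"
    proof (rule integral_cong_AE)
      show "AE x in lborel. indicator {x. w \<theta> x > 0} x * (indicator K x * f x) + indicator {x. w (\<theta> + pi) x > 0} x * (indicator K x * f x) = indicator K x * f x"
        using wnull[of \<theta>] by eventually_elim (auto simp: w_pi indicator_def)
    qed (use intw[OF f] int[OF f] in \<open>auto intro!: borel_measurable_add dest: borel_measurable_integrable\<close>)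
    finally show ?thesis .
  qed
  \<comment> \<open>Continuity in the angle is shown for open half-spaces, while closed ones keep
    the pieces compact; the hyperplane between them is a null set.\<close>
  have closed_half: "(LINT x|lborel. indicator (K \<inter> {x. 0 \<le> w \<theta> x}) x * f x) = \<Phi> f \<theta>" if f: "continuous_on UNIV f" for f \<theta>
    unfolding \<Phi>_def
  proof (rule integral_cong_AE)
    have [measurable]: "f \<in> borel_measurable borel" "K \<in> sets borel"
      using f K by (auto intro: borel_measurable_continuous_onI borel_compact)
    show "(\<lambda>x. indicator (K \<inter> {x. 0 \<le> w \<theta> x}) x * f x) \<in> borel_measurable lborel" by measurable
    show "(\<lambda>x. indicator {x. w \<theta> x > 0} x * (indicator K x * f x)) \<in> borel_measurable lborel" by measurable
    show "AE x in lborel. indicator (K \<inter> {x. 0 \<le> w \<theta> x}) x * f x = indicator {x. w \<theta> x > 0} x * (indicator K x * f x)"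
      using wnull[of \<theta>] by eventually_elim (auto simp: indicator_def)
  qed
  have cont: "continuous_on UNIV (\<Phi> u)"
    unfolding \<Phi>_def[abs_def]
  proof (rule continuous_on_integral_moving_halfspace[OF int[OF u]])
    show "continuous_on UNIV (\<lambda>\<theta>. w \<theta> x)" for x unfolding w_def by (intro continuous_intros)
  qed (use wnull in auto)
  have "\<Phi> u pi = - \<Phi> u 0" using split[OF u, of 0] u0 by simp
  then have "\<exists>\<theta>. \<Phi> u \<theta> = 0"
    using IVT'[of "\<Phi> u" 0 0 pi] IVT2'[of "\<Phi> u" pi 0 0] continuous_on_subset[OF cont, of "{0..pi}"] pi_ge_zero
    by (cases "\<Phi> u 0 \<le> 0") auto
  then obtain \<theta> where \<theta>: "\<Phi> u \<theta> = 0" by blast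
  then have \<theta>': "\<Phi> u (\<theta> + pi) = 0" using split[OF u, of \<theta>] u0 by simp
  \<comment> \<open>The function \<open>u\<close> has integral zero on both sides of this
    hyperplane, so one may choose the side; the integrals of \<open>g\<close> add up to a positive
    number.\<close>
  have "\<Phi> g \<theta> > 0 \<or> \<Phi> g (\<theta> + pi) > 0" using split[OF g, of \<theta>] g0 by linarith
  then obtain \<theta>0 where "\<Phi> u \<theta>0 = 0" "\<Phi> g \<theta>0 > 0" using \<theta> \<theta>' by blast
  then show ?thesis
    unfolding Let_def using closed_half[OF u, of \<theta>0] closed_half[OF g, of \<theta>0] by (intro exI[of _ \<theta>0]) (simp add: w_def)
qed

text \<open>A convex set that is not contained in a line has a two-dimensional projection to some coordinate
  plane; a line through an interior rational point of that projection properly cuts the set.\<close>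

lemma subset_line_if_not_properly_cut:
  fixes M :: "'a::euclidean_space set"
  assumes M: "convex M"
    and cut: "\<And>i j a b. i \<in> Basis \<Longrightarrow> j \<in> Basis \<Longrightarrow> i \<noteq> j \<Longrightarrow> a \<in> \<rat> \<Longrightarrow> b \<in> \<rat> \<Longrightarrow>
      \<exists>\<theta>. \<forall>x\<in>M. 0 \<le> cos \<theta> * (x \<bullet> i - a) + sin \<theta> * (x \<bullet> j - b)"
  shows "\<exists>x0 e. norm e = 1 \<and> (\<forall>x\<in>M. x = x0 + ((x - x0) \<bullet> e) *\<^sub>R e)"
proof (cases "\<exists>x\<in>M. \<exists>y\<in>M. x \<noteq> y")
  case False
  obtain e :: 'a where "e \<in> Basis" using nonempty_Basis by blast
  moreover obtain x0 where x0: "\<forall>x\<in>M. x = x0" using False by blast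
  then have "\<forall>x\<in>M. x = x0 + ((x - x0) \<bullet> e) *\<^sub>R e" by simp
  ultimately show ?thesis using norm_Basis by blast
next
  case True
  then obtain x y where xy: "x \<in> M" "y \<in> M" "x \<noteq> y" by blast
  define p where "p = y - x"
  have "p \<noteq> 0" using xy by (simp add: p_def)
  then obtain i where i: "i \<in> Basis" "p \<bullet> i \<noteq> 0" using euclidean_all_zero_iff[of p] by blast
  \<comment> \<open>Vanishing of all minors with the fixed column \<open>i\<close>, where
    \<open>p\<close> does not vanish, makes every difference \<open>q\<close> a multiple of
    \<open>p\<close>.\<close>
  have minors: "p \<bullet> i * (q \<bullet> j) - p \<bullet> j * (q \<bullet> i) = 0" if z: "z \<in> M" and j: "j \<in> Basis" and q: "q = z - x" for z q j
  proof (rule ccontr)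
    define D where "D = p \<bullet> i * (q \<bullet> j) - p \<bullet> j * (q \<bullet> i)"
    assume "p \<bullet> i * (q \<bullet> j) - p \<bullet> j * (q \<bullet> i) \<noteq> 0"
    then have D: "D \<noteq> 0" by (simp add: D_def)
    then have ij: "i \<noteq> j" by (auto simp: D_def)
    \<comment> \<open>By Cramer's rule \<open>S\<close> and \<open>T\<close> are the coordinates of
      the point (a, b) in the affine frame given by \<open>x\<close>, \<open>p\<close> and
      \<open>q\<close> in the plane of the coordinates \<open>i\<close> and
      \<open>j\<close>.\<close>
    define S where "S a b = ((a - x \<bullet> i) * (q \<bullet> j) - (b - x \<bullet> j) * (q \<bullet> i)) / D" for a b
    define T where "T a b = (p \<bullet> i * (b - x \<bullet> j) - p \<bullet> j * (a - x \<bullet> i)) / D" for a b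
    have sol: "x \<bullet> i + S a b * (p \<bullet> i) + T a b * (q \<bullet> i) = a" "x \<bullet> j + S a b * (p \<bullet> j) + T a b * (q \<bullet> j) = b" for a b
    proof -
      have "S a b * (p \<bullet> i) + T a b * (q \<bullet> i) = (a - x \<bullet> i) * D / D" "S a b * (p \<bullet> j) + T a b * (q \<bullet> j) = (b - x \<bullet> j) * D / D"
        unfolding S_def T_def times_divide_eq_left add_divide_distrib[symmetric] by (simp_all add: D_def algebra_simps)
      then show "x \<bullet> i + S a b * (p \<bullet> i) + T a b * (q \<bullet> i) = a" "x \<bullet> j + S a b * (p \<bullet> j) + T a b * (q \<bullet> j) = b"
        using D by simp_all
    qed
    \<comment> \<open>The centroid of the projected triangle with vertices x, x + p and x + q.
      Rational points close to it still have \<open>S\<close> and \<open>T\<close> positive with sum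
      below 1.\<close>
    define a0 where "a0 = x \<bullet> i + (1/3) * (p \<bullet> i) + (1/3) * (q \<bullet> i)"
    define b0 where "b0 = x \<bullet> j + (1/3) * (p \<bullet> j) + (1/3) * (q \<bullet> j)"
    have "S a0 b0 = ((1/3) * D) / D" "T a0 b0 = ((1/3) * D) / D"
      unfolding S_def T_def a0_def b0_def by (simp_all add: D_def algebra_simps)
    then have S0: "S a0 b0 = 1/3" "T a0 b0 = 1/3" using D by simp_all
    define V where "V = {z. 0 < S (fst z) (snd z) \<and> 0 < T (fst z) (snd z) \<and> S (fst z) (snd z) + T (fst z) (snd z) < 1}"
    have "open V"
      unfolding V_def S_def T_def using D
      by (intro open_Collect_conj open_Collect_less continuous_intros) auto
    moreover have "(a0, b0) \<in> V" using S0 by (simp add: V_def)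
    ultimately obtain A B where AB: "open A" "open B" "a0 \<in> A" "b0 \<in> B" "A \<times> B \<subseteq> V"
      by (metis open_prod_elim mem_Sigma_iff)
    have rat: "\<exists>r\<in>\<rat>. r \<in> X" if X: "open X" "t \<in> X" for X and t :: real
    proof -
      obtain \<delta> where \<delta>: "\<delta> > 0" "ball t \<delta> \<subseteq> X" using X by (auto elim: openE)
      obtain r where "r \<in> \<rat>" "t < r" "r < t + \<delta>" using Rats_dense_in_real[of t "t + \<delta>"] \<delta>(1) by auto
      then show ?thesis using \<delta>(2) by (intro bexI[of _ r]) (auto simp: dist_real_def)
    qed
    obtain a where a: "a \<in> \<rat>" "a \<in> A" using rat[OF AB(1,3)] by blast
    obtain b where b: "b \<in> \<rat>" "b \<in> B" using rat[OF AB(2,4)] by blast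
    have st: "0 < S a b" "0 < T a b" "S a b + T a b < 1"
      using AB(5) a(2) b(2) by (auto simp: V_def)
    obtain \<theta> where \<theta>: "\<And>x. x \<in> M \<Longrightarrow> 0 \<le> cos \<theta> * (x \<bullet> i - a) + sin \<theta> * (x \<bullet> j - b)"
      using cut[OF i(1) j ij a(1) b(1)] by blast
    define w where "w y = cos \<theta> * (y \<bullet> i - a) + sin \<theta> * (y \<bullet> j - b)" for y
    have wp: "w (x + p) = w x + (cos \<theta> * (p \<bullet> i) + sin \<theta> * (p \<bullet> j))" and wq: "w (x + q) = w x + (cos \<theta> * (q \<bullet> i) + sin \<theta> * (q \<bullet> j))"
      by (simp_all add: w_def inner_add_left algebra_simps)
    have wx: "w x + S a b * (cos \<theta> * (p \<bullet> i) + sin \<theta> * (p \<bullet> j)) + T a b * (cos \<theta> * (q \<bullet> i) + sin \<theta> * (q \<bullet> j)) = 0"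
    proof -
      have "w x + S a b * (cos \<theta> * (p \<bullet> i) + sin \<theta> * (p \<bullet> j)) + T a b * (cos \<theta> * (q \<bullet> i) + sin \<theta> * (q \<bullet> j)) =
        cos \<theta> * ((x \<bullet> i + S a b * (p \<bullet> i) + T a b * (q \<bullet> i)) - a) + sin \<theta> * ((x \<bullet> j + S a b * (p \<bullet> j) + T a b * (q \<bullet> j)) - b)"
        by (simp add: w_def algebra_simps)
      then show ?thesis unfolding sol by simp
    qed
    have nn: "w x \<ge> 0" "w (x + p) \<ge> 0" "w (x + q) \<ge> 0"
      using \<theta>[OF xy(1)] \<theta>[OF xy(2)] \<theta>[OF z] by (simp_all add: w_def p_def q)
    \<comment> \<open>An affine function that is nonnegative at the vertices of a triangle and zero
      at an interior point vanishes at all vertices. As the determinant \<open>D\<close> is not 0,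
      both cosine and sine would then vanish.\<close>
    have "(1 - S a b - T a b) * w x + S a b * w (x + p) + T a b * w (x + q) = 0"
      using wx unfolding wp wq by (simp add: algebra_simps)
    moreover have "0 \<le> (1 - S a b - T a b) * w x" "0 \<le> S a b * w (x + p)" "0 \<le> T a b * w (x + q)"
      using st nn by (auto intro!: mult_nonneg_nonneg)
    ultimately have "(1 - S a b - T a b) * w x = 0" "S a b * w (x + p) = 0" "T a b * w (x + q) = 0" by linarith+
    then have "w x = 0" "w (x + p) = 0" "w (x + q) = 0" using st by auto
    then have 0: "cos \<theta> * (p \<bullet> i) + sin \<theta> * (p \<bullet> j) = 0" "cos \<theta> * (q \<bullet> i) + sin \<theta> * (q \<bullet> j) = 0"
      using wp wq by simp_all
    have "cos \<theta> * D = (cos \<theta> * (p \<bullet> i) + sin \<theta> * (p \<bullet> j)) * (q \<bullet> j) - (cos \<theta> * (q \<bullet> i) + sin \<theta> * (q \<bullet> j)) * (p \<bullet> j)"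
      and "sin \<theta> * D = (cos \<theta> * (q \<bullet> i) + sin \<theta> * (q \<bullet> j)) * (p \<bullet> i) - (cos \<theta> * (p \<bullet> i) + sin \<theta> * (p \<bullet> j)) * (q \<bullet> i)"
      by (simp_all add: D_def algebra_simps)
    then have "cos \<theta> * D = 0" "sin \<theta> * D = 0" unfolding 0 by simp_all
    then have "cos \<theta> = 0" "sin \<theta> = 0" using D by simp_all
    then show False using sin_cos_squared_add[of \<theta>] by simp
  qed
  define e where "e = (1 / norm p) *\<^sub>R p"
  have e: "norm e = 1" using \<open>p \<noteq> 0\<close> by (simp add: e_def)
  have "z = x + ((z - x) \<bullet> e) *\<^sub>R e" if z: "z \<in> M" for z
  proof -
    define t where "t = ((z - x) \<bullet> i) / (p \<bullet> i)"
    have zt: "z - x = t *\<^sub>R p"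
    proof (rule euclidean_eqI)
      fix j :: 'a assume j: "j \<in> Basis"
      show "(z - x) \<bullet> j = (t *\<^sub>R p) \<bullet> j"
        using minors[OF z j refl] i(2) by (simp add: t_def field_simps)
    qed
    have "((z - x) \<bullet> e) *\<^sub>R e = (t * (p \<bullet> e)) *\<^sub>R e" by (simp add: zt)
    also have "p \<bullet> e = norm p" by (simp add: e_def dot_square_norm power2_eq_square)
    also have "(t * norm p) *\<^sub>R e = t *\<^sub>R p" using \<open>p \<noteq> 0\<close> by (simp add: e_def)
    finally show ?thesis using zt by (simp add: algebra_simps)
  qed
  then show ?thesis using e by blast
qed

text \<open>Cantor's intersection theorem for the compact parts on which \<open>f\<close> is at
  least \<delta>.\<close>

lemma nested_compact_in_neighbourhood:
  fixes K :: "nat \<Rightarrow> 'a::euclidean_space set" and f :: "'a \<Rightarrow> real"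
  assumes K: "\<And>n. compact (K n)" "decseq K" and f: "continuous_on UNIV f"
    and lim: "\<And>x. x \<in> (\<Inter>n. K n) \<Longrightarrow> f x < \<delta>"
  shows "\<exists>n. \<forall>x\<in>K n. f x < \<delta>"
proof (rule ccontr)
  assume neg: "\<not> ?thesis"
  define F where "F n = K n \<inter> {x. \<delta> \<le> f x}" for n
  have "(\<Inter>n. F n) \<noteq> {}"
  proof (rule compact_nest)
    show "compact (F n)" for n
      unfolding F_def using K(1) f by (intro compact_Int_closed closed_Collect_le continuous_intros) auto
    show "F n \<noteq> {}" for n using neg by (force simp: F_def not_less)
    show "F n \<subseteq> F m" if "m \<le> n" for m n using decseqD[OF K(2) that] by (auto simp: F_def)
  qed
  then show False using lim by (force simp: F_def)
qed

text \<open>Centres of the halving hyperplanes run through all rational points of all coordinate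
  planes, a countable set. The intersection of the pieces is therefore not properly cut at any of
  them and lies on a line; by compactness the pieces themselves come arbitrarily close to it. The
  line is fixed before \<delta>.\<close>

lemma localization_to_needle:
  fixes u g :: "'a::euclidean_space \<Rightarrow> real"
  assumes K: "compact K" "convex K" and u: "continuous_on UNIV u" and g: "continuous_on UNIV g"
    and u0: "(LINT x|lborel. indicator K x * u x) = 0" and g0: "(LINT x|lborel. indicator K x * g x) > 0"
  shows "\<exists>x0 e. norm e = 1 \<and> (\<forall>\<delta>>0. \<exists>K'\<subseteq>K. compact K' \<and> convex K' \<and> (LINT x|lborel. indicator K' x * u x) = 0 \<and>
      (LINT x|lborel. indicator K' x * g x) > 0 \<and> (\<forall>x\<in>K'. norm (x - (x0 + ((x - x0) \<bullet> e) *\<^sub>R e)) < \<delta>))"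
proof -
  define P where "P K \<longleftrightarrow> compact K \<and> convex K \<and> (LINT x|lborel. indicator K x * u x) = 0 \<and> (LINT x|lborel. indicator K x * g x) > 0"
    for K :: "'a set"
  define C where "C = ((Basis :: 'a set) \<times> (Basis :: 'a set)) \<times> ((\<rat> :: real set) \<times> (\<rat> :: real set))"
  have "countable C" unfolding C_def by (intro countable_SIGMA countable_finite countable_rat) auto
  then obtain q :: "nat \<Rightarrow> ('a \<times> 'a) \<times> (real \<times> real)" where q: "C \<subseteq> range q"
    by (metis from_nat_into_surj image_iff rangeI subsetI)
  \<comment> \<open>The second clause is vacuous when \<open>q n\<close> is not an admissible
    centre; the set is then kept unchanged.\<close>
  define Q where "Q n K K' \<longleftrightarrow> K' \<subseteq> K \<and> (\<forall>i j a b. q n = ((i, j), (a, b)) \<longrightarrow> i \<in> Basis \<longrightarrow> j \<in> Basis \<longrightarrow> i \<noteq> j \<longrightarrow>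
      (\<exists>\<theta>. \<forall>x\<in>K'. 0 \<le> cos \<theta> * (x \<bullet> i - a) + sin \<theta> * (x \<bullet> j - b)))" for n and K K' :: "'a set"
  have step: "\<exists>K'. P K' \<and> Q n K K'" if PK: "P K" for n K
  proof -
    obtain i j a b where qn: "q n = ((i, j), (a, b))" by (metis surj_pair)
    show ?thesis
    proof (cases "i \<in> Basis \<and> j \<in> Basis \<and> i \<noteq> j")
      case True
      then obtain \<theta> where \<theta>: "(LINT x|lborel. indicator (K \<inter> {x. 0 \<le> cos \<theta> * (x \<bullet> i - a) + sin \<theta> * (x \<bullet> j - b)}) x * u x) = 0"
        "(LINT x|lborel. indicator (K \<inter> {x. 0 \<le> cos \<theta> * (x \<bullet> i - a) + sin \<theta> * (x \<bullet> j - b)}) x * g x) > 0"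
        using halving_hyperplane[OF _ u g, of K i j a b] PK unfolding P_def Let_def by blast
      define H where "H = {x. 0 \<le> cos \<theta> * (x \<bullet> i - a) + sin \<theta> * (x \<bullet> j - b)}"
      have H_eq: "H = {x. cos \<theta> * a + sin \<theta> * b \<le> (cos \<theta> *\<^sub>R i + sin \<theta> *\<^sub>R j) \<bullet> x}"
        unfolding H_def by (auto simp: inner_add_left inner_commute algebra_simps)
      have "closed H" "convex H" unfolding H_eq using closed_halfspace_ge convex_halfspace_ge by auto
      then have "P (K \<inter> H)" using PK \<theta> unfolding P_def H_def by (auto intro: compact_Int_closed convex_Int)
      moreover have "Q n K (K \<inter> H)" unfolding Q_def qn H_def by auto
      ultimately show ?thesis by blast
    next
      case False
      then have "Q n K K" unfolding Q_def qn by auto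
      then show ?thesis using PK by blast
    qed
  qed
  have "P K" using assms by (simp add: P_def)
  then obtain F where F: "\<And>n. P (F n)" "\<And>n. Q n (F n) (F (Suc n))" "F 0 = K"
    using dependent_nat_choice[of "\<lambda>n L. P L \<and> (n = 0 \<longrightarrow> L = K)" Q] step by (metis nat.distinct(1))
  have dec: "decseq F" using F(2) by (intro decseq_SucI) (auto simp: Q_def)
  have comp: "compact (F n)" "convex (F n)" for n using F(1) by (auto simp: P_def)
  define M where "M = (\<Inter>n. F n)"
  have "\<exists>x0 e. norm e = 1 \<and> (\<forall>x\<in>M. x = x0 + ((x - x0) \<bullet> e) *\<^sub>R e)"
  proof (rule subset_line_if_not_properly_cut)
    show "convex M" unfolding M_def using comp by (intro convex_INT) auto
    fix i j :: 'a and a b :: real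
    assume *: "i \<in> Basis" "j \<in> Basis" "i \<noteq> j" "a \<in> \<rat>" "b \<in> \<rat>"
    then have "((i, j), (a, b)) \<in> range q" using q by (auto simp: C_def)
    then obtain n where "q n = ((i, j), (a, b))" by auto
    then obtain \<theta> where "\<forall>x\<in>F (Suc n). 0 \<le> cos \<theta> * (x \<bullet> i - a) + sin \<theta> * (x \<bullet> j - b)"
      using F(2)[of n] * unfolding Q_def by blast
    then show "\<exists>\<theta>. \<forall>x\<in>M. 0 \<le> cos \<theta> * (x \<bullet> i - a) + sin \<theta> * (x \<bullet> j - b)"
      unfolding M_def by blast
  qed
  then obtain x0 e where e: "norm e = 1" and M: "\<And>x. x \<in> M \<Longrightarrow> x = x0 + ((x - x0) \<bullet> e) *\<^sub>R e" by blast
  show ?thesis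
  proof (rule exI[of _ x0], rule exI[of _ e], intro conjI e allI impI)
    fix \<delta> :: real assume \<delta>: "\<delta> > 0"
    have "norm (x - (x0 + ((x - x0) \<bullet> e) *\<^sub>R e)) < \<delta>" if "x \<in> (\<Inter>n. F n)" for x
      using M[of x] that \<delta> unfolding M_def by simp
    then have "\<exists>n. \<forall>x\<in>F n. norm (x - (x0 + ((x - x0) \<bullet> e) *\<^sub>R e)) < \<delta>"
      by (intro nested_compact_in_neighbourhood[OF comp(1) dec] continuous_intros)
    then obtain n where n: "\<forall>x\<in>F n. norm (x - (x0 + ((x - x0) \<bullet> e) *\<^sub>R e)) < \<delta>" by blast
    moreover have "F n \<subseteq> K" using decseqD[OF dec, of 0 n] F(3) by simp
    ultimately show "\<exists>K'\<subseteq>K. compact K' \<and> convex K' \<and> (LINT x|lborel. indicator K' x * u x) = 0 \<and>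
      (LINT x|lborel. indicator K' x * g x) > 0 \<and> (\<forall>x\<in>K'. norm (x - (x0 + ((x - x0) \<bullet> e) *\<^sub>R e)) < \<delta>)"
      using F(1)[of n] unfolding P_def by blast
  qed
qed

section \<open>The Payne--Weinberger inequality\<close>

text \<open>Subtracting \<epsilon> in \<open>q\<close> keeps a slack proportional to the measure of
  a piece. Each error of replacing \<open>x\<close> by its projection to the needle is proportional
  to that measure as well, so the contradiction survives although the pieces may be arbitrarily
  small.\<close>

lemma payne_weinberger_smooth_mean_zero:
  fixes T :: "'a::euclidean_space set" and v :: "'a \<Rightarrow> real" and g :: "'a \<Rightarrow> 'a"
  assumes T: "compact T" "convex T" and v: "continuous_on UNIV v" and g: "continuous_on UNIV g"
    and der: "\<And>x h. ((\<lambda>t. v (x + t *\<^sub>R h)) has_real_derivative g x \<bullet> h) (at 0)"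
    and mean: "(LINT x|lborel. indicator T x * v x) = 0"
  shows "(LINT x|lborel. indicator T x * (v x)\<^sup>2) \<le> (diameter T / pi)\<^sup>2 * (LINT x|lborel. indicator T x * (norm (g x))\<^sup>2)"
proof (rule ccontr)
  assume neg: "\<not> ?thesis"
  define c where "c = (diameter T / pi)\<^sup>2"
  have c: "c \<ge> 0" by (simp add: c_def)
  let ?V = "\<lambda>x. (v x)\<^sup>2" and ?G = "\<lambda>x. (norm (g x))\<^sup>2"
  have cV: "continuous_on UNIV ?V" and cG: "continuous_on UNIV ?G" by (intro continuous_intros v g)+
  have [measurable]: "v \<in> borel_measurable borel" "g \<in> borel_measurable borel"
    using v g by (auto intro: borel_measurable_continuous_onI)
  define D where "D = (LINT x|lborel. indicator T x * ?V x) - c * (LINT x|lborel. indicator T x * ?G x)"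
  have D: "D > 0" using neg by (simp add: D_def c_def)
  obtain mT where mT: "mT = measure lborel T" "0 \<le> mT" by simp
  \<comment> \<open>Chosen so that \<epsilon> times the measure of \<open>T\<close> stays below the
    defect \<open>D\<close> and \<open>q\<close> still has positive integral over
    \<open>T\<close>.\<close>
  define \<epsilon> where "\<epsilon> = D / (2 * (mT + 1))"
  have \<epsilon>: "\<epsilon> > 0" using D mT(2) by (simp add: \<epsilon>_def)
  have \<epsilon>m: "\<epsilon> * mT < D"
  proof -
    have "\<epsilon> * mT < \<epsilon> * (2 * (mT + 1))" using \<epsilon> mT(2) by (intro mult_strict_left_mono) auto
    also have "\<dots> = D" using mT(2) by (simp add: \<epsilon>_def)
    finally show ?thesis .
  qed
  define q where "q x = ?V x - c * ?G x - \<epsilon>" for x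
  have cq: "continuous_on UNIV q" unfolding q_def by (intro continuous_intros v g)
  have int_q: "(LINT x|lborel. indicator K x * q x) =
      (LINT x|lborel. indicator K x * ?V x) - c * (LINT x|lborel. indicator K x * ?G x) - \<epsilon> * measure lborel K"
    if K: "compact K" for K
  proof -
    note i = integrable_indicator_compact[OF K cV] integrable_indicator_compact[OF K cG]
    have "integrable lborel (\<lambda>x. \<epsilon> * indicator K x)"
      using integrable_indicator_compact[OF K, of "\<lambda>_. \<epsilon>"] by (simp add: mult.commute)
    moreover have "indicator K x * q x = indicator K x * ?V x - c * (indicator K x * ?G x) - \<epsilon> * indicator K x" for x
      by (simp add: q_def algebra_simps)
    ultimately show ?thesis using i K by (simp add: Bochner_Integration.integral_diff)
  qed
  have "(LINT x|lborel. indicator T x * q x) > 0"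
    using int_q[OF T(1)] \<epsilon>m by (simp add: D_def mT(1))
  from localization_to_needle[OF T v cq mean this]
  obtain x0 e where e: "norm e = 1" and loc:
    "\<forall>\<delta>>0. \<exists>K\<subseteq>T. compact K \<and> convex K \<and> (LINT x|lborel. indicator K x * v x) = 0 \<and>
      (LINT x|lborel. indicator K x * q x) > 0 \<and> (\<forall>x\<in>K. norm (x - (x0 + ((x - x0) \<bullet> e) *\<^sub>R e)) < \<delta>)"
    by blast
  \<comment> \<open>Here \<pi> is the orthogonal projection to the needle line; the number is
    \<open>pi\<close>.\<close>
  define \<pi> where "\<pi> x = x0 + ((x - x0) \<bullet> e) *\<^sub>R e" for x
  obtain R where R: "\<And>x. x \<in> T \<Longrightarrow> norm x \<le> R" using compact_imp_bounded[OF T(1)] by (auto simp: bounded_iff)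
  define r where "r = R + 2 * norm x0"
  have ball: "x \<in> cball 0 r" "\<pi> x \<in> cball 0 r" if "x \<in> T" for x
  proof -
    have "norm (\<pi> x) \<le> norm x0 + \<bar>(x - x0) \<bullet> e\<bar>" unfolding \<pi>_def using norm_triangle_ineq[of x0] e by (metis norm_scaleR mult.right_neutral real_norm_def)
    also have "\<bar>(x - x0) \<bullet> e\<bar> \<le> norm (x - x0)" using Cauchy_Schwarz_ineq2[of "x - x0" e] e by simp
    also have "norm (x - x0) \<le> norm x + norm x0" by (rule norm_triangle_ineq4)
    finally show "\<pi> x \<in> cball 0 r" using R[OF that] by (simp add: r_def)
    show "x \<in> cball 0 r" using R[OF that] by (simp add: r_def add_increasing2)
  qed
  \<comment> \<open>Three errors must stay below \<epsilon>: \<omega>^2 from the mean of the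
    projected function, c \<omega> from the gradient, and \<omega> from the square of
    \<open>v\<close>. With \<omega> at most 1 they total at most (c + 2) \<omega>, and 3 instead of
    2 makes the bound strict.\<close>
  define \<omega> where "\<omega> = min 1 (\<epsilon> / (c + 3))"
  have \<omega>: "0 < \<omega>" "\<omega> \<le> 1" using \<epsilon> c by (auto simp: \<omega>_def)
  have \<omega>\<epsilon>: "\<omega>\<^sup>2 + c * \<omega> + \<omega> < \<epsilon>"
  proof -
    have "\<omega>\<^sup>2 \<le> \<omega>" using \<omega> by (simp add: power2_eq_square mult_left_le)
    then have "\<omega>\<^sup>2 + c * \<omega> + \<omega> \<le> (c + 2) * \<omega>" by (simp add: algebra_simps)
    also have "\<dots> < (c + 3) * \<omega>" using \<omega> by simp
    also have "\<dots> \<le> (c + 3) * (\<epsilon> / (c + 3))" using c by (intro mult_left_mono) (auto simp: \<omega>_def)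
    also have "\<dots> = \<epsilon>" using c by simp
    finally show ?thesis .
  qed
  have unif: "\<exists>\<delta>>0. \<forall>x\<in>cball 0 r. \<forall>y\<in>cball 0 r. norm (x - y) < \<delta> \<longrightarrow> \<bar>f x - f y\<bar> \<le> \<omega>"
    if "continuous_on UNIV f" for f :: "'a \<Rightarrow> real"
  proof -
    have "uniformly_continuous_on (cball 0 r) f"
      by (intro compact_uniformly_continuous continuous_on_subset[OF that]) auto
    then obtain \<delta> where "\<delta> > 0" "\<forall>x\<in>cball 0 r. \<forall>x'\<in>cball 0 r. dist x' x < \<delta> \<longrightarrow> dist (f x') (f x) < \<omega>"
      using \<omega>(1) unfolding uniformly_continuous_on_def by meson
    then show ?thesis by (intro exI[of _ \<delta>]) (auto simp: dist_norm dist_real_def less_imp_le)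
  qed
  have cge: "continuous_on UNIV (\<lambda>x. (g x \<bullet> e)\<^sup>2)" by (intro continuous_intros g)
  obtain d1 where d1: "d1 > 0" "\<forall>x\<in>cball 0 r. \<forall>y\<in>cball 0 r. norm (x - y) < d1 \<longrightarrow> \<bar>v x - v y\<bar> \<le> \<omega>"
    using unif[OF v] by blast
  obtain d2 where d2: "d2 > 0" "\<forall>x\<in>cball 0 r. \<forall>y\<in>cball 0 r. norm (x - y) < d2 \<longrightarrow> \<bar>(v x)\<^sup>2 - (v y)\<^sup>2\<bar> \<le> \<omega>"
    using unif[OF cV] by blast
  obtain d3 where d3: "d3 > 0" "\<forall>x\<in>cball 0 r. \<forall>y\<in>cball 0 r. norm (x - y) < d3 \<longrightarrow> \<bar>(g x \<bullet> e)\<^sup>2 - (g y \<bullet> e)\<^sup>2\<bar> \<le> \<omega>"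
    using unif[OF cge] by blast
  have "min d1 (min d2 d3) > 0" using d1(1) d2(1) d3(1) by simp
  from loc[rule_format, OF this] obtain K where K: "K \<subseteq> T" "compact K" "convex K" "(LINT x|lborel. indicator K x * v x) = 0"
    "(LINT x|lborel. indicator K x * q x) > 0" and near: "\<And>x. x \<in> K \<Longrightarrow> norm (x - \<pi> x) < min d1 (min d2 d3)"
    unfolding \<pi>_def by blast
  \<comment> \<open>The one-dimensional reduction requires an open set; the frontier of the convex
    piece is a null set, so no integral changes.\<close>
  define W where "W = interior K"
  have W: "open W" "bounded W" "convex W"
    unfolding W_def using K(2,3) by (auto intro: bounded_subset[OF compact_imp_bounded interior_subset] convex_interior)
  have [measurable]: "W \<in> sets borel" "K \<in> sets borel" using W K(2) by (auto intro: borel_compact)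
  have "AE x in lborel. x \<notin> frontier K"
    using K by (intro AE_lborel_not_in_negligible negligible_convex_frontier) (auto intro: borel_closed)
  then have AE_WK: "AE x in lborel. indicator W x = (indicator K x :: real)"
    by eventually_elim (use K(2) in \<open>auto simp: W_def frontier_def indicator_def closure_closed compact_imp_closed
        dest: subsetD[OF interior_subset]\<close>)
  have WK: "(LINT x|lborel. indicator W x * f x) = (LINT x|lborel. indicator K x * f x)"
    if [measurable]: "f \<in> borel_measurable borel" for f :: "'a \<Rightarrow> real"
  proof (rule integral_cong_AE)
    show "AE x in lborel. indicator W x * f x = indicator K x * f x" using AE_WK by eventually_elim simp
  qed measurable
  define m where "m = measure lborel W"
  have mK: "m = measure lborel K"
    using WK[of "\<lambda>_. 1"] by (simp add: m_def)
  have [measurable]: "q \<in> borel_measurable borel" using cq by (rule borel_measurable_continuous_onI)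
  have "W \<noteq> {}"
  proof
    assume "W = {}"
    then have "(LINT x|lborel. indicator K x * q x) = 0" using WK[of q] by simp
    then show False using K(5) by simp
  qed
  have m: "m > 0"
  proof -
    have "\<not> negligible W" using open_not_negligible[OF W(1) \<open>W \<noteq> {}\<close>] .
    then have "emeasure lborel W \<noteq> 0"
      using W(1) by (auto simp: negligible_iff_null_sets null_sets_completion_iff null_sets_def borel_open)
    then show ?thesis
      using fmeasurable_bounded[of W] W by (auto simp: m_def zero_less_measure_iff fmeasurable_def emeasure_eq_ennreal_measure less_top[symmetric])
  qed
  have WT: "x \<in> T" "x \<in> K" if "x \<in> W" for x using that K(1) interior_subset by (auto simp: W_def)
  \<comment> \<open>The restriction of \<open>v\<close> to the line, parametrized so that the
    projection of \<open>x\<close> has parameter \<open>x \<bullet> e\<close>.\<close>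
  define f where "f t = v (x0 + (t - x0 \<bullet> e) *\<^sub>R e)" for t
  define f' where "f' t = g (x0 + (t - x0 \<bullet> e) *\<^sub>R e) \<bullet> e" for t
  have f\<pi>: "f (x \<bullet> e) = v (\<pi> x)" "f' (x \<bullet> e) = g (\<pi> x) \<bullet> e" for x
    by (simp_all add: f_def f'_def \<pi>_def inner_diff_left)
  have fder: "(f has_real_derivative f' t) (at t)" for t
  proof -
    have "((\<lambda>t. v (x0 + t *\<^sub>R e)) has_real_derivative g (x0 + (t - x0 \<bullet> e) *\<^sub>R e) \<bullet> e) (at (t - x0 \<bullet> e))"
      using directional_derivative_shift[of v e "\<lambda>x. g x \<bullet> e"] der by blast
    then show ?thesis
      using DERIV_shift[of "\<lambda>t. v (x0 + t *\<^sub>R e)" _ t "- (x0 \<bullet> e)"] by (simp add: f_def[abs_def] f'_def)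
  qed
  have f'c: "continuous_on UNIV f'"
    unfolding f'_def by (intro continuous_intros continuous_on_compose2[OF g]) auto
  have fc: "continuous_on UNIV f" using fder by (auto intro!: continuous_at_imp_continuous_on intro: DERIV_isCont)
  let ?J = "\<lambda>f. LINT x|lborel. indicator W x * f x"
  have Wint: "integrable lborel (\<lambda>x. indicator W x * f x)" if f: "continuous_on UNIV f" for f :: "'a \<Rightarrow> real"
  proof (rule Bochner_Integration.integrable_bound[OF integrable_indicator_compact[OF K(2) f]])
    have [measurable]: "f \<in> borel_measurable borel" using f by (rule borel_measurable_continuous_onI)
    show "(\<lambda>x. indicator W x * f x) \<in> borel_measurable lborel" by measurable
  qed (use interior_subset[of K] in \<open>auto simp: W_def indicator_def\<close>)
  have close: "?J f1 \<le> ?J f2 + \<omega> * m" if cont: "continuous_on UNIV f1" "continuous_on UNIV f2"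
    and le: "\<And>x. x \<in> W \<Longrightarrow> f1 x \<le> f2 x + \<omega>" for f1 f2 :: "'a \<Rightarrow> real"
  proof -
    have i3: "integrable lborel (\<lambda>x. indicator W x * \<omega>)" by (rule Wint) simp
    have "?J f1 \<le> (LINT x|lborel. indicator W x * f2 x + indicator W x * \<omega>)"
      using Wint[OF cont(1)] Wint[OF cont(2)] i3 le by (intro integral_mono) (auto simp: indicator_def)
    also have "\<dots> = ?J f2 + \<omega> * m"
      using Wint[OF cont(2)] i3 by (simp add: m_def mult.commute)
    finally show ?thesis .
  qed
  have c\<pi>: "continuous_on UNIV \<pi>" unfolding \<pi>_def[abs_def] by (intro continuous_intros)
  have cv\<pi>: "continuous_on UNIV (\<lambda>x. v (\<pi> x))" "continuous_on UNIV (\<lambda>x. (v (\<pi> x))\<^sup>2)" "continuous_on UNIV (\<lambda>x. (g (\<pi> x) \<bullet> e)\<^sup>2)"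
    by (intro continuous_intros continuous_on_compose2[OF v] continuous_on_compose2[OF g] c\<pi> subset_UNIV)+
  have cmp: "\<bar>v x - v (\<pi> x)\<bar> \<le> \<omega>" "\<bar>(v x)\<^sup>2 - (v (\<pi> x))\<^sup>2\<bar> \<le> \<omega>" "\<bar>(g x \<bullet> e)\<^sup>2 - (g (\<pi> x) \<bullet> e)\<^sup>2\<bar> \<le> \<omega>" if "x \<in> W" for x
    using d1(2) d2(2) d3(2) ball[OF WT(1)[OF that]] near[OF WT(2)[OF that]] by auto
  have J0: "?J v = 0" using WK[of v] K(4) by simp
  \<comment> \<open>The piece has mean zero for \<open>v\<close> itself; for the projected function
    the mean is only small, which is why the inequality with the subtracted square of the mean is
    used.\<close>
  have b1: "(?J (\<lambda>x. v (\<pi> x)))\<^sup>2 \<le> (\<omega> * m)\<^sup>2"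
  proof -
    have "?J (\<lambda>x. v (\<pi> x)) \<le> ?J v + \<omega> * m"
      by (rule close[OF cv\<pi>(1) v]) (use cmp(1) in \<open>fastforce simp: abs_le_iff\<close>)
    moreover have "?J v \<le> ?J (\<lambda>x. v (\<pi> x)) + \<omega> * m"
      by (rule close[OF v cv\<pi>(1)]) (use cmp(1) in \<open>fastforce simp: abs_le_iff\<close>)
    ultimately show ?thesis using J0 by (intro abs_le_square_iff[THEN iffD1]) (auto simp: abs_le_iff)
  qed
  have b2: "?J ?V \<le> ?J (\<lambda>x. (v (\<pi> x))\<^sup>2) + \<omega> * m"
    by (rule close[OF cV cv\<pi>(2)]) (use cmp(2) in \<open>fastforce simp: abs_le_iff\<close>)
  \<comment> \<open>The needle sees only the derivative along \<open>e\<close>, which is bounded by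
    the norm of the gradient.\<close>
  have b3: "?J (\<lambda>x. (g (\<pi> x) \<bullet> e)\<^sup>2) \<le> ?J ?G + \<omega> * m"
  proof (rule close[OF cv\<pi>(3) cG])
    fix x assume x: "x \<in> W"
    have "\<bar>g x \<bullet> e\<bar> \<le> norm (g x)" using Cauchy_Schwarz_ineq2[of "g x" e] e by simp
    then have "(g x \<bullet> e)\<^sup>2 \<le> (norm (g x))\<^sup>2" using power_mono[of "\<bar>g x \<bullet> e\<bar>" "norm (g x)" 2] by simp
    then show "(g (\<pi> x) \<bullet> e)\<^sup>2 \<le> (norm (g x))\<^sup>2 + \<omega>" using cmp(3)[OF x] by (simp add: abs_le_iff)
  qed
  have "x \<bullet> e - y \<bullet> e \<le> diameter T" if "x \<in> W" "y \<in> W" for x y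
  proof -
    have "x \<bullet> e - y \<bullet> e \<le> norm (x - y)" using Cauchy_Schwarz_ineq2[of "x - y" e] e by (simp add: inner_diff_left)
    also have "\<dots> \<le> diameter T"
      using diameter_bounded_bound[OF compact_imp_bounded[OF T(1)] WT(1)[OF that(1)] WT(1)[OF that(2)]] by (simp add: dist_norm)
    finally show ?thesis .
  qed
  from projection_poincare[OF W \<open>W \<noteq> {}\<close> this fder f'c]
  have "m * ?J (\<lambda>x. (v (\<pi> x))\<^sup>2) - (?J (\<lambda>x. v (\<pi> x)))\<^sup>2 \<le> c * (m * ?J (\<lambda>x. (g (\<pi> x) \<bullet> e)\<^sup>2))"
    by (simp add: f\<pi> m_def c_def)
  then have "m * ?J (\<lambda>x. (v (\<pi> x))\<^sup>2) \<le> c * (m * ?J (\<lambda>x. (g (\<pi> x) \<bullet> e)\<^sup>2)) + (\<omega> * m)\<^sup>2" using b1 by linarith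
  also have "\<dots> \<le> c * (m * (?J ?G + \<omega> * m)) + (\<omega> * m)\<^sup>2"
    using b3 c m by (intro add_right_mono mult_left_mono) auto
  also have "\<dots> = m * (c * (?J ?G + \<omega> * m) + \<omega>\<^sup>2 * m)" by (simp add: power2_eq_square algebra_simps)
  finally have "?J (\<lambda>x. (v (\<pi> x))\<^sup>2) \<le> c * (?J ?G + \<omega> * m) + \<omega>\<^sup>2 * m" using m by simp
  then have "?J ?V - c * ?J ?G \<le> (\<omega>\<^sup>2 + c * \<omega> + \<omega>) * m" using b2 by (simp add: algebra_simps)
  also have "\<dots> < \<epsilon> * m" using \<omega>\<epsilon> m by simp
  finally have "?J ?V - c * ?J ?G < \<epsilon> * m" .
  moreover have "?J ?V = (LINT x|lborel. indicator K x * ?V x)" "?J ?G = (LINT x|lborel. indicator K x * ?G x)"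
    by (intro WK; measurable)+
  ultimately show False using int_q[OF K(2)] K(5) mK by simp
qed

section \<open>From smooth functions to limits in L2\<close>

lemma norm_abs_L2: "square_integrable f \<Longrightarrow> (norm (abs_L2 f))\<^sup>2 = (LINT x|lborel. (norm (f x))\<^sup>2)"
proof -
  assume f: "square_integrable f"
  then have [measurable]: "f \<in> borel_measurable borel" by (simp add: square_integrable_def)
  show ?thesis unfolding norm_L2_power2
  proof (rule integral_cong_AE)
    show "AE x in lborel. (norm (rep_L2 (abs_L2 f) x))\<^sup>2 = (norm (f x))\<^sup>2"
      using rep_abs_L2[OF f] by eventually_elim simp
  qed measurable
qed

text \<open>Minkowski's inequality, read off from the norm of the quotient type.\<close>

lemma L2_triangle:
  assumes f: "square_integrable f" and g: "square_integrable g"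
  shows "sqrt (LINT x|lborel. (norm (f x + g x))\<^sup>2) \<le> sqrt (LINT x|lborel. (norm (f x))\<^sup>2) + sqrt (LINT x|lborel. (norm (g x))\<^sup>2)"
proof -
  have "abs_L2 (\<lambda>x. f x + g x) = abs_L2 f + abs_L2 g"
    unfolding L2_eq_iff_AE
    using rep_abs_L2[OF square_integrable_add[OF f g]] rep_L2_add[of "abs_L2 f" "abs_L2 g"] rep_abs_L2[OF f] rep_abs_L2[OF g]
    by eventually_elim simp
  then have "norm (abs_L2 (\<lambda>x. f x + g x)) \<le> norm (abs_L2 f) + norm (abs_L2 g)" by (simp add: norm_triangle_ineq)
  moreover have "norm (abs_L2 k) = sqrt (LINT x|lborel. (norm (k x))\<^sup>2)" if "square_integrable k" for k :: "'a \<Rightarrow> 'b"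
    using norm_abs_L2[OF that] by (metis norm_ge_zero real_sqrt_unique)
  ultimately show ?thesis using f g square_integrable_add[OF f g] by simp
qed

text \<open>The smooth approximations are corrected by their own means \<open>k\<close>, not by
  \<open>m\<close>. This costs nothing, as the mean of \<open>u\<close> minimizes the distance to
  constants. Square roots turn the approximation errors into additive terms.\<close>

lemma payne_weinberger:
  fixes T :: "'a::euclidean_space set" and u :: "'a \<Rightarrow> real" and s :: "'a \<Rightarrow> 'a"
  assumes T: "compact T" "convex T" and u: "square_integrable u" and s: "square_integrable s"
    and approx: "\<And>\<eta>. \<eta> > 0 \<Longrightarrow> \<exists>v g. continuous_on UNIV v \<and> continuous_on UNIV g \<and>
      (\<forall>x h. ((\<lambda>t. v (x + t *\<^sub>R h)) has_real_derivative g x \<bullet> h) (at 0)) \<and>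
      (\<integral>\<^sup>+x. ennreal ((norm (v x - u x))\<^sup>2) \<partial>lborel) \<le> ennreal \<eta> \<and>
      (\<integral>\<^sup>+x. ennreal ((norm (g x - s x))\<^sup>2) \<partial>lborel) \<le> ennreal \<eta>"
  defines "m \<equiv> (LINT x|lborel. indicator T x * u x) / measure lborel T"
  shows "(LINT x|lborel. indicator T x * (u x - m)\<^sup>2) \<le> (diameter T / pi)\<^sup>2 * (LINT x|lborel. indicator T x * (norm (s x))\<^sup>2)"
proof (cases "measure lborel T = 0")
  case True
  have "T \<in> null_sets lborel"
    using True fmeasurable_bounded[OF borel_compact[OF T(1)] compact_imp_bounded[OF T(1)]] T(1)
    by (auto simp: null_sets_def fmeasurable_def measure_def enn2real_eq_0_iff borel_compact)
  then have AE0: "AE x in lborel. indicator T x * f x = 0" for f :: "'a \<Rightarrow> real"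
  proof -
    have "AE x in lborel. x \<notin> T" using \<open>T \<in> null_sets lborel\<close> by (rule AE_not_in)
    then show ?thesis by eventually_elim simp
  qed
  have "(LINT x|lborel. indicator T x * (u x - m)\<^sup>2) = 0" "(LINT x|lborel. indicator T x * (norm (s x))\<^sup>2) = 0"
    by (intro integral_eq_zero_AE AE0)+
  then show ?thesis by simp
next
  case False
  define M where "M = measure lborel T"
  have M: "M > 0" using False by (simp add: M_def zero_less_measure_iff)
  have [measurable]: "T \<in> sets borel" "u \<in> borel_measurable borel" "s \<in> borel_measurable borel"
    using T u s by (auto simp: square_integrable_def borel_compact)
  have Tfin: "emeasure lborel T < \<infinity>" using T(1) by (intro emeasure_bounded_finite compact_imp_bounded)
  define d where "d = diameter T / pi"
  have d: "d \<ge> 0" using diameter_ge_0[OF compact_imp_bounded[OF T(1)]] by (simp add: d_def)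
  have norm_ind: "(norm (indicator T x *\<^sub>R y))\<^sup>2 = indicator T x * (norm y)\<^sup>2" for x and y :: "'c::euclidean_space"
    by (simp add: indicator_def)
  have sq_ind: "square_integrable (\<lambda>x. indicator T x *\<^sub>R f x)" if "square_integrable f" for f :: "'a \<Rightarrow> 'c::euclidean_space"
  proof -
    have [measurable]: "f \<in> borel_measurable borel" using that by (simp add: square_integrable_def)
    have "integrable lborel (\<lambda>x. (norm (f x))\<^sup>2)" using that by (simp add: square_integrable_def)
    then have "integrable lborel (\<lambda>x. (norm (indicator T x *\<^sub>R f x))\<^sup>2)"
      by (rule Bochner_Integration.integrable_bound) (auto simp: indicator_def)
    then show ?thesis by (simp add: square_integrable_def)
  qed
  have sq_cont: "square_integrable (\<lambda>x. indicator T x *\<^sub>R f x)" if "continuous_on UNIV f" for f :: "'a \<Rightarrow> 'c::euclidean_space"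
    using T by (intro square_integrable_bounded_support that compact_imp_bounded) auto
  have iu: "integrable lborel (\<lambda>x. indicator T x * u x)"
    using square_integrable_imp_integrable_on_finite[OF u _ Tfin] by simp
  have iu2: "integrable lborel (\<lambda>x. indicator T x * (u x)\<^sup>2)"
    using sq_ind[OF u] unfolding square_integrable_def norm_ind by simp
  have iT: "integrable lborel (\<lambda>x. indicator T x :: real)" using Tfin by simp
  \<comment> \<open>The parallel-axis identity, which contains the minimality of the mean.\<close>
  have shift: "(LINT x|lborel. indicator T x * (u x - c)\<^sup>2) = (LINT x|lborel. indicator T x * (u x - m)\<^sup>2) + M * (m - c)\<^sup>2" for c
  proof -
    have exp: "(LINT x|lborel. indicator T x * (u x - k)\<^sup>2) = (LINT x|lborel. indicator T x * (u x)\<^sup>2) - 2 * k * (M * m) + k\<^sup>2 * M" for k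
    proof -
      have "(LINT x|lborel. indicator T x * (u x - k)\<^sup>2) =
          (LINT x|lborel. indicator T x * (u x)\<^sup>2 - 2 * k * (indicator T x * u x) + k\<^sup>2 * indicator T x)"
        by (intro Bochner_Integration.integral_cong refl) (simp add: power2_diff algebra_simps)
      also have "\<dots> = (LINT x|lborel. indicator T x * (u x)\<^sup>2) - 2 * k * (LINT x|lborel. indicator T x * u x) + k\<^sup>2 * M"
        using iu iu2 iT by (simp add: M_def)
      also have "(LINT x|lborel. indicator T x * u x) = M * m" using M by (simp add: m_def M_def)
      finally show ?thesis .
    qed
    show ?thesis unfolding exp by (simp add: power2_eq_square algebra_simps)
  qed
  have est: "sqrt (LINT x|lborel. indicator T x * (u x - m)\<^sup>2) \<le> sqrt \<eta> + d * (sqrt (LINT x|lborel. indicator T x * (norm (s x))\<^sup>2) + sqrt \<eta>)"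
    if \<eta>: "\<eta> > 0" for \<eta>
  proof -
    obtain v g where v: "continuous_on UNIV v" and g: "continuous_on UNIV g" and
      der: "\<And>x h. ((\<lambda>t. v (x + t *\<^sub>R h)) has_real_derivative g x \<bullet> h) (at 0)" and
      ev: "(\<integral>\<^sup>+x. ennreal ((norm (v x - u x))\<^sup>2) \<partial>lborel) \<le> ennreal \<eta>" and
      eg: "(\<integral>\<^sup>+x. ennreal ((norm (g x - s x))\<^sup>2) \<partial>lborel) \<le> ennreal \<eta>"
      using approx[OF \<eta>] by blast
    have err: "sqrt (LINT x|lborel. (norm (indicator T x *\<^sub>R a x - indicator T x *\<^sub>R b x))\<^sup>2) \<le> sqrt \<eta>"
      if a: "continuous_on UNIV a" and b: "square_integrable b"
        and le: "(\<integral>\<^sup>+x. ennreal ((norm (a x - b x))\<^sup>2) \<partial>lborel) \<le> ennreal \<eta>" for a b :: "'a \<Rightarrow> 'c::euclidean_space"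
    proof -
      have "integrable lborel (\<lambda>x. (norm (indicator T x *\<^sub>R a x - indicator T x *\<^sub>R b x))\<^sup>2)"
        using square_integrable_diff[OF sq_cont[OF a] sq_ind[OF b]] by (simp add: square_integrable_def)
      then have "ennreal (LINT x|lborel. (norm (indicator T x *\<^sub>R a x - indicator T x *\<^sub>R b x))\<^sup>2) =
          (\<integral>\<^sup>+x. ennreal ((norm (indicator T x *\<^sub>R a x - indicator T x *\<^sub>R b x))\<^sup>2) \<partial>lborel)"
        by (subst nn_integral_eq_integral) auto
      also have "\<dots> \<le> (\<integral>\<^sup>+x. ennreal ((norm (a x - b x))\<^sup>2) \<partial>lborel)"
        by (intro nn_integral_mono) (auto simp: indicator_def)
      finally have "ennreal (LINT x|lborel. (norm (indicator T x *\<^sub>R a x - indicator T x *\<^sub>R b x))\<^sup>2) \<le> ennreal \<eta>"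
        using le by (rule order_trans)
      then show ?thesis using \<eta> by (simp add: ennreal_le_iff)
    qed
    define k where "k = (LINT x|lborel. indicator T x * v x) / M"
    have ivT: "integrable lborel (\<lambda>x. indicator T x * v x)" by (rule integrable_indicator_compact[OF T(1) v])
    have "(LINT x|lborel. indicator T x * (v x - k)) = (LINT x|lborel. indicator T x * v x - k * indicator T x)"
      by (simp add: algebra_simps)
    also have "\<dots> = (LINT x|lborel. indicator T x * v x) - k * M" using ivT iT by (simp add: M_def)
    also have "\<dots> = 0" using M by (simp add: k_def)
    finally have "(LINT x|lborel. indicator T x * (v x - k)\<^sup>2) \<le> (diameter T / pi)\<^sup>2 * (LINT x|lborel. indicator T x * (norm (g x))\<^sup>2)"
      by (intro payne_weinberger_smooth_mean_zero T g continuous_intros v) (auto intro!: derivative_eq_intros der)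
    then have "sqrt (LINT x|lborel. indicator T x * (v x - k)\<^sup>2) \<le> sqrt (d\<^sup>2 * (LINT x|lborel. indicator T x * (norm (g x))\<^sup>2))"
      by (simp add: d_def)
    then have PW: "sqrt (LINT x|lborel. indicator T x * (v x - k)\<^sup>2) \<le> d * sqrt (LINT x|lborel. indicator T x * (norm (g x))\<^sup>2)"
      using d by (simp add: real_sqrt_mult)
    have "sqrt (LINT x|lborel. indicator T x * (u x - m)\<^sup>2) \<le> sqrt (LINT x|lborel. indicator T x * (u x - k)\<^sup>2)"
      unfolding shift[of k] using M by simp
    also have "(LINT x|lborel. indicator T x * (u x - k)\<^sup>2) =
        (LINT x|lborel. (norm ((indicator T x *\<^sub>R (v x - k)) + (indicator T x *\<^sub>R u x - indicator T x *\<^sub>R v x)))\<^sup>2)"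
      by (intro Bochner_Integration.integral_cong refl) (auto simp: indicator_def)
    also have "sqrt \<dots> \<le> sqrt (LINT x|lborel. (norm (indicator T x *\<^sub>R (v x - k)))\<^sup>2) + sqrt (LINT x|lborel. (norm (indicator T x *\<^sub>R u x - indicator T x *\<^sub>R v x))\<^sup>2)"
      by (intro L2_triangle square_integrable_diff sq_ind[OF u] sq_cont continuous_intros v)
    also have "(LINT x|lborel. (norm (indicator T x *\<^sub>R (v x - k)))\<^sup>2) = (LINT x|lborel. indicator T x * (v x - k)\<^sup>2)"
      unfolding norm_ind by simp
    finally have "sqrt (LINT x|lborel. indicator T x * (u x - m)\<^sup>2) \<le> sqrt (LINT x|lborel. indicator T x * (v x - k)\<^sup>2) +
        sqrt (LINT x|lborel. (norm (indicator T x *\<^sub>R u x - indicator T x *\<^sub>R v x))\<^sup>2)" .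
    moreover have "sqrt (LINT x|lborel. (norm (indicator T x *\<^sub>R u x - indicator T x *\<^sub>R v x))\<^sup>2) \<le> sqrt \<eta>"
      using err[OF v u ev] by (simp only: norm_minus_commute)
    ultimately have 1: "sqrt (LINT x|lborel. indicator T x * (u x - m)\<^sup>2) \<le> d * sqrt (LINT x|lborel. indicator T x * (norm (g x))\<^sup>2) + sqrt \<eta>"
      using PW by linarith
    have "(LINT x|lborel. indicator T x * (norm (g x))\<^sup>2) =
        (LINT x|lborel. (norm ((indicator T x *\<^sub>R s x) + (indicator T x *\<^sub>R g x - indicator T x *\<^sub>R s x)))\<^sup>2)"
      by (intro Bochner_Integration.integral_cong refl) (auto simp: indicator_def)
    also have "sqrt \<dots> \<le> sqrt (LINT x|lborel. (norm (indicator T x *\<^sub>R s x))\<^sup>2) + sqrt (LINT x|lborel. (norm (indicator T x *\<^sub>R g x - indicator T x *\<^sub>R s x))\<^sup>2)"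
      by (intro L2_triangle square_integrable_diff sq_ind[OF s] sq_cont[OF g])
    also have "\<dots> \<le> sqrt (LINT x|lborel. indicator T x * (norm (s x))\<^sup>2) + sqrt \<eta>"
      using err[OF g s eg] unfolding norm_ind by simp
    finally have "d * sqrt (LINT x|lborel. indicator T x * (norm (g x))\<^sup>2) \<le> d * (sqrt (LINT x|lborel. indicator T x * (norm (s x))\<^sup>2) + sqrt \<eta>)"
      using d by (intro mult_left_mono)
    then show ?thesis using 1 by linarith
  qed
  let ?a = "sqrt (LINT x|lborel. indicator T x * (u x - m)\<^sup>2)" and ?b = "sqrt (LINT x|lborel. indicator T x * (norm (s x))\<^sup>2)"
  have "?a \<le> d * ?b"
  proof (rule field_le_epsilon)
    fix \<epsilon> :: real assume \<epsilon>: "\<epsilon> > 0"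
    \<comment> \<open>The error enters once directly and once through the gradient with factor
      \<open>d\<close>, so (1 + d) sqrt \<eta> is to equal \<epsilon>.\<close>
    define \<eta> where "\<eta> = (\<epsilon> / (1 + d))\<^sup>2"
    have \<eta>: "\<eta> > 0" "sqrt \<eta> = \<epsilon> / (1 + d)" using \<epsilon> d by (simp_all add: \<eta>_def)
    have "?a \<le> sqrt \<eta> + d * (?b + sqrt \<eta>)" by (rule est[OF \<eta>(1)])
    also have "\<dots> = d * ?b + (1 + d) * sqrt \<eta>" by (simp add: algebra_simps)
    also have "(1 + d) * sqrt \<eta> = \<epsilon>" using \<eta>(2) d by simp
    finally show "?a \<le> d * ?b + \<epsilon>" .
  qed
  moreover have "0 \<le> ?a" by (intro real_sqrt_ge_zero integral_nonneg_AE) simp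
  ultimately have "?a\<^sup>2 \<le> (d * ?b)\<^sup>2" by (intro power_mono)
  moreover have "?a\<^sup>2 = (LINT x|lborel. indicator T x * (u x - m)\<^sup>2)" "?b\<^sup>2 = (LINT x|lborel. indicator T x * (norm (s x))\<^sup>2)"
    by (intro real_sqrt_pow2 integral_nonneg_AE; simp)+
  ultimately show ?thesis by (simp only: power_mult_distrib d_def)
qed

section \<open>Piecewise constant approximation and the eigenvalue bound\<close>

text \<open>Excludes slits: otherwise an element could contain a slit in its interior, where
  functions on \<Omega> may jump. Just below the graph near a boundary point there is an open set
  free of \<Omega>, so the point cannot be interior to the closure.\<close>

lemma interior_closure_Lipschitz_domain:
  fixes \<Omega> :: "'a::euclidean_space set"
  assumes \<Omega>: "open \<Omega>" and lip: "Lipschitz_domain \<Omega>"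
  shows "interior (closure \<Omega>) \<subseteq> \<Omega>"
proof
  fix x assume x: "x \<in> interior (closure \<Omega>)"
  show "x \<in> \<Omega>"
  proof (rule ccontr)
    assume x\<Omega>: "x \<notin> \<Omega>"
    have "x \<in> frontier \<Omega>"
      using x x\<Omega> interior_subset \<Omega> by (auto simp: frontier_def interior_open)
    then obtain r e C and g :: "'a \<Rightarrow> real" where r: "r > 0" and e: "norm e = 1"
      and g: "C-lipschitz_on {y. y \<bullet> e = 0} g"
      and iff: "\<And>y. y \<in> ball x r \<Longrightarrow> y \<in> \<Omega> \<longleftrightarrow> y \<bullet> e > g (y - (y \<bullet> e) *\<^sub>R e)"
      using lip unfolding Lipschitz_domain_def by blast
    have ee: "e \<bullet> e = 1" using e by (simp add: dot_square_norm)
    define f where "f y = y \<bullet> e - g (y - (y \<bullet> e) *\<^sub>R e)" for y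
    have fc: "continuous_on UNIV f"
      unfolding f_def
      by (intro continuous_intros continuous_on_compose2[OF lipschitz_on_continuous_on[OF g]])
        (auto simp: inner_diff_left ee)
    obtain d where d: "d > 0" "ball x d \<subseteq> closure \<Omega>"
      using x by (meson interior_subset open_contains_ball open_interior order_trans)
    define t where "t = min r d / 2"
    have t: "0 < t" "t < r" "t < d" using r d by (auto simp: t_def)
    \<comment> \<open>Stepping down along \<open>e\<close> leaves the orthogonal component
      unchanged, so the height \<open>f\<close> above the graph drops by exactly
      \<open>t\<close>.\<close>
    define y where "y = x - t *\<^sub>R e"
    have yb: "y \<in> ball x r" "y \<in> ball x d" using t e by (auto simp: y_def dist_norm)
    have "y - (y \<bullet> e) *\<^sub>R e = x - (x \<bullet> e) *\<^sub>R e" "y \<bullet> e = x \<bullet> e - t"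
      by (simp_all add: y_def inner_diff_left ee algebra_simps)
    then have "f y = f x - t" by (simp add: f_def)
    moreover have "f x \<le> 0" using iff[of x] r x\<Omega> by (simp add: f_def)
    ultimately have fy: "f y < 0" using t by simp
    have "open (ball x r \<inter> {z. f z < 0})"
      using fc by (intro open_Int open_ball open_Collect_less continuous_intros)
    moreover have "y \<in> closure \<Omega>" using yb d by blast
    ultimately obtain z where "z \<in> \<Omega>" "z \<in> ball x r" "f z < 0"
      using yb(1) fy unfolding closure_iff_nhds_not_empty by blast
    then show False using iff[of z] by (simp add: f_def)
  qed
qed

lemma subspace_L2_on: "subspace (L2_on \<Omega>)"
proof (rule subspaceI)
  have "AE x in lborel. rep_L2 (0::('a, 'b) L2) x = 0"
    unfolding zero_L2_def using rep_abs_L2[OF square_integrable_zero] by simp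
  then show "(0::('a, 'b) L2) \<in> L2_on \<Omega>" unfolding L2_on_def by (auto elim: AE_mp)
  fix u v :: "('a, 'b) L2" assume "u \<in> L2_on \<Omega>" "v \<in> L2_on \<Omega>"
  then have "AE x in lborel. x \<notin> \<Omega> \<longrightarrow> rep_L2 u x = 0" "AE x in lborel. x \<notin> \<Omega> \<longrightarrow> rep_L2 v x = 0"
    by (auto simp: L2_on_def)
  then have "AE x in lborel. x \<notin> \<Omega> \<longrightarrow> rep_L2 (u + v) x = 0"
    using rep_L2_add[of u v] by eventually_elim auto
  then show "u + v \<in> L2_on \<Omega>" by (simp add: L2_on_def)
next
  fix c and u :: "('a, 'b) L2" assume "u \<in> L2_on \<Omega>"
  then have "AE x in lborel. x \<notin> \<Omega> \<longrightarrow> rep_L2 u x = 0" by (auto simp: L2_on_def)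
  moreover have "AE x in lborel. rep_L2 (c *\<^sub>R u) x = c *\<^sub>R rep_L2 u x"
    unfolding scaleR_L2_def by (simp, intro rep_abs_L2 square_integrable_scaleR square_integrable_rep_L2)
  ultimately have "AE x in lborel. x \<notin> \<Omega> \<longrightarrow> rep_L2 (c *\<^sub>R u) x = 0" by eventually_elim auto
  then show "c *\<^sub>R u \<in> L2_on \<Omega>" by (simp add: L2_on_def)
qed

text \<open>The approximation takes the mean of \<open>u\<close> on each element. The elementwise
  estimates add up because almost every point of the domain lies in exactly one element.\<close>

lemma P0_approximation_error:
  fixes \<Omega> :: "'a::euclidean_space set" and u :: "('a, real) L2" and \<sigma> :: "('a, 'a) L2"
  assumes \<Omega>: "open \<Omega>" "bounded \<Omega>" "Lipschitz_domain \<Omega>" and part: "polytopal_partition \<T> (closure \<Omega>)"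
    and u: "u \<in> L2_on \<Omega>" and eq: "\<And>\<tau>. \<tau> \<in> Hdiv \<Omega> \<Longrightarrow> inner \<sigma> \<tau> + inner (divg \<Omega> \<tau>) u = 0"
  shows "\<exists>v\<in>P0 \<Omega> \<T>. (norm (u - v))\<^sup>2 \<le> (Max (diameter ` \<T>))\<^sup>2 / pi\<^sup>2 * (norm \<sigma>)\<^sup>2"
proof -
  define h where "h = Max (diameter ` \<T>)"
  define us where "us x = indicator \<Omega> x *\<^sub>R rep_L2 u x" for x
  \<comment> \<open>Mollification asks for functions that vanish everywhere outside \<Omega>, but
    representatives of classes in \<open>L2_on \<Omega>\<close> do so only almost everywhere, and
    \<sigma> is known only through its equation. The cut leaves the equation intact and does not
    increase the norm.\<close>
  define s where "s x = indicator \<Omega> x *\<^sub>R rep_L2 \<sigma> x" for x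
  have [measurable]: "\<Omega> \<in> sets borel" using \<Omega> by simp
  have cut: "square_integrable (\<lambda>x. indicator \<Omega> x *\<^sub>R rep_L2 k x)" for k :: "('a, 'c::euclidean_space) L2"
  proof -
    have "integrable lborel (\<lambda>x. (norm (rep_L2 k x))\<^sup>2)"
      using square_integrable_rep_L2[of k] by (simp add: square_integrable_def)
    then have "integrable lborel (\<lambda>x. (norm (indicator \<Omega> x *\<^sub>R rep_L2 k x))\<^sup>2)"
      by (rule Bochner_Integration.integrable_bound) (auto simp: indicator_def)
    then show ?thesis by (simp add: square_integrable_def)
  qed
  have us: "square_integrable us" and s: "square_integrable s"
    unfolding us_def[abs_def] s_def[abs_def] by (rule cut)+
  have [measurable]: "us \<in> borel_measurable borel" "s \<in> borel_measurable borel"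
    using us s by (auto simp: square_integrable_def)
  have off: "us x = 0" "s x = 0" if "x \<notin> \<Omega>" for x using that by (auto simp: us_def s_def)
  have ident: "(LINT x|lborel. r x * (s x \<bullet> k)) = - (LINT x|lborel. d x * us x)"
    if "\<And>x. ((\<lambda>t. r (x + t *\<^sub>R k)) has_real_derivative d x) (at 0)" "continuous_on UNIV r" "continuous_on UNIV d" for r d k
    using weak_gradient_identity[OF \<Omega>(1,2) eq that] by (simp add: us_def s_def)
  have approx: "\<exists>v g. continuous_on UNIV v \<and> continuous_on UNIV g \<and>
      (\<forall>x h. ((\<lambda>t. v (x + t *\<^sub>R h)) has_real_derivative g x \<bullet> h) (at 0)) \<and>
      (\<integral>\<^sup>+x. ennreal ((norm (v x - us x))\<^sup>2) \<partial>lborel) \<le> ennreal \<eta> \<and>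
      (\<integral>\<^sup>+x. ennreal ((norm (g x - s x))\<^sup>2) \<partial>lborel) \<le> ennreal \<eta>" if \<eta>: "\<eta> > 0" for \<eta>
    by (rule smooth_approximation[OF \<Omega>(2) us off(1) s off(2) ident \<eta>])
  define m where "m T = (LINT x|lborel. indicator T x * us x) / measure lborel T" for T
  have \<T>: "finite \<T>" "\<And>T. T \<in> \<T> \<Longrightarrow> polytope T" "\<Union>\<T> = closure \<Omega>"
      "\<And>S T. S \<in> \<T> \<Longrightarrow> T \<in> \<T> \<Longrightarrow> S \<noteq> T \<Longrightarrow> interior S \<inter> interior T = {}"
    using part by (auto simp: polytopal_partition_def pairwise_def)
  have comp: "compact T" "convex T" if "T \<in> \<T>" for T
    using \<T>(2)[OF that] polytope_imp_compact polytope_imp_convex by auto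
  have [measurable]: "T \<in> sets borel" if "T \<in> \<T>" for T using comp(1)[OF that] by (rule borel_compact)
  have int_sub: "interior T \<subseteq> \<Omega>" if "T \<in> \<T>" for T
    using interior_mono[of T "closure \<Omega>"] \<T>(3) that interior_closure_Lipschitz_domain[OF \<Omega>(1,3)] by blast
  \<comment> \<open>With interiors, the values of neighbouring elements do not add on common faces,
    and \<open>w\<close> vanishes everywhere outside \<Omega>.\<close>
  define w where "w x = (\<Sum>T\<in>\<T>. m T * indicator (interior T) x)" for x
  have w: "square_integrable w"
  proof -
    have 1: "square_integrable (\<lambda>x. m T * indicator (interior T) x)" if "T \<in> \<T>" for T
      unfolding real_scaleR_def[symmetric]
    proof (intro square_integrable_scaleR square_integrable_indicator)
      show "emeasure lborel (interior T) < \<infinity>"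
        using comp(1)[OF that] by (intro emeasure_bounded_finite bounded_subset[OF compact_imp_bounded interior_subset])
    qed auto
    have "\<T>' \<subseteq> \<T> \<longrightarrow> square_integrable (\<lambda>x. \<Sum>T\<in>\<T>'. m T * indicator (interior T) x)" if "finite \<T>'" for \<T>'
      using that
    proof (induction rule: finite_induct)
      case (insert T F)
      then show ?case
        using square_integrable_add[OF 1[of T], of "\<lambda>x. \<Sum>T\<in>F. m T * indicator (interior T) x"]
        by (simp del: sum_mult_indicator)
    qed (simp add: square_integrable_zero)
    then show ?thesis unfolding w_def[abs_def] using \<T>(1) by blast
  qed
  have [measurable]: "w \<in> borel_measurable borel" using w by (simp add: square_integrable_def)
  have "AE x in lborel. x \<notin> frontier T" if "T \<in> \<T>" for T
    using comp[OF that] by (intro AE_lborel_not_in_negligible negligible_convex_frontier) (auto intro: borel_closed)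
  then have good: "AE x in lborel. \<forall>T\<in>\<T>. x \<notin> frontier T"
    using \<T>(1) by (simp add: AE_finite_all)
  have mem: "x \<in> T \<longleftrightarrow> x \<in> interior T" if "\<forall>T\<in>\<T>. x \<notin> frontier T" "T \<in> \<T>" for x T
    using that comp(1)[OF that(2)] interior_subset by (auto simp: frontier_def compact_imp_closed)
  have single: "(\<exists>T\<in>\<T>. x \<in> \<Omega> \<and> x \<in> interior T \<and> (\<forall>S\<in>\<T>. x \<in> S \<longleftrightarrow> S = T) \<and> (\<forall>S\<in>\<T>. x \<in> interior S \<longleftrightarrow> S = T)) \<or>
      (x \<notin> \<Omega> \<and> (\<forall>S\<in>\<T>. x \<notin> S) \<and> (\<forall>S\<in>\<T>. x \<notin> interior S))" if x: "\<forall>T\<in>\<T>. x \<notin> frontier T" for x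
  proof (cases "x \<in> \<Union>\<T>")
    case True
    then obtain T where T: "T \<in> \<T>" "x \<in> T" by blast
    have "S = T" if "S \<in> \<T>" "x \<in> interior S" for S
      using \<T>(4)[OF that(1) T(1)] that mem[OF x T(1)] T(2) by blast
    then show ?thesis using T mem[OF x] int_sub[OF T(1)] by blast
  next
    case False
    then have "x \<notin> \<Omega>" using \<T>(3) closure_subset by blast
    then show ?thesis using False mem[OF x] by blast
  qed
  let ?v = "abs_L2 w"
  have "?v \<in> L2_on \<Omega>"
  proof (rule abs_L2_in_L2_on[OF w])
    show "w x = 0" if "x \<notin> \<Omega>" for x
      unfolding w_def using that int_sub by (intro sum.neutral) (auto simp: indicator_def)
  qed
  moreover have "\<exists>c. AE x in lborel. x \<in> T \<longrightarrow> rep_L2 ?v x = c" if T: "T \<in> \<T>" for T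
  proof (rule exI[of _ "m T"])
    show "AE x in lborel. x \<in> T \<longrightarrow> rep_L2 ?v x = m T"
      using good rep_abs_L2[OF w]
    proof eventually_elim
      case (elim x)
      show ?case
      proof
        assume xT: "x \<in> T"
        have "\<forall>S\<in>\<T>. x \<in> interior S \<longleftrightarrow> S = T"
          using single[OF elim(1)]
        proof
          assume "\<exists>T\<in>\<T>. x \<in> \<Omega> \<and> x \<in> interior T \<and> (\<forall>S\<in>\<T>. x \<in> S \<longleftrightarrow> S = T) \<and> (\<forall>S\<in>\<T>. x \<in> interior S \<longleftrightarrow> S = T)"
          then obtain T' where T': "\<forall>S\<in>\<T>. x \<in> S \<longleftrightarrow> S = T'" "\<forall>S\<in>\<T>. x \<in> interior S \<longleftrightarrow> S = T'" by blast
          then have "T = T'" using T xT by simp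
          then show ?thesis using T' by simp
        next
          assume "x \<notin> \<Omega> \<and> (\<forall>S\<in>\<T>. x \<notin> S) \<and> (\<forall>S\<in>\<T>. x \<notin> interior S)"
          then show ?thesis using T xT by simp
        qed
        then have "w x = (\<Sum>S\<in>\<T>. if S = T then m T else 0)"
          unfolding w_def by (intro sum.cong) (auto simp: indicator_def)
        then show "rep_L2 ?v x = m T" using elim(2) \<T>(1) T by simp
      qed
    qed
  qed
  ultimately have vP0: "?v \<in> P0 \<Omega> \<T>" by (simp add: P0_def)
  have int_T: "integrable lborel (\<lambda>x. indicator T x * (us x - m T)\<^sup>2)" "integrable lborel (\<lambda>x. indicator T x * (norm (s x))\<^sup>2)"
    if T: "T \<in> \<T>" for T
  proof -
    have [measurable]: "T \<in> sets borel" using T by measurable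
    have "emeasure lborel T < \<infinity>" using comp(1)[OF T] by (intro emeasure_bounded_finite compact_imp_bounded)
    then have "square_integrable (\<lambda>x. us x - m T *\<^sub>R indicator T x)"
      using us by (intro square_integrable_diff square_integrable_scaleR square_integrable_indicator) auto
    then have "integrable lborel (\<lambda>x. (norm (us x - m T *\<^sub>R indicator T x))\<^sup>2)" by (simp add: square_integrable_def)
    then show "integrable lborel (\<lambda>x. indicator T x * (us x - m T)\<^sup>2)"
      by (rule Bochner_Integration.integrable_bound) (auto simp: indicator_def)
    have "integrable lborel (\<lambda>x. (norm (s x))\<^sup>2)" using s by (simp add: square_integrable_def)
    then show "integrable lborel (\<lambda>x. indicator T x * (norm (s x))\<^sup>2)"
      by (rule Bochner_Integration.integrable_bound) (auto simp: indicator_def)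
  qed
  have "(norm (u - ?v))\<^sup>2 = (LINT x|lborel. (norm (rep_L2 (u - ?v) x))\<^sup>2)" by (rule norm_L2_power2)
  also have "\<dots> = (LINT x|lborel. (\<Sum>T\<in>\<T>. indicator T x * (us x - m T)\<^sup>2))"
  proof (rule integral_cong_AE)
    have "AE x in lborel. x \<notin> \<Omega> \<longrightarrow> rep_L2 u x = 0" using u by (simp add: L2_on_def)
    then show "AE x in lborel. (norm (rep_L2 (u - ?v) x))\<^sup>2 = (\<Sum>T\<in>\<T>. indicator T x * (us x - m T)\<^sup>2)"
      using rep_L2_diff[of u ?v] rep_abs_L2[OF w] good
    proof eventually_elim
      case (elim x)
      have ux: "rep_L2 u x = us x" using elim(1) by (auto simp: us_def indicator_def)
      from single[OF elim(4)] show ?case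
      proof
        assume "\<exists>T\<in>\<T>. x \<in> \<Omega> \<and> x \<in> interior T \<and> (\<forall>S\<in>\<T>. x \<in> S \<longleftrightarrow> S = T) \<and> (\<forall>S\<in>\<T>. x \<in> interior S \<longleftrightarrow> S = T)"
        then obtain T where T: "T \<in> \<T>" "\<forall>S\<in>\<T>. x \<in> S \<longleftrightarrow> S = T" "\<forall>S\<in>\<T>. x \<in> interior S \<longleftrightarrow> S = T" by blast
        have "w x = (\<Sum>S\<in>\<T>. if S = T then m T else 0)"
          unfolding w_def using T by (intro sum.cong) (auto simp: indicator_def)
        moreover have "(\<Sum>S\<in>\<T>. indicator S x * (us x - m S)\<^sup>2) = (\<Sum>S\<in>\<T>. if S = T then (us x - m T)\<^sup>2 else 0)"
          using T by (intro sum.cong) (auto simp: indicator_def)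
        ultimately show ?thesis using T(1) \<T>(1) elim ux by simp
      next
        assume "x \<notin> \<Omega> \<and> (\<forall>S\<in>\<T>. x \<notin> S) \<and> (\<forall>S\<in>\<T>. x \<notin> interior S)"
        then have "w x = 0" "us x = 0" "(\<Sum>S\<in>\<T>. indicator S x * (us x - m S)\<^sup>2) = 0"
          unfolding w_def using off by (auto intro!: sum.neutral simp: indicator_def)
        then show ?thesis using elim ux by simp
      qed
    qed
  qed (use int_T in \<open>auto dest: borel_measurable_integrable\<close>)
  also have "\<dots> = (\<Sum>T\<in>\<T>. LINT x|lborel. indicator T x * (us x - m T)\<^sup>2)"
    by (rule Bochner_Integration.integral_sum) (rule int_T)
  also have "\<dots> \<le> (\<Sum>T\<in>\<T>. h\<^sup>2 / pi\<^sup>2 * (LINT x|lborel. indicator T x * (norm (s x))\<^sup>2))"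
  proof (rule sum_mono)
    fix T assume T: "T \<in> \<T>"
    have "(LINT x|lborel. indicator T x * (us x - m T)\<^sup>2) \<le> (diameter T / pi)\<^sup>2 * (LINT x|lborel. indicator T x * (norm (s x))\<^sup>2)"
      unfolding m_def by (rule payne_weinberger[OF comp[OF T] us s approx])
    also have "\<dots> \<le> (h / pi)\<^sup>2 * (LINT x|lborel. indicator T x * (norm (s x))\<^sup>2)"
    proof (intro mult_right_mono power_mono divide_right_mono)
      show "diameter T \<le> h" unfolding h_def using T \<T>(1) by (intro Max_ge) auto
      show "0 \<le> diameter T / pi" using diameter_ge_0[OF compact_imp_bounded[OF comp(1)[OF T]]] by simp
      show "0 \<le> (LINT x|lborel. indicator T x * (norm (s x))\<^sup>2)" by (intro integral_nonneg_AE) simp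
    qed simp
    finally show "(LINT x|lborel. indicator T x * (us x - m T)\<^sup>2) \<le> h\<^sup>2 / pi\<^sup>2 * (LINT x|lborel. indicator T x * (norm (s x))\<^sup>2)"
      by (simp add: power_divide)
  qed
  also have "\<dots> = h\<^sup>2 / pi\<^sup>2 * (LINT x|lborel. (\<Sum>T\<in>\<T>. indicator T x * (norm (s x))\<^sup>2))"
    by (subst Bochner_Integration.integral_sum) (simp_all add: int_T sum_distrib_left)
  also have "\<dots> \<le> h\<^sup>2 / pi\<^sup>2 * (norm \<sigma>)\<^sup>2"
    unfolding norm_L2_power2
  proof (intro mult_left_mono integral_mono_AE)
    show "integrable lborel (\<lambda>x. \<Sum>T\<in>\<T>. indicator T x * (norm (s x))\<^sup>2)"
      by (intro Bochner_Integration.integrable_sum int_T)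
    show "integrable lborel (\<lambda>x. (norm (rep_L2 \<sigma> x))\<^sup>2)"
      using square_integrable_rep_L2[of \<sigma>] by (simp add: square_integrable_def)
    show "AE x in lborel. (\<Sum>T\<in>\<T>. indicator T x * (norm (s x))\<^sup>2) \<le> (norm (rep_L2 \<sigma> x))\<^sup>2"
      using good
    proof eventually_elim
      case (elim x)
      from single[OF elim] show ?case
      proof
        assume "\<exists>T\<in>\<T>. x \<in> \<Omega> \<and> x \<in> interior T \<and> (\<forall>S\<in>\<T>. x \<in> S \<longleftrightarrow> S = T) \<and> (\<forall>S\<in>\<T>. x \<in> interior S \<longleftrightarrow> S = T)"
        then obtain T where T: "T \<in> \<T>" "\<forall>S\<in>\<T>. x \<in> S \<longleftrightarrow> S = T" by blast
        have "(\<Sum>S\<in>\<T>. indicator S x * (norm (s x))\<^sup>2) = (\<Sum>S\<in>\<T>. if S = T then (norm (s x))\<^sup>2 else 0)"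
          using T by (intro sum.cong) (auto simp: indicator_def)
        also have "\<dots> = (norm (s x))\<^sup>2" using T(1) \<T>(1) by simp
        also have "\<dots> \<le> (norm (rep_L2 \<sigma> x))\<^sup>2" by (simp add: s_def indicator_def)
        finally show ?thesis .
      next
        assume "x \<notin> \<Omega> \<and> (\<forall>S\<in>\<T>. x \<notin> S) \<and> (\<forall>S\<in>\<T>. x \<notin> interior S)"
        then have "(\<Sum>S\<in>\<T>. indicator S x * (norm (s x))\<^sup>2) = 0" by (auto intro!: sum.neutral simp: indicator_def)
        then show ?thesis by simp
      qed
    qed
  qed simp
  finally show ?thesis using vP0 unfolding h_def by blast
qed

theorem corollary4p1:
  fixes \<Omega> :: "'a::euclidean_space set"
    and \<T> :: "'a set set"
    and S\<^sub>h :: "('a, 'a) L2 set"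
    and U\<^sub>h :: "('a, real) L2 set"
    and l l\<^sub>h :: "nat \<Rightarrow> real"
    and h :: real
    and J :: nat
  assumes "open \<Omega>" "bounded \<Omega>" "connected \<Omega>" "polytopal \<Omega>" "Lipschitz_domain \<Omega>"
    and "polytopal_partition \<T> (closure \<Omega>)"
    and "h = Max (diameter ` \<T>)"
    and "finite_dim_subspace S\<^sub>h" "S\<^sub>h \<subseteq> Hdiv \<Omega>"
    and "finite_dim_subspace U\<^sub>h" "U\<^sub>h \<subseteq> L2_on \<Omega>"
    and "inf_sup_stable \<Omega> S\<^sub>h U\<^sub>h"
    and "P0 \<Omega> \<T> \<subseteq> U\<^sub>h"
    and "divg \<Omega> ` S\<^sub>h \<subseteq> U\<^sub>h"
    and "eigenvalue_enumeration \<Omega> (Hdiv \<Omega>) (L2_on \<Omega>) {1..} l"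
    and "eigenvalue_enumeration \<Omega> S\<^sub>h U\<^sub>h {1..dim U\<^sub>h} l\<^sub>h"
    and "J \<in> {1..dim U\<^sub>h}"
  shows "l\<^sub>h J / (1 + (h\<^sup>2 / pi\<^sup>2) * l\<^sub>h J) \<le> l J"
proof -
  define \<kappa> where "\<kappa> = h\<^sup>2 / pi\<^sup>2"
  have \<kappa>: "\<kappa> \<ge> 0" by (simp add: \<kappa>_def)
  have J: "1 \<le> J" "J \<le> dim U\<^sub>h" using assms(17) by auto
  have subU: "subspace U\<^sub>h" and subS: "subspace S\<^sub>h" using assms(8,10) by (auto simp: finite_dim_subspace_def)
  obtain B where B: "finite B" "independent B" "B \<subseteq> L2_on \<Omega>" "card B \<ge> card {1..J}"
    "\<And>u. u \<in> span B \<Longrightarrow> \<exists>\<sigma>. (\<forall>\<tau>\<in>Hdiv \<Omega>. inner \<sigma> \<tau> + inner (divg \<Omega> \<tau>) u = 0) \<and> (subspace (Hdiv \<Omega>) \<longrightarrow> \<sigma> \<in> Hdiv \<Omega>) \<and>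
       (\<forall>c. (\<forall>i\<in>{1..J}. l i \<le> c) \<longrightarrow> (norm \<sigma>)\<^sup>2 \<le> c * (norm u)\<^sup>2) \<and>
       (\<forall>c. (\<forall>i\<in>{1..J}. c \<le> l i) \<longrightarrow> c * (norm u)\<^sup>2 \<le> (norm \<sigma>)\<^sup>2)"
    by (rule spectral_subspace[OF assms(15), of "{1..J}"]) auto
  obtain X where X: "finite X" "independent X" "X \<subseteq> U\<^sub>h" "card X \<ge> card {J..dim U\<^sub>h}"
    "\<And>u. u \<in> span X \<Longrightarrow> \<exists>\<sigma>. (\<forall>\<tau>\<in>S\<^sub>h. inner \<sigma> \<tau> + inner (divg \<Omega> \<tau>) u = 0) \<and> (subspace S\<^sub>h \<longrightarrow> \<sigma> \<in> S\<^sub>h) \<and>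
       (\<forall>c. (\<forall>i\<in>{J..dim U\<^sub>h}. l\<^sub>h i \<le> c) \<longrightarrow> (norm \<sigma>)\<^sup>2 \<le> c * (norm u)\<^sup>2) \<and>
       (\<forall>c. (\<forall>i\<in>{J..dim U\<^sub>h}. c \<le> l\<^sub>h i) \<longrightarrow> c * (norm u)\<^sup>2 \<le> (norm \<sigma>)\<^sup>2)"
    by (rule spectral_subspace[OF assms(16), of "{J..dim U\<^sub>h}"]) (use J in auto)
  \<comment> \<open>The index \<open>J\<close> belongs to both ranges, so the sizes J and N - J + 1
    exceed N = \<open>dim U\<^sub>h\<close> by one.\<close>
  have "card B + card X > dim U\<^sub>h" using B(4) X(4) J by simp
  then obtain u x where u: "u \<in> span B" "u \<noteq> 0" and x: "x \<in> span X" and orth: "\<And>w. w \<in> U\<^sub>h \<Longrightarrow> inner (u - x) w = 0"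
    using exists_nonzero_with_projection_in_span[OF assms(10) B(1,2) X(1,2,3)] by blast
  have xU: "x \<in> U\<^sub>h" using x X(3) subU span_minimal by blast
  have uL: "u \<in> L2_on \<Omega>" using u(1) B(3) subspace_L2_on span_minimal by blast
  have mono_l: "\<forall>i\<in>{1..J}. l i \<le> l J"
    using assms(15) J unfolding eigenvalue_enumeration_def by (auto intro: mono_onD)
  have mono_lh: "\<forall>i\<in>{J..dim U\<^sub>h}. l\<^sub>h J \<le> l\<^sub>h i"
    using assms(16) J unfolding eigenvalue_enumeration_def by (auto intro: mono_onD)
  obtain \<sigma> where \<sigma>: "\<And>\<tau>. \<tau> \<in> Hdiv \<Omega> \<Longrightarrow> inner \<sigma> \<tau> + inner (divg \<Omega> \<tau>) u = 0" "(norm \<sigma>)\<^sup>2 \<le> l J * (norm u)\<^sup>2"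
    using B(5)[OF u(1)] mono_l by blast
  obtain \<sigma>\<^sub>h where \<sigma>h: "\<And>\<tau>. \<tau> \<in> S\<^sub>h \<Longrightarrow> inner \<sigma>\<^sub>h \<tau> + inner (divg \<Omega> \<tau>) x = 0" "\<sigma>\<^sub>h \<in> S\<^sub>h" "l\<^sub>h J * (norm x)\<^sup>2 \<le> (norm \<sigma>\<^sub>h)\<^sup>2"
    using X(5)[OF x] mono_lh subS by blast
  have lh0: "l\<^sub>h J \<ge> 0"
    using assms(16,17) mixed_eigenvalue_nonneg unfolding eigenvalue_enumeration_def by blast
  have "(norm \<sigma>\<^sub>h)\<^sup>2 \<le> (norm \<sigma>)\<^sup>2"
  proof -
    have "divg \<Omega> \<sigma>\<^sub>h \<in> U\<^sub>h" using assms(14) \<sigma>h(2) by blast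
    then have "inner (divg \<Omega> \<sigma>\<^sub>h) x = inner (divg \<Omega> \<sigma>\<^sub>h) u"
      using orth[of "divg \<Omega> \<sigma>\<^sub>h"] by (simp add: inner_diff_left inner_commute[of "divg \<Omega> \<sigma>\<^sub>h"])
    then have "(norm \<sigma>\<^sub>h)\<^sup>2 = inner \<sigma> \<sigma>\<^sub>h"
      using \<sigma>h(1)[OF \<sigma>h(2)] \<sigma>(1)[of \<sigma>\<^sub>h] \<sigma>h(2) assms(9) by (auto simp: power2_norm_eq_inner)
    also have "\<dots> \<le> norm \<sigma> * norm \<sigma>\<^sub>h" by (rule norm_cauchy_schwarz)
    finally have "norm \<sigma>\<^sub>h * norm \<sigma>\<^sub>h \<le> norm \<sigma> * norm \<sigma>\<^sub>h" by (simp add: power2_eq_square)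
    then have "norm \<sigma>\<^sub>h \<le> norm \<sigma>" by (cases "norm \<sigma>\<^sub>h = 0") auto
    then show ?thesis by (intro power_mono) auto
  qed
  moreover have "(norm (u - x))\<^sup>2 \<le> \<kappa> * (norm \<sigma>)\<^sup>2"
  proof -
    obtain v where v: "v \<in> P0 \<Omega> \<T>" "(norm (u - v))\<^sup>2 \<le> \<kappa> * (norm \<sigma>)\<^sup>2"
      using P0_approximation_error[OF assms(1,2,5,6) uL \<sigma>(1)] unfolding \<kappa>_def assms(7) by blast
    have "x - v \<in> U\<^sub>h" using subspace_diff[OF subU xU] v(1) assms(13) by blast
    \<comment> \<open>Pythagoras: as the projection, \<open>x\<close> is at least as close to
      \<open>u\<close> as the piecewise constant \<open>v\<close>, which also lies in
      \<open>U\<^sub>h\<close>.\<close>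
    then have "(norm ((u - x) + (x - v)))\<^sup>2 = (norm (u - x))\<^sup>2 + (norm (x - v))\<^sup>2"
      using orth by (simp only: power2_norm_eq_inner inner_add_left inner_add_right inner_commute[of "x - v" "u - x"])
    then have "(norm (u - x))\<^sup>2 \<le> (norm (u - v))\<^sup>2" by simp
    then show ?thesis using v(2) by linarith
  qed
  moreover have "(norm u)\<^sup>2 = (norm (u - x))\<^sup>2 + (norm x)\<^sup>2"
  proof -
    have "(norm ((u - x) + x))\<^sup>2 = (norm (u - x))\<^sup>2 + (norm x)\<^sup>2"
      using orth[OF xU] by (simp only: power2_norm_eq_inner inner_add_left inner_add_right inner_commute[of x "u - x"])
    then show ?thesis by simp
  qed
  ultimately have "(norm u)\<^sup>2 - \<kappa> * (norm \<sigma>)\<^sup>2 \<le> (norm x)\<^sup>2" "(norm \<sigma>\<^sub>h)\<^sup>2 \<le> (norm \<sigma>)\<^sup>2" by linarith+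
  \<comment> \<open>The difference may be negative; multiplying the bound by the discrete eigenvalue
    uses only the sign of the latter.\<close>
  then have "l\<^sub>h J * ((norm u)\<^sup>2 - \<kappa> * (norm \<sigma>)\<^sup>2) \<le> (norm \<sigma>)\<^sup>2"
    using mult_left_mono[OF _ lh0, of "(norm u)\<^sup>2 - \<kappa> * (norm \<sigma>)\<^sup>2" "(norm x)\<^sup>2"] \<sigma>h(3) by linarith
  then have "l\<^sub>h J * (norm u)\<^sup>2 \<le> (1 + \<kappa> * l\<^sub>h J) * (norm \<sigma>)\<^sup>2" by (simp add: algebra_simps)
  also have "\<dots> \<le> (1 + \<kappa> * l\<^sub>h J) * (l J * (norm u)\<^sup>2)"
    using \<sigma>(2) \<kappa> lh0 by (intro mult_left_mono) auto
  finally have "l\<^sub>h J * (norm u)\<^sup>2 \<le> (l J * (1 + \<kappa> * l\<^sub>h J)) * (norm u)\<^sup>2" by (simp add: mult_ac)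
  then have "l\<^sub>h J \<le> l J * (1 + \<kappa> * l\<^sub>h J)" using u(2) by simp
  moreover have "0 < 1 + \<kappa> * l\<^sub>h J" using \<kappa> lh0 by (simp add: add_pos_nonneg)
  ultimately show ?thesis unfolding \<kappa>_def[symmetric] by (simp add: divide_le_eq)
qed

end
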